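(* Let $\mathbf{cHausStoch}$ be the category of (nonempty) compact Hausdorff spaces and continuous stochastic maps, let $\mathbf{cC^*\text{-}AlgPos}$ be the category of commutative unital $C^*$-algebras and positive unital maps, let $C:\mathbf{cHausStoch}^{\mathrm{op}}\to\mathbf{cC^*\text{-}AlgPos}$ be the continuous functions functor and let $\sigma:\mathbf{cC^*\text{-}AlgPos}^{\mathrm{op}}\to\mathbf{cHausStoch}$ be the stochastic spectrum functor. For a compact Hausdorff space $X$ let $h_X:X\to\sigma(C(X))$, $h_X(x)(\varphi):=\varphi(x)$, regarded as the stochastic map $x\mapsto\delta_{h_X(x)}$; for a commutative unital $C^*$-algebra $\mathcal{A}$ let $\Gamma_{\mathcal{A}}:\mathcal{A}\to C(\sigma(\mathcal{A}))$, $\Gamma_{\mathcal{A}}(a)(\chi):=\chi(a)$. Then $h:\mathrm{id}_{\mathbf{cHausStoch}}\Rightarrow\sigma\circ C$ and $\Gamma:\mathrm{id}_{\mathbf{cC^*\text{-}AlgPos}}\Rightarrow C\circ\sigma$ are natural isomorphisms, and $(\sigma,C,\Gamma,h^{-1})$ is an adjoint equivalence between $\mathbf{cC^*\text{-}AlgPos}^{\mathrm{op}}$ and $\mathbf{cHausStoch}$; that is, in addition, the triangle (zig-zag) identities $C(h_X)\circ\Gamma_{C(X)}=\mathrm{id}_{C(X)}$ and $\sigma(\Gamma_{\mathcal{A}})\circ h_{\sigma(\mathcal{A})}=\mathrm{id}_{\sigma(\mathcal{A})}$ hold for all $X$ and $\mathcal{A}$.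
   Context: For a compact Hausdorff space $Y$, $\mathcal{M}_Y$ is its Borel $\sigma$-algebra and $\mathrm{ProbMeas}(Y)$ is the set of regular Borel probability measures on $Y$ (outer regular by open sets and inner regular by compact sets on all Borel sets), with the vague topology: the coarsest topology making $\mu\mapsto\int_Y\varphi\,d\mu$ continuous for every continuous $\varphi:Y\to\mathbb{C}$ (so a net $\mu_\theta$ converges to $\mu$ iff $\int\varphi\,d\mu_\theta\to\int\varphi\,d\mu$ for all $\varphi\in C(Y)$). A (continuous) stochastic map $\mu$ from $X$ to $Y$ is a continuous function $X\to\mathrm{ProbMeas}(Y)$, $x\mapsto\mu_x$. $\mathbf{cHausStoch}$ has compact Hausdorff spaces as objects and stochastic maps as morphisms; the composite of $\mu$ from $X$ to $Y$ followed by $\nu$ from $Y$ to $Z$ is $(\nu\circ\mu)_x(E)=\int_Y\nu_y(E)\,d\mu_x(y)$ for $E\in\mathcal{M}_Z$, and the identity of $X$ is $x\mapsto\delta_x$ (Dirac measure). All $C^*$-algebras are unital with $1\neq0$. A positive (unital) map $f:\mathcal{B}\to\mathcal{A}$ of $C^*$-algebras is a bounded linear map with $f(1_{\mathcal{B}})=1_{\mathcal{A}}$ and $f(b^*b)\ge0$ for all $b$. $\mathbf{cC^*\text{-}AlgPos}$ has commutative unital $C^*$-algebras as objects and positive unital maps as morphisms. The functor $C$ sends $X$ to $C(X)$, the $C^*$-algebra of continuous complex-valued functions with the sup norm, and sends a stochastic map $\mu$ from $X$ to $Y$ to $C^\mu:C(Y)\to C(X)$, $C^\mu(\varphi)(x)=\int_Y\varphi\,d\mu_x$.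 The functor $\sigma$ sends $\mathcal{A}$ to its spectrum $\sigma(\mathcal{A})$, the set of characters (nonzero multiplicative continuous linear functionals $\mathcal{A}\to\mathbb{C}$) with the weak* topology, a compact Hausdorff space. It sends a positive unital map $f:\mathcal{B}\to\mathcal{A}$ to the stochastic map $\sigma^f$ from $\sigma(\mathcal{A})$ to $\sigma(\mathcal{B})$ whose value at $\chi\in\sigma(\mathcal{A})$ is the unique regular Borel probability measure $\sigma^f_\chi$ on $\sigma(\mathcal{B})$ with $\int_{\sigma(\mathcal{B})}\mathrm{ev}_b\,d\sigma^f_\chi=\chi(f(b))$ for all $b\in\mathcal{B}$, where $\mathrm{ev}_b(\psi)=\psi(b)$. *)

theory Defs
  imports "HOL-Probability.Probability" "HOL-Algebra.Module"
begin

text \<open>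
  Objects of both categories live on arbitrary carrier types. A morphism may connect objects over
  different types, so homsets, composition, identities and the functors are polymorphic constants.
  All morphisms and all functions that are elements of a carrier are extensional (they take the
  value \<^term>\<open>undefined\<close> off their domain), so that equality of morphisms is HOL equality.
\<close>

section \<open>Compact Hausdorff spaces and stochastic maps\<close>

definition chaus :: "'x topology \<Rightarrow> bool" where
  "chaus X \<longleftrightarrow> compact_space X \<and> Hausdorff_space X \<and> topspace X \<noteq> {}"

definition borel_of :: "'x topology \<Rightarrow> 'x measure" where
  "borel_of X = sigma (topspace X) {U. openin X U}"

definition regular_measure :: "'x topology \<Rightarrow> 'x measure \<Rightarrow> bool" where
  "regular_measure X M \<longleftrightarrow>
     (\<forall>E\<in>sets M. emeasure M E = (INF U\<in>{U. openin X U \<and> E \<subseteq> U}. emeasure M U)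
               \<and> emeasure M E = (SUP K\<in>{K. compactin X K \<and> K \<subseteq> E}. emeasure M K))"

definition prob_meas :: "'x topology \<Rightarrow> 'x measure set" where
  "prob_meas X = {M. space M = topspace X \<and> sets M = sets (borel_of X) \<and> prob_space M
                   \<and> regular_measure X M}"

definition vague_topology :: "'x topology \<Rightarrow> 'x measure topology" where
  "vague_topology X = topology_generated_by
     {{M \<in> prob_meas X. (\<integral>x. \<phi> x \<partial>M) \<in> U} |\<phi> (U :: complex set).
        continuous_map X euclidean \<phi> \<and> open U}"

definition stoch :: "'x topology \<Rightarrow> 'y topology \<Rightarrow> ('x \<Rightarrow> 'y measure) set" where
  "stoch X Y = {\<mu> \<in> extensional (topspace X). continuous_map X (vague_topology Y) \<mu>}"

text \<open>
  \<open>stoch_comp X Z \<nu> \<mu>\<close> is \<open>\<nu>\<close> after \<open>\<mu>\<close>. If the set function below were not countably additive,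
  \<^const>\<open>measure_of\<close> would return the zero measure, which is not a probability measure.
\<close>
definition stoch_comp ::
    "'x topology \<Rightarrow> 'z topology \<Rightarrow> ('y \<Rightarrow> 'z measure) \<Rightarrow> ('x \<Rightarrow> 'y measure) \<Rightarrow> 'x \<Rightarrow> 'z measure" where
  "stoch_comp X Z \<nu> \<mu> =
     (\<lambda>x\<in>topspace X. measure_of (topspace Z) (sets (borel_of Z))
                        (\<lambda>E. \<integral>\<^sup>+y. emeasure (\<nu> y) E \<partial>(\<mu> x)))"

definition dirac_map :: "'x topology \<Rightarrow> 'y topology \<Rightarrow> ('x \<Rightarrow> 'y) \<Rightarrow> 'x \<Rightarrow> 'y measure" where
  "dirac_map X Y f = (\<lambda>x\<in>topspace X. return (borel_of Y) (f x))"

definition stoch_id :: "'x topology \<Rightarrow> 'x \<Rightarrow> 'x measure" where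
  "stoch_id X = dirac_map X X (\<lambda>x. x)"

definition stoch_iso :: "'x topology \<Rightarrow> 'y topology \<Rightarrow> ('x \<Rightarrow> 'y measure) \<Rightarrow> bool" where
  "stoch_iso X Y \<mu> \<longleftrightarrow> \<mu> \<in> stoch X Y \<and>
     (\<exists>\<nu>\<in>stoch Y X. stoch_comp X X \<nu> \<mu> = stoch_id X \<and> stoch_comp Y Y \<mu> \<nu> = stoch_id Y)"

section \<open>Commutative unital C*-algebras and positive unital maps\<close>

record 'a cstar_algebra = "(complex, 'a) module" +
  adj :: "'a \<Rightarrow> 'a"
  cnorm :: "'a \<Rightarrow> real"

definition complex_ring :: "complex ring" where
  "complex_ring = \<lparr>carrier = UNIV, mult = (*), one = 1, zero = 0, add = (+)\<rparr>"

text \<open>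
  The case distinction is needed because the locale \<^locale>\<open>Metric_space\<close> requires nonnegativity
  and symmetry of the distance also off the carrier.
\<close>
definition cstar_dist :: "'a cstar_algebra \<Rightarrow> 'a \<Rightarrow> 'a \<Rightarrow> real" where
  "cstar_dist A a b =
     (if a \<in> carrier A \<and> b \<in> carrier A then cnorm A (a \<ominus>\<^bsub>A\<^esub> b) else 0)"

text \<open>Commutativity is part of the locale \<^locale>\<open>algebra\<close>.\<close>
locale comm_cstar_algebra = algebra complex_ring A for A :: "'a cstar_algebra" +
  assumes one_neq_zero: "\<one>\<^bsub>A\<^esub> \<noteq> \<zero>\<^bsub>A\<^esub>"
    and cnorm_nonneg: "a \<in> carrier A \<Longrightarrow> 0 \<le> cnorm A a"
    and cnorm_eq_0_iff: "a \<in> carrier A \<Longrightarrow> cnorm A a = 0 \<longleftrightarrow> a = \<zero>\<^bsub>A\<^esub>"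
    and cnorm_triangle:
      "\<lbrakk>a \<in> carrier A; b \<in> carrier A\<rbrakk> \<Longrightarrow> cnorm A (a \<oplus>\<^bsub>A\<^esub> b) \<le> cnorm A a + cnorm A b"
    and cnorm_smult: "a \<in> carrier A \<Longrightarrow> cnorm A (c \<odot>\<^bsub>A\<^esub> a) = cmod c * cnorm A a"
    and cnorm_mult:
      "\<lbrakk>a \<in> carrier A; b \<in> carrier A\<rbrakk> \<Longrightarrow> cnorm A (a \<otimes>\<^bsub>A\<^esub> b) \<le> cnorm A a * cnorm A b"
    and complete: "Metric_space.mcomplete (carrier A) (cstar_dist A)"
    and adj_closed: "a \<in> carrier A \<Longrightarrow> adj A a \<in> carrier A"
    and adj_adj: "a \<in> carrier A \<Longrightarrow> adj A (adj A a) = a"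
    and adj_add:
      "\<lbrakk>a \<in> carrier A; b \<in> carrier A\<rbrakk> \<Longrightarrow> adj A (a \<oplus>\<^bsub>A\<^esub> b) = adj A a \<oplus>\<^bsub>A\<^esub> adj A b"
    and adj_smult: "a \<in> carrier A \<Longrightarrow> adj A (c \<odot>\<^bsub>A\<^esub> a) = cnj c \<odot>\<^bsub>A\<^esub> adj A a"
    and adj_mult:
      "\<lbrakk>a \<in> carrier A; b \<in> carrier A\<rbrakk> \<Longrightarrow> adj A (a \<otimes>\<^bsub>A\<^esub> b) = adj A b \<otimes>\<^bsub>A\<^esub> adj A a"
    and cstar_identity: "a \<in> carrier A \<Longrightarrow> cnorm A (adj A a \<otimes>\<^bsub>A\<^esub> a) = (cnorm A a)\<^sup>2"

definition cpositive :: "'a cstar_algebra \<Rightarrow> 'a \<Rightarrow> bool" where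
  "cpositive A a \<longleftrightarrow> (\<exists>c\<in>carrier A. a = adj A c \<otimes>\<^bsub>A\<^esub> c)"

definition pos_maps :: "'b cstar_algebra \<Rightarrow> 'a cstar_algebra \<Rightarrow> ('b \<Rightarrow> 'a) set" where
  "pos_maps B A = {f \<in> carrier B \<rightarrow>\<^sub>E carrier A.
     (\<forall>x\<in>carrier B. \<forall>y\<in>carrier B. f (x \<oplus>\<^bsub>B\<^esub> y) = f x \<oplus>\<^bsub>A\<^esub> f y) \<and>
     (\<forall>c. \<forall>x\<in>carrier B. f (c \<odot>\<^bsub>B\<^esub> x) = c \<odot>\<^bsub>A\<^esub> f x) \<and>
     (\<exists>K. \<forall>x\<in>carrier B. cnorm A (f x) \<le> K * cnorm B x) \<and>
     f \<one>\<^bsub>B\<^esub> = \<one>\<^bsub>A\<^esub> \<and>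
     (\<forall>b\<in>carrier B. cpositive A (f (adj B b \<otimes>\<^bsub>B\<^esub> b)))}"

definition pos_comp :: "'c cstar_algebra \<Rightarrow> ('b \<Rightarrow> 'a) \<Rightarrow> ('c \<Rightarrow> 'b) \<Rightarrow> 'c \<Rightarrow> 'a" where
  "pos_comp D f g = compose (carrier D) f g"

definition pos_id :: "'a cstar_algebra \<Rightarrow> 'a \<Rightarrow> 'a" where
  "pos_id A = (\<lambda>a\<in>carrier A. a)"

definition pos_iso :: "'b cstar_algebra \<Rightarrow> 'a cstar_algebra \<Rightarrow> ('b \<Rightarrow> 'a) \<Rightarrow> bool" where
  "pos_iso B A f \<longleftrightarrow> f \<in> pos_maps B A \<and>
     (\<exists>g\<in>pos_maps A B. pos_comp B g f = pos_id B \<and> pos_comp A f g = pos_id A)"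

section \<open>The continuous functions functor\<close>

definition C_obj :: "'x topology \<Rightarrow> ('x \<Rightarrow> complex) cstar_algebra" where
  "C_obj X =
     \<lparr>carrier = {\<phi> \<in> extensional (topspace X). continuous_map X euclidean \<phi>},
      mult = (\<lambda>\<phi> \<psi>. \<lambda>x\<in>topspace X. \<phi> x * \<psi> x),
      one = (\<lambda>x\<in>topspace X. 1),
      zero = (\<lambda>x\<in>topspace X. 0),
      add = (\<lambda>\<phi> \<psi>. \<lambda>x\<in>topspace X. \<phi> x + \<psi> x),
      smult = (\<lambda>c \<phi>. \<lambda>x\<in>topspace X. c * \<phi> x),
      adj = (\<lambda>\<phi>. \<lambda>x\<in>topspace X. cnj (\<phi> x)),
      cnorm = (\<lambda>\<phi>. SUP x\<in>topspace X. cmod (\<phi> x))\<rparr>"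

definition C_map ::
    "'x topology \<Rightarrow> 'y topology \<Rightarrow> ('x \<Rightarrow> 'y measure) \<Rightarrow> ('y \<Rightarrow> complex) \<Rightarrow> 'x \<Rightarrow> complex" where
  "C_map X Y \<mu> = (\<lambda>\<phi>\<in>carrier (C_obj Y). \<lambda>x\<in>topspace X. \<integral>y. \<phi> y \<partial>(\<mu> x))"

section \<open>The stochastic spectrum functor\<close>

definition characters :: "'a cstar_algebra \<Rightarrow> ('a \<Rightarrow> complex) set" where
  "characters A = {\<omega> \<in> extensional (carrier A).
     (\<forall>a\<in>carrier A. \<forall>b\<in>carrier A. \<omega> (a \<oplus>\<^bsub>A\<^esub> b) = \<omega> a + \<omega> b) \<and>
     (\<forall>c. \<forall>a\<in>carrier A. \<omega> (c \<odot>\<^bsub>A\<^esub> a) = c * \<omega> a) \<and>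
     (\<forall>a\<in>carrier A. \<forall>b\<in>carrier A. \<omega> (a \<otimes>\<^bsub>A\<^esub> b) = \<omega> a * \<omega> b) \<and>
     (\<exists>a\<in>carrier A. \<omega> a \<noteq> 0) \<and>
     continuous_map (Metric_space.mtopology (carrier A) (cstar_dist A)) euclidean \<omega>}"

text \<open>The weak* topology is the topology of pointwise convergence on the carrier.\<close>
definition spec_obj :: "'a cstar_algebra \<Rightarrow> ('a \<Rightarrow> complex) topology" where
  "spec_obj A = subtopology (product_topology (\<lambda>_. euclidean) (carrier A)) (characters A)"

definition represents ::
    "'b cstar_algebra \<Rightarrow> ('b \<Rightarrow> 'a) \<Rightarrow> ('a \<Rightarrow> complex) \<Rightarrow> ('b \<Rightarrow> complex) measure \<Rightarrow> bool" where
  "represents B f \<omega> M \<longleftrightarrow>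
     M \<in> prob_meas (spec_obj B) \<and> (\<forall>b\<in>carrier B. (\<integral>\<psi>. \<psi> b \<partial>M) = \<omega> (f b))"

definition spec_map ::
    "'b cstar_algebra \<Rightarrow> 'a cstar_algebra \<Rightarrow> ('b \<Rightarrow> 'a)
      \<Rightarrow> ('a \<Rightarrow> complex) \<Rightarrow> ('b \<Rightarrow> complex) measure" where
  "spec_map B A f = (\<lambda>\<omega>\<in>characters A. THE M. represents B f \<omega> M)"

section \<open>The two natural transformations\<close>

definition h_fun :: "'x topology \<Rightarrow> 'x \<Rightarrow> ('x \<Rightarrow> complex) \<Rightarrow> complex" where
  "h_fun X x = (\<lambda>\<phi>\<in>carrier (C_obj X). \<phi> x)"

definition h_map :: "'x topology \<Rightarrow> 'x \<Rightarrow> (('x \<Rightarrow> complex) \<Rightarrow> complex) measure" where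
  "h_map X = dirac_map X (spec_obj (C_obj X)) (h_fun X)"

definition Gelfand :: "'a cstar_algebra \<Rightarrow> 'a \<Rightarrow> ('a \<Rightarrow> complex) \<Rightarrow> complex" where
  "Gelfand A = (\<lambda>a\<in>carrier A. \<lambda>\<omega>\<in>characters A. \<omega> a)"

end

theory Submission
  imports Defs
begin

text \<open>
  A regular probability measure is determined by its integrals of continuous functions, and by the
  Riesz representation theorem every positive unital functional on \<open>C X\<close> is such an integral. So all
  identities between stochastic maps are identities between functionals. The only delicate one is
  that composition of kernels stays regular: for open \<open>U\<close> the function \<open>y \<mapsto> \<nu>\<^sub>y U\<close> is the supremum of an
  upward directed family of continuous functions, which inner regularity allows to exchange with
  the integral.

  Gelfand duality is obtained without ideals and spectra. For an element \<open>a\<close>, a minimal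
  square-preserving seminorm \<open>p\<close> among those with \<open>p (x a) = p x \<parallel>a\<parallel>\<close> (Zorn) is multiplicative. Over the
  complex numbers a multiplicative seminorm is the modulus of a character \<open>\<omega>\<close>, by Ostrowski's
  argument, and \<open>\<bar>\<omega> a\<bar> = \<parallel>a\<parallel>\<close>. Hence the Gelfand map is isometric, and it is surjective by the
  Stone--Weierstrass theorem and completeness. A positive map followed by a character is a positive
  functional on \<open>C (\<sigma> B)\<close>, whose Riesz measure is the value of the stochastic spectrum.
\<close>

section \<open>Regular Borel measures\<close>

text \<open>Regularity is always verified in one shape: open sets are approximated from inside by
  closed sets. By \<open>prob_measI_inner_open\<close> this implies both approximations for all
  Borel sets, so it is the only condition checked for Dirac measures, Riesz measures and composites.
  Test functions vanish off an open set instead of having their support inside it; where compactness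
  is required, a level set \<open>{x. e \<le> \<phi> x}\<close> replaces the support at the price of
  an error \<open>e\<close>, which explains most of the fractions of \<open>e\<close>. On the
  algebraic side, the C*-identity and commutativity make the norm preserve squares, and this plays
  the part of the spectral radius formula. Minimality yields multiplicativity because localising a
  seminorm at \<open>b\<close> can only lower it and makes \<open>b\<close> multiplicative. Once the
  Gelfand map is onto, every continuous function on a spectrum is an evaluation at an element, so
  stochastic maps into a spectrum are compared, and their continuity is checked, on evaluations
  alone.\<close>

lemma space_borel_of [simp]: "space (borel_of X) = topspace X"
  unfolding borel_of_def by (rule space_measure_of) (auto dest: openin_subset)

lemma sets_borel_of: "sets (borel_of X) = sigma_sets (topspace X) {U. openin X U}"
  unfolding borel_of_def by (rule sets_measure_of) (auto dest: openin_subset)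

lemma openin_sets_borel_of: "openin X U \<Longrightarrow> U \<in> sets (borel_of X)"
  by (simp add: sets_borel_of)

lemma closedin_sets_borel_of: "closedin X U \<Longrightarrow> U \<in> sets (borel_of X)"
  by (metis closedin_def openin_sets_borel_of sets.compl_sets space_borel_of double_diff subset_refl)

lemma continuous_map_borel_of:
  fixes f :: "'x \<Rightarrow> 'b::topological_space"
  assumes "continuous_map X euclidean f"
  shows "f \<in> borel_measurable (borel_of X)"
proof (rule borel_measurableI)
  fix S :: "'b set" assume "open S"
  then have "openin X {x \<in> topspace X. f x \<in> S}"
    using assms by (simp add: openin_continuous_map_preimage)
  moreover have "{x \<in> topspace X. f x \<in> S} = f -` S \<inter> space (borel_of X)" by auto
  ultimately show "f -` S \<inter> space (borel_of X) \<in> sets (borel_of X)"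
    using openin_sets_borel_of by metis
qed

lemma prob_measD:
  assumes "M \<in> prob_meas X"
  shows "space M = topspace X" "sets M = sets (borel_of X)" "prob_space M" "regular_measure X M"
  using assms by (auto simp: prob_meas_def)

lemma prob_meas_measurable:
  assumes "M \<in> prob_meas X" "f \<in> borel_measurable (borel_of X)"
  shows "f \<in> borel_measurable M"
  using assms measurable_cong_sets prob_measD(2) by blast

lemma chaus_normal: "chaus X \<Longrightarrow> normal_space X"
  by (simp add: chaus_def compact_Hausdorff_or_regular_imp_normal_space)

lemma chaus_closed_eq_compact: "chaus X \<Longrightarrow> closedin X K \<longleftrightarrow> compactin X K"
  by (meson chaus_def closedin_compact_space compactin_imp_closedin)

lemma continuous_map_bounded:
  fixes f :: "'x \<Rightarrow> 'b::real_normed_vector"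
  assumes "chaus X" "continuous_map X euclidean f"
  obtains B where "\<And>x. x \<in> topspace X \<Longrightarrow> norm (f x) \<le> B"
proof -
  have "compactin euclidean (f ` topspace X)"
    using assms image_compactin unfolding chaus_def compact_space_def by blast
  then have "bounded (f ` topspace X)" by (simp add: compact_imp_bounded)
  then show ?thesis using that unfolding bounded_iff by auto
qed

lemma integrable_continuous:
  fixes f :: "'x \<Rightarrow> 'b::{banach, second_countable_topology}"
  assumes "chaus X" "M \<in> prob_meas X" "continuous_map X euclidean f"
  shows "integrable M f"
proof -
  interpret prob_space M using assms prob_measD by blast
  obtain B where "\<And>x. x \<in> topspace X \<Longrightarrow> norm (f x) \<le> B"
    using continuous_map_bounded assms by blast
  then show ?thesis
    by (intro integrable_const_bound[of _ B])
       (auto simp: prob_measD[OF assms(2)] prob_meas_measurable[OF assms(2)] continuous_map_borel_of assms(3) intro!: AE_I2)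
qed

section \<open>Bump functions and the measure of open sets\<close>

lemma closedin_superlevel:
  "continuous_map X euclideanreal \<phi> \<Longrightarrow> closedin X {x \<in> topspace X. e \<le> \<phi> x}"
  using closedin_continuous_map_preimage[of X euclideanreal \<phi> "{e..}"] by simp

lemma openin_superlevel:
  "continuous_map X euclideanreal \<phi> \<Longrightarrow> openin X {x \<in> topspace X. e < \<phi> x}"
  using openin_continuous_map_preimage[of X euclideanreal \<phi> "{e<..}"] by simp

text \<open>The functions vanish off \<open>U\<close>, but their support may leave \<open>U\<close>.
  This keeps the family closed under maxima; a compact subset of \<open>U\<close> is obtained from a
  level set of a bump instead of its support.\<close>

definition bumps :: "'x topology \<Rightarrow> 'x set \<Rightarrow> ('x \<Rightarrow> real) set" where
  "bumps X U = {\<phi>. continuous_map X euclideanreal \<phi> \<and> (\<forall>x\<in>topspace X. 0 \<le> \<phi> x \<and> \<phi> x \<le> 1)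
                  \<and> (\<forall>x\<in>topspace X - U. \<phi> x = 0)}"

lemma bump_exists:
  assumes "chaus X" "closedin X K" "openin X U" "K \<subseteq> U"
  obtains \<phi> where "\<phi> \<in> bumps X U" "\<And>x. x \<in> K \<Longrightarrow> \<phi> x = 1"
proof -
  have "closedin X (topspace X - U)" using assms by blast
  moreover have "disjnt (topspace X - U) K" using assms by (auto simp: disjnt_def)
  ultimately obtain f where f: "continuous_map X (top_of_set {0..1::real}) f"
      "f ` (topspace X - U) \<subseteq> {0}" "f ` K \<subseteq> {1}"
    using Urysohn_lemma[OF chaus_normal[OF assms(1)], of "topspace X - U" K 0 1] assms(2) by auto
  have "f \<in> bumps X U"
    using f by (auto simp: bumps_def continuous_map_in_subtopology)
  then show ?thesis using that f(3) by auto
qed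

lemma bump_integral_bounds:
  assumes X: "chaus X" and M: "M \<in> prob_meas X" and \<phi>: "\<phi> \<in> bumps X U" and U: "U \<in> sets M"
  shows "integrable M \<phi>" "0 \<le> (\<integral>x. \<phi> x \<partial>M)" "(\<integral>x. \<phi> x \<partial>M) \<le> measure M U"
proof -
  interpret prob_space M using M prob_measD by blast
  show i: "integrable M \<phi>" using integrable_continuous[OF X M] \<phi> by (auto simp: bumps_def)
  show "0 \<le> (\<integral>x. \<phi> x \<partial>M)" using \<phi>
    by (intro Bochner_Integration.integral_nonneg) (auto simp: bumps_def prob_measD(1)[OF M])
  have "(\<integral>x. \<phi> x \<partial>M) \<le> (\<integral>x. indicator U x \<partial>M)"
    using i U \<phi> by (intro integral_mono) (auto simp: bumps_def prob_measD(1)[OF M] emeasure_eq_measure split: split_indicator)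
  then show "(\<integral>x. \<phi> x \<partial>M) \<le> measure M U" using U by simp
qed

lemma inner_closed_approx:
  assumes X: "chaus X" and M: "M \<in> prob_meas X" and U: "openin X U" and e: "0 < (e::real)"
  obtains K where "closedin X K" "K \<subseteq> U" "measure M U < measure M K + e"
proof -
  interpret prob_space M using M prob_measD by blast
  have US: "U \<in> sets M" using U prob_measD[OF M] openin_sets_borel_of by auto
  show ?thesis
  \<comment> \<open>Null sets are separate because \<open>ennreal\<close> truncates negative reals
    to 0, so that \<open>ennreal (measure M U - e) < emeasure M U\<close> fails for them.\<close>
  proof (cases "measure M U = 0")
    case True
    then show ?thesis using that[of "{}"] e by simp
  next
    case False
    then have pos: "0 < measure M U" by (simp add: zero_less_measure_iff)
    have "emeasure M U = (SUP K\<in>{K. compactin X K \<and> K \<subseteq> U}. emeasure M K)"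
      using prob_measD(4)[OF M] US unfolding regular_measure_def by blast
    moreover have "ennreal (measure M U - e) < emeasure M U"
      using e pos by (auto simp: emeasure_eq_measure intro!: ennreal_lessI)
    ultimately obtain K where K: "compactin X K" "K \<subseteq> U" "ennreal (measure M U - e) < emeasure M K"
      by (auto simp: less_SUP_iff)
    have "measure M U - e < measure M K"
      using K(3) by (metis not_le ennreal_leI emeasure_eq_measure)
    then show ?thesis using K that X chaus_closed_eq_compact by force
  qed
qed

text \<open>A bump squeezed between \<open>U\<close> and a closed subset of nearly full measure has
  nearly the measure of \<open>U\<close> as its integral. The measure of an open set is thus a
  supremum of integrals of continuous functions.\<close>

lemma bump_approx:
  assumes X: "chaus X" and M: "M \<in> prob_meas X" and U: "openin X U" and e: "0 < (e::real)"
  obtains \<phi> where "\<phi> \<in> bumps X U" "measure M U < (\<integral>x. \<phi> x \<partial>M) + e"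
proof -
  interpret prob_space M using M prob_measD by blast
  have US: "U \<in> sets M" using U prob_measD[OF M] openin_sets_borel_of by auto
  obtain K where K: "closedin X K" "K \<subseteq> U" "measure M U < measure M K + e"
    using inner_closed_approx[OF X M U e] by blast
  have KS: "K \<in> sets M" using prob_measD[OF M] closedin_sets_borel_of K(1) by auto
  obtain \<phi> where \<phi>: "\<phi> \<in> bumps X U" "\<And>x. x \<in> K \<Longrightarrow> \<phi> x = 1"
    using bump_exists[OF X K(1) U K(2)] by blast
  have "measure M K = (\<integral>x. indicator K x \<partial>M)" using KS by simp
  also have "\<dots> \<le> (\<integral>x. \<phi> x \<partial>M)"
    using bump_integral_bounds(1)[OF X M \<phi>(1) US] KS \<phi>
    by (intro integral_mono) (auto simp: bumps_def prob_measD(1)[OF M] emeasure_eq_measure split: split_indicator)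
  finally show ?thesis using that[OF \<phi>(1)] K(3) by linarith
qed

text \<open>By \<open>bump_approx\<close> the integrals fix the measures of open sets, and the open
  sets form a generator closed under intersection.\<close>

lemma prob_meas_eqI:
  assumes X: "chaus X" and M: "M \<in> prob_meas X" and N: "N \<in> prob_meas X"
    and eq: "\<And>\<phi>::'x \<Rightarrow> real. continuous_map X euclideanreal \<phi> \<Longrightarrow> (\<integral>x. \<phi> x \<partial>M) = (\<integral>x. \<phi> x \<partial>N)"
  shows "M = (N :: 'x measure)"
proof -
  interpret M: prob_space M using M prob_measD by blast
  interpret N: prob_space N using N prob_measD by blast
  have le: "measure M' U \<le> measure N' U"
    if M': "M' \<in> prob_meas X" and N': "N' \<in> prob_meas X" and U: "openin X U"
      and eq: "\<And>\<phi>::'x \<Rightarrow> real. continuous_map X euclideanreal \<phi> \<Longrightarrow> (\<integral>x. \<phi> x \<partial>M') = (\<integral>x. \<phi> x \<partial>N')"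
    for M' N' :: "'x measure" and U
  proof (rule field_le_epsilon)
    fix e :: real assume "0 < e"
    then obtain \<phi> where \<phi>: "\<phi> \<in> bumps X U" "measure M' U < (\<integral>x. \<phi> x \<partial>M') + e"
      using bump_approx[OF X M' U] by blast
    have "(\<integral>x. \<phi> x \<partial>M') = (\<integral>x. \<phi> x \<partial>N')" using \<phi>(1) eq by (auto simp: bumps_def)
    moreover have "\<dots> \<le> measure N' U"
      using bump_integral_bounds(3)[OF X N' \<phi>(1)] U openin_sets_borel_of prob_measD(2)[OF N'] by auto
    ultimately show "measure M' U \<le> measure N' U + e" using \<phi> by linarith
  qed
  show ?thesis
  proof (rule measure_eqI_generator_eq[where E="{U. openin X U}" and \<Omega>="topspace X" and A="\<lambda>_. topspace X"])
    show "Int_stable {U. openin X U}" by (auto simp: Int_stable_def)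
    show "{U. openin X U} \<subseteq> Pow (topspace X)" by (auto dest: openin_subset)
    show "sets M = sigma_sets (topspace X) {U. openin X U}" "sets N = sigma_sets (topspace X) {U. openin X U}"
      using prob_measD(2)[OF M] prob_measD(2)[OF N] sets_borel_of by metis+
    fix U assume "U \<in> {U. openin X U}"
    then show "emeasure M U = emeasure N U"
      using le[OF M N _ eq, of U] le[OF N M _ eq[symmetric], of U]
      by (simp add: M.emeasure_eq_measure N.emeasure_eq_measure order_antisym)
  qed auto
qed

text \<open>The Borel sets squeezed between a closed and an open set of nearly equal measure form a
  sigma-algebra.\<close>

lemma prob_measI_inner_open:
  assumes X: "chaus X" and sp: "sets M = sets (borel_of X)" and "prob_space M"
    and inner: "\<And>U e. openin X U \<Longrightarrow> 0 < (e::real) \<Longrightarrow> \<exists>K. closedin X K \<and> K \<subseteq> U \<and> measure M U < measure M K + e"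
  shows "M \<in> prob_meas X"
proof -
  interpret prob_space M by fact
  have space: "space M = topspace X" using sp sets_eq_imp_space_eq space_borel_of by metis
  have oS: "openin X U \<Longrightarrow> U \<in> sets M" and cS: "closedin X U \<Longrightarrow> U \<in> sets M" for U
    using sp openin_sets_borel_of closedin_sets_borel_of by auto
  have sq: "\<forall>e>0. \<exists>K U. closedin X K \<and> openin X U \<and> K \<subseteq> E \<and> E \<subseteq> U \<and> measure M (U - K) < e"
    if "E \<in> sigma_sets (topspace X) {U. openin X U}" for E
    using that
  proof (induction E)
    case (Basic U)
    show ?case
    proof (intro allI impI)
      fix e :: real assume "0 < e"
      then obtain K where K: "closedin X K" "K \<subseteq> U" "measure M U < measure M K + e"
        using inner Basic by blast
      then have "measure M (U - K) < e"
        using Basic oS cS by (subst finite_measure_Diff) auto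
      then show "\<exists>K U'. closedin X K \<and> openin X U' \<and> K \<subseteq> U \<and> U \<subseteq> U' \<and> measure M (U' - K) < e"
        using K Basic by blast
    qed
  next
    case Empty
    show ?case by (intro allI impI exI[of _ "{}"]) auto
  next
    case (Compl E)
    show ?case
    proof (intro allI impI)
      fix e :: real assume "0 < e"
      then obtain K U where KU: "closedin X K" "openin X U" "K \<subseteq> E" "E \<subseteq> U" "measure M (U - K) < e"
        using Compl.IH[rule_format, OF \<open>0 < e\<close>] by blast
      \<comment> \<open>Complementation exchanges the roles of the closed and the open set and
        leaves their difference unchanged.\<close>
      have eq: "(topspace X - K) - (topspace X - U) = U - K" using KU openin_subset by blast
      show "\<exists>K U. closedin X K \<and> openin X U \<and> K \<subseteq> topspace X - E \<and> topspace X - E \<subseteq> U \<and> measure M (U - K) < e"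
      proof (intro exI conjI)
        show "closedin X (topspace X - U)" "openin X (topspace X - K)" using KU by auto
        show "topspace X - U \<subseteq> topspace X - E" "topspace X - E \<subseteq> topspace X - K" using KU by auto
        show "measure M ((topspace X - K) - (topspace X - U)) < e" using KU eq by simp
      qed
    qed
  next
    case (Union E)
    show ?case
    proof (intro allI impI)
      fix e :: real assume e: "0 < e"
      \<comment> \<open>The geometric errors add up to \<open>e/2\<close>; the other half of
        \<open>e\<close> is kept for cutting the union of the \<open>K i\<close> down to a finite
        one.\<close>
      have "\<exists>K U. closedin X K \<and> openin X U \<and> K \<subseteq> E i \<and> E i \<subseteq> U \<and> measure M (U - K) < e / 4 * (1/2)^i" for i
        using Union.IH[of i, rule_format, of "e / 4 * (1/2)^i"] e by simp
      then obtain K U where KU: "\<And>i. closedin X (K i)" "\<And>i. openin X (U i)" "\<And>i. K i \<subseteq> E i" "\<And>i. E i \<subseteq> U i"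
          "\<And>i. measure M (U i - K i) < e / 4 * (1/2)^i"
        by metis
      have [simp, measurable]: "K i \<in> sets M" "U i \<in> sets M" for i using KU oS cS by auto
      have sm: "summable (\<lambda>i. e / 4 * (1/2::real)^i)" by (intro summable_mult summable_geometric) auto
      have su: "(\<Sum>i. e / 4 * (1/2::real)^i) = e/2"
        by (subst suminf_mult) (auto simp: suminf_geometric intro!: summable_geometric)
      have "measure M ((\<Union>i. U i) - (\<Union>i. K i)) \<le> measure M (\<Union>i. U i - K i)"
        by (intro finite_measure_mono) auto
      also have "\<dots> \<le> (\<Sum>i. measure M (U i - K i))"
        using KU(5) by (intro finite_measure_subadditive_countably summable_comparison_test'[OF sm, of 0])
           (auto intro: less_imp_le)
      also have "\<dots> \<le> (\<Sum>i. e / 4 * (1/2)^i)"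
        using KU(5) by (intro suminf_le sm summable_comparison_test'[OF sm, of 0]) (auto intro: less_imp_le)
      finally have 1: "measure M ((\<Union>i. U i) - (\<Union>i. K i)) \<le> e/2" using su by simp
      \<comment> \<open>An infinite union of closed sets need not be closed, so only finitely many
        \<open>K i\<close> are kept; continuity from below makes the loss less than
        \<open>e/2\<close>.\<close>
      have "(\<lambda>n. measure M (\<Union>i\<le>n. K i)) \<longlonglongrightarrow> measure M (\<Union>n. \<Union>i\<le>n. K i)"
        by (intro finite_Lim_measure_incseq) (auto simp: incseq_def intro: order_trans)
      moreover have "(\<Union>n. \<Union>i\<le>n. K i) = (\<Union>i. K i)" by auto
      ultimately have "(\<lambda>n. measure M (\<Union>i\<le>n. K i)) \<longlonglongrightarrow> measure M (\<Union>i. K i)" by simp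
      then have "\<forall>\<^sub>F n in sequentially. measure M (\<Union>i. K i) - e/2 < measure M (\<Union>i\<le>n. K i)"
        using e by (intro order_tendstoD(1)) auto
      then obtain n where n: "measure M (\<Union>i. K i) - e/2 < measure M (\<Union>i\<le>n. K i)"
        using eventually_happens'[OF sequentially_bot] by blast
      have KsubU: "K i \<subseteq> U i" for i using KU(3,4) by (meson order_trans)
      have "measure M ((\<Union>i. U i) - (\<Union>i\<le>n. K i)) = measure M (\<Union>i. U i) - measure M (\<Union>i\<le>n. K i)"
        using KsubU by (intro finite_measure_Diff) (auto simp: subset_iff)
      moreover have "measure M ((\<Union>i. U i) - (\<Union>i. K i)) = measure M (\<Union>i. U i) - measure M (\<Union>i. K i)"
        using KsubU by (intro finite_measure_Diff) (auto simp: subset_iff)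
      ultimately have "measure M ((\<Union>i. U i) - (\<Union>i\<le>n. K i)) < e" using 1 n by linarith
      moreover have "closedin X (\<Union>i\<le>n. K i)" using KU(1) by (intro closedin_Union) auto
      moreover have "openin X (\<Union>i. U i)" using KU(2) by (intro openin_Union) auto
      moreover have "(\<Union>i\<le>n. K i) \<subseteq> (\<Union>i. E i)" using KU(3) by (intro UN_mono) auto
      moreover have "(\<Union>i. E i) \<subseteq> (\<Union>i. U i)" using KU(4) by (intro UN_mono) auto
      ultimately show "\<exists>K U. closedin X K \<and> openin X U \<and> K \<subseteq> \<Union> (range E) \<and> \<Union> (range E) \<subseteq> U \<and> measure M (U - K) < e"
        by (intro exI conjI)
    qed
  qed
  have "regular_measure X M"
    unfolding regular_measure_def
  proof (intro ballI conjI)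
    fix E assume E: "E \<in> sets M"
    then have E': "E \<in> sigma_sets (topspace X) {U. openin X U}" using sp sets_borel_of by auto
    show "emeasure M E = (INF U\<in>{U. openin X U \<and> E \<subseteq> U}. emeasure M U)"
    proof (rule antisym)
      show "emeasure M E \<le> (INF U\<in>{U. openin X U \<and> E \<subseteq> U}. emeasure M U)"
        using oS by (intro INF_greatest emeasure_mono) auto
      show "(INF U\<in>{U. openin X U \<and> E \<subseteq> U}. emeasure M U) \<le> emeasure M E"
      proof (rule ennreal_le_epsilon)
        fix e :: real assume "0 < e"
        then obtain K U where KU: "closedin X K" "openin X U" "K \<subseteq> E" "E \<subseteq> U" "measure M (U - K) < e"
          using sq[OF E', rule_format, OF \<open>0 < e\<close>] by blast
        have "measure M U - measure M K < e"
          using KU oS cS finite_measure_Diff[of U K] by auto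
        moreover have "measure M K \<le> measure M E" using KU E by (intro finite_measure_mono) auto
        ultimately have "measure M U \<le> measure M E + e" by linarith
        then have "emeasure M U \<le> emeasure M E + ennreal e"
          using \<open>0 < e\<close> by (simp add: emeasure_eq_measure flip: ennreal_plus)
        then show "(INF U\<in>{U. openin X U \<and> E \<subseteq> U}. emeasure M U) \<le> emeasure M E + ennreal e"
          using KU by (intro INF_lower2[of U]) auto
      qed
    qed
    show "emeasure M E = (SUP K\<in>{K. compactin X K \<and> K \<subseteq> E}. emeasure M K)"
    proof (rule antisym)
      show "(SUP K\<in>{K. compactin X K \<and> K \<subseteq> E}. emeasure M K) \<le> emeasure M E"
        using E by (intro SUP_least emeasure_mono) auto
      show "emeasure M E \<le> (SUP K\<in>{K. compactin X K \<and> K \<subseteq> E}. emeasure M K)"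
      proof (rule ennreal_le_epsilon)
        fix e :: real assume "0 < e"
        then obtain K U where KU: "closedin X K" "openin X U" "K \<subseteq> E" "E \<subseteq> U" "measure M (U - K) < e"
          using sq[OF E', rule_format, OF \<open>0 < e\<close>] by blast
        have "measure M U - measure M K < e"
          using KU oS cS finite_measure_Diff[of U K] by auto
        moreover have "measure M E \<le> measure M U" using KU oS by (intro finite_measure_mono) auto
        ultimately have "measure M E \<le> measure M K + e" by linarith
        then have "emeasure M E \<le> emeasure M K + ennreal e"
          using \<open>0 < e\<close> by (simp add: emeasure_eq_measure flip: ennreal_plus)
        moreover have "emeasure M K \<le> (SUP K\<in>{K. compactin X K \<and> K \<subseteq> E}. emeasure M K)"
          using KU chaus_closed_eq_compact[OF X] by (intro SUP_upper) auto
        ultimately show "emeasure M E \<le> (SUP K\<in>{K. compactin X K \<and> K \<subseteq> E}. emeasure M K) + ennreal e"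
          by (meson add_right_mono order_trans)
      qed
    qed
  qed
  then show ?thesis using space sp \<open>prob_space M\<close> by (simp add: prob_meas_def)
qed

lemma return_prob_meas:
  assumes X: "chaus X" and x: "x \<in> topspace X"
  shows "return (borel_of X) x \<in> prob_meas X"
proof (rule prob_measI_inner_open[OF X])
  show "prob_space (return (borel_of X) x)" using x by (intro prob_space_return) simp
  fix U and e :: real assume U: "openin X U" and e: "0 < e"
  have "closedin X {x}" using X x by (simp add: chaus_def closedin_Hausdorff_singleton)
  then have "{x} \<in> sets (borel_of X)" by (rule closedin_sets_borel_of)
  moreover have "U \<in> sets (borel_of X)" using U by (rule openin_sets_borel_of)
  ultimately show "\<exists>K. closedin X K \<and> K \<subseteq> U \<and> measure (return (borel_of X) x) U < measure (return (borel_of X) x) K + e"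
    using \<open>closedin X {x}\<close> e
    by (cases "x \<in> U") (auto simp: measure_return intro: exI[of _ "{x}"] exI[of _ "{}"])
qed simp

section \<open>The Riesz representation theorem\<close>

text \<open>\<open>L\<close> takes total functions but is constrained only on those continuous on
  \<open>X\<close>. Positivity makes its value on them depend only on their restriction to the
  space.\<close>

locale positive_functional =
  fixes X :: "'x topology" and L :: "('x \<Rightarrow> real) \<Rightarrow> real"
  assumes chausX: "chaus X"
    and L_add: "\<lbrakk>continuous_map X euclideanreal \<phi>; continuous_map X euclideanreal \<psi>\<rbrakk>
      \<Longrightarrow> L (\<lambda>x. \<phi> x + \<psi> x) = L \<phi> + L \<psi>"
    and L_scale: "continuous_map X euclideanreal \<phi> \<Longrightarrow> L (\<lambda>x. c * \<phi> x) = c * L \<phi>"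
    and L_pos: "\<lbrakk>continuous_map X euclideanreal \<phi>; \<And>x. x \<in> topspace X \<Longrightarrow> 0 \<le> \<phi> x\<rbrakk> \<Longrightarrow> 0 \<le> L \<phi>"
    and L_one: "L (\<lambda>_. 1) = 1"
begin

lemma L_const: "L (\<lambda>_. c) = c"
  using L_scale[of "\<lambda>_. 1" c] L_one by simp

lemma L_diff:
  assumes "continuous_map X euclideanreal \<phi>" "continuous_map X euclideanreal \<psi>"
  shows "L (\<lambda>x. \<phi> x - \<psi> x) = L \<phi> - L \<psi>"
proof -
  have "L (\<lambda>x. \<phi> x + (-1) * \<psi> x) = L \<phi> + L (\<lambda>x. (-1) * \<psi> x)"
    using assms by (intro L_add continuous_intros)
  then show ?thesis using L_scale[OF assms(2), of "-1"] by simp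
qed

lemma L_mono:
  assumes "continuous_map X euclideanreal \<phi>" "continuous_map X euclideanreal \<psi>"
    "\<And>x. x \<in> topspace X \<Longrightarrow> \<phi> x \<le> \<psi> x"
  shows "L \<phi> \<le> L \<psi>"
  using L_pos[of "\<lambda>x. \<psi> x - \<phi> x"] L_diff[OF assms(2,1)] assms by (simp add: continuous_map_diff)

lemma L_sum:
  assumes "finite I" "\<And>i. i \<in> I \<Longrightarrow> continuous_map X euclideanreal (\<phi> i)"
  shows "L (\<lambda>x. \<Sum>i\<in>I. \<phi> i x) = (\<Sum>i\<in>I. L (\<phi> i))"
  using assms
proof (induction I rule: finite_induct)
  case empty
  then show ?case by (simp add: L_const)
next
  case (insert i I)
  then show ?case using L_add[of "\<phi> i" "\<lambda>x. \<Sum>i\<in>I. \<phi> i x"] by (simp add: continuous_map_sum)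
qed

lemma L_bump: "\<phi> \<in> bumps X U \<Longrightarrow> 0 \<le> L \<phi> \<and> L \<phi> \<le> 1"
  using L_pos[of \<phi>] L_mono[of \<phi> "\<lambda>_. 1"] L_one by (auto simp: bumps_def)

section \<open>The content of an open set\<close>

definition riesz_content :: "'x set \<Rightarrow> real" where
  "riesz_content U = (SUP \<phi>\<in>bumps X U. L \<phi>)"

lemma bumps_zero: "(\<lambda>_. 0) \<in> bumps X U"
  by (simp add: bumps_def)

lemma bdd_above_L_bumps: "bdd_above (L ` bumps X U)"
  using L_bump by (intro bdd_aboveI[of _ 1]) auto

lemma L_le_content: "\<phi> \<in> bumps X U \<Longrightarrow> L \<phi> \<le> riesz_content U"
  unfolding riesz_content_def by (intro cSUP_upper bdd_above_L_bumps)

lemma content_le: "(\<And>\<phi>. \<phi> \<in> bumps X U \<Longrightarrow> L \<phi> \<le> c) \<Longrightarrow> riesz_content U \<le> c"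
  unfolding riesz_content_def using bumps_zero by (intro cSUP_least) auto

lemma content_approx:
  assumes "0 < e"
  obtains \<phi> where "\<phi> \<in> bumps X U" "riesz_content U < L \<phi> + e"
proof -
  have "\<exists>y\<in>L ` bumps X U. riesz_content U - e < y"
    unfolding riesz_content_def using assms bdd_above_L_bumps bumps_zero
    by (subst less_cSup_iff[symmetric]) auto
  then show ?thesis using that by force
qed

lemma bumps_mono: "U \<subseteq> V \<Longrightarrow> bumps X U \<subseteq> bumps X V"
  by (auto simp: bumps_def)

lemma content_mono: "U \<subseteq> V \<Longrightarrow> riesz_content U \<le> riesz_content V"
  using bumps_mono L_le_content by (intro content_le) blast

lemma content_nonneg: "0 \<le> riesz_content U"
  using L_le_content[OF bumps_zero] by (simp add: L_const)

lemma content_empty: "riesz_content {} = 0"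
proof (rule antisym)
  show "riesz_content {} \<le> 0"
  proof (rule content_le)
    fix \<phi> assume "\<phi> \<in> bumps X {}"
    then show "L \<phi> \<le> 0" using L_mono[of \<phi> "\<lambda>_. 0"] by (auto simp: bumps_def L_const)
  qed
qed (rule content_nonneg)

lemma content_topspace: "riesz_content (topspace X) = 1"
proof (rule antisym)
  show "riesz_content (topspace X) \<le> 1" using L_bump by (intro content_le) auto
  have "(\<lambda>_. 1) \<in> bumps X (topspace X)" by (auto simp: bumps_def)
  then show "1 \<le> riesz_content (topspace X)" using L_le_content L_one by force
qed

text \<open>The level set where \<open>\<phi>\<close> is at least \<open>e\<close> is compact, hence
  covered by finitely many bumps inside the \<open>U i\<close>. Truncated sums of these bumps
  dominate \<open>\<phi> - e\<close>, which does the work of a partition of unity.\<close>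

lemma content_subadditive:
  fixes U :: "nat \<Rightarrow> 'x set"
  assumes U: "\<And>i. openin X (U i)" and \<phi>: "\<phi> \<in> bumps X (\<Union>i. U i)" and e: "0 < e"
  obtains N where "L \<phi> - e \<le> (\<Sum>i<N. riesz_content (U i))"
proof -
  have c: "continuous_map X euclideanreal \<phi>" using \<phi> by (auto simp: bumps_def)
  define K where "K = {x \<in> topspace X. e \<le> \<phi> x}"
  have K: "closedin X K" unfolding K_def by (rule closedin_superlevel[OF c])
  have KU: "\<exists>i. x \<in> U i" if "x \<in> K" for x
  proof (rule ccontr)
    assume "\<nexists>i. x \<in> U i"
    then have "\<phi> x = 0" using \<phi> that by (auto simp: bumps_def K_def)
    then show False using that e by (auto simp: K_def)
  qed
  then obtain i where i: "\<And>x. x \<in> K \<Longrightarrow> x \<in> U (i x)" by metis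
  have "\<exists>\<psi>\<in>bumps X (U (i x)). \<psi> x = 1" if "x \<in> K" for x
  proof -
    have "closedin X {x}" using chausX that by (simp add: chaus_def closedin_Hausdorff_singleton K_def)
    then show ?thesis using bump_exists[OF chausX _ U, of "{x}" "i x"] i[OF that] by auto
  qed
  then obtain \<psi> where \<psi>: "\<And>x. x \<in> K \<Longrightarrow> \<psi> x \<in> bumps X (U (i x))" "\<And>x. x \<in> K \<Longrightarrow> \<psi> x x = 1"
    by metis
  have \<psi>c: "continuous_map X euclideanreal (\<psi> x)" if "x \<in> K" for x
    using \<psi>(1)[OF that] by (auto simp: bumps_def)
  have "compactin X K" using K chaus_closed_eq_compact[OF chausX] by blast
  moreover have "\<forall>V\<in>(\<lambda>x. {y \<in> topspace X. 1/2 < \<psi> x y}) ` K. openin X V"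
    using openin_superlevel \<psi>c by blast
  moreover have "K \<subseteq> \<Union>((\<lambda>x. {y \<in> topspace X. 1/2 < \<psi> x y}) ` K)"
    using \<psi>(2) by (auto simp: K_def)
  ultimately have "\<exists>\<F>. finite \<F> \<and> \<F> \<subseteq> (\<lambda>x. {y \<in> topspace X. 1/2 < \<psi> x y}) ` K \<and> K \<subseteq> \<Union>\<F>"
    unfolding compactin_def by (metis (no_types, lifting))
  then obtain F where F: "finite F" "F \<subseteq> K" "K \<subseteq> (\<Union>x\<in>F. {y \<in> topspace X. 1/2 < \<psi> x y})"
    by (metis (no_types, lifting) finite_subset_image)
  obtain N where N: "\<And>x. x \<in> F \<Longrightarrow> i x < N"
    using finite_nat_set_iff_bounded[of "i ` F"] F(1) by auto
  \<comment> \<open>Bumps with the same index \<open>j\<close> are merged, so that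
    \<open>U j\<close> is counted once. Near each chosen point the bump exceeds 1/2, hence the
    factor 2; the cut at 1 brings the sum back into \<open>bumps X (U j)\<close>.\<close>
  define \<Psi> where "\<Psi> j y = min 1 (\<Sum>x\<in>{x \<in> F. i x = j}. 2 * \<psi> x y)" for j y
  have \<Psi>: "\<Psi> j \<in> bumps X (U j)" for j
  proof -
    have "continuous_map X euclideanreal (\<Psi> j)"
      unfolding \<Psi>_def using F \<psi>c
      by (intro continuous_map_real_min continuous_map_sum continuous_map_real_mult_left) auto
    moreover have "0 \<le> \<Psi> j y" if "y \<in> topspace X" for y
      unfolding \<Psi>_def using F(2) \<psi>(1) that by (auto intro!: sum_nonneg simp: bumps_def subset_iff)
    moreover have "\<Psi> j y = 0" if "y \<in> topspace X - U j" for y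
    proof -
      have "(\<Sum>x\<in>{x \<in> F. i x = j}. 2 * \<psi> x y) = 0"
        using F(2) \<psi>(1) that by (intro sum.neutral) (auto simp: bumps_def)
      then show ?thesis by (simp add: \<Psi>_def)
    qed
    ultimately show ?thesis by (auto simp: bumps_def \<Psi>_def)
  qed
  have \<Psi>c: "continuous_map X euclideanreal (\<Psi> j)" for j using \<Psi> by (auto simp: bumps_def)
  have \<Psi>0: "0 \<le> \<Psi> j y" if "y \<in> topspace X" for j y using \<Psi>[of j] that by (auto simp: bumps_def)
  have "\<phi> y - e \<le> (\<Sum>j<N. \<Psi> j y)" if y: "y \<in> topspace X" for y
  proof (cases "y \<in> K")
    case True
    then obtain x where x: "x \<in> F" "1/2 < \<psi> x y" using F(3) by blast
    have "2 * \<psi> x y \<le> (\<Sum>x'\<in>{x' \<in> F. i x' = i x}. 2 * \<psi> x' y)"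
      using F(1,2) \<psi>(1) x(1) y by (intro member_le_sum) (auto simp: bumps_def)
    then have "1 \<le> \<Psi> (i x) y" using x(2) by (simp add: \<Psi>_def)
    also have "\<dots> \<le> (\<Sum>j<N. \<Psi> j y)"
      using N[OF x(1)] \<Psi>0[OF y] by (intro member_le_sum) auto
    finally show ?thesis using \<phi> y e by (force simp: bumps_def)
  next
    case False
    then have "\<phi> y - e < 0" using y by (simp add: K_def)
    moreover have "0 \<le> (\<Sum>j<N. \<Psi> j y)" using \<Psi>0[OF y] by (intro sum_nonneg) auto
    ultimately show ?thesis by linarith
  qed
  then have "L (\<lambda>y. \<phi> y - e) \<le> L (\<lambda>y. \<Sum>j<N. \<Psi> j y)"
    using c \<Psi>c by (intro L_mono continuous_intros) auto
  also have "\<dots> = (\<Sum>j<N. L (\<Psi> j))" using \<Psi>c by (intro L_sum) auto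
  also have "\<dots> \<le> (\<Sum>j<N. riesz_content (U j))" using \<Psi> by (intro sum_mono L_le_content) auto
  finally show ?thesis using that L_diff[OF c, of "\<lambda>_. e"] by (simp add: L_const)
qed

section \<open>The outer measure and Caratheodory's criterion\<close>

definition riesz_outer :: "'x set \<Rightarrow> ennreal" where
  "riesz_outer E = (INF U\<in>{U. openin X U \<and> E \<subseteq> U}. ennreal (riesz_content U))"

lemma outer_open: "openin X U \<Longrightarrow> riesz_outer U = ennreal (riesz_content U)"
  unfolding riesz_outer_def
  by (intro antisym INF_lower INF_greatest) (auto intro!: ennreal_leI content_mono)

lemma outer_mono: "A \<subseteq> B \<Longrightarrow> riesz_outer A \<le> riesz_outer B"
  unfolding riesz_outer_def by (intro INF_superset_mono) auto

lemma outer_le: "openin X U \<Longrightarrow> A \<subseteq> U \<Longrightarrow> riesz_outer A \<le> ennreal (riesz_content U)"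
  unfolding riesz_outer_def by (intro INF_lower) auto

lemma outer_approx:
  assumes "A \<subseteq> topspace X" "0 < (e::real)"
  obtains U where "openin X U" "A \<subseteq> U" "ennreal (riesz_content U) < riesz_outer A + ennreal e"
proof -
  have "riesz_outer A \<le> ennreal 1" using outer_le[of "topspace X" A] assms content_topspace by auto
  then have "riesz_outer A < riesz_outer A + ennreal e" using assms(2)
    using ennreal_add_left_cancel_less[of "riesz_outer A" 0 "ennreal e"] by (auto simp: top_unique)
  then have "(INF U\<in>{U. openin X U \<and> A \<subseteq> U}. ennreal (riesz_content U)) < riesz_outer A + ennreal e"
    by (simp add: riesz_outer_def)
  then show ?thesis using that by (auto simp: INF_less_iff)
qed

lemma outer_measure_space_outer: "outer_measure_space (Pow (topspace X)) riesz_outer"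
  unfolding outer_measure_space_def
proof (intro conjI)
  show "positive (Pow (topspace X)) riesz_outer"
    using outer_open[of "{}"] by (simp add: positive_def content_empty)
  show "increasing (Pow (topspace X)) riesz_outer" by (auto simp: increasing_def intro: outer_mono)
  show "countably_subadditive (Pow (topspace X)) riesz_outer"
    unfolding countably_subadditive_def
  proof (intro allI impI)
    fix A :: "nat \<Rightarrow> 'x set" assume A: "range A \<subseteq> Pow (topspace X)"
    show "riesz_outer (\<Union>i. A i) \<le> (\<Sum>i. riesz_outer (A i))"
    proof (rule ennreal_le_epsilon)
      fix e :: real assume e: "0 < e"
      \<comment> \<open>The errors of the covers add up to \<open>e/2\<close>; the remaining half is
        split between \<open>content_approx\<close> and \<open>content_subadditive\<close>,
        \<open>e/4\<close> each.\<close>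
      have "\<exists>U. openin X U \<and> A i \<subseteq> U \<and> ennreal (riesz_content U) \<le> riesz_outer (A i) + ennreal (e/2) * ennreal ((1/2)^Suc i)" for i
      proof -
        have "A i \<subseteq> topspace X" using A by blast
        moreover have "0 < (e/2) * (1/2)^Suc i" using e by simp
        ultimately obtain U where "openin X U" "A i \<subseteq> U" "ennreal (riesz_content U) < riesz_outer (A i) + ennreal ((e/2) * (1/2)^Suc i)"
          using outer_approx by blast
        moreover have "ennreal ((e/2) * (1/2)^Suc i) = ennreal (e/2) * ennreal ((1/2)^Suc i)"
          using e by (intro ennreal_mult) auto
        ultimately show ?thesis using less_imp_le by metis
      qed
      then obtain U where U: "\<And>i. openin X (U i)" "\<And>i. A i \<subseteq> U i"
          "\<And>i. ennreal (riesz_content (U i)) \<le> riesz_outer (A i) + ennreal (e/2) * ennreal ((1/2)^Suc i)"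
        by metis
      obtain \<phi> where \<phi>: "\<phi> \<in> bumps X (\<Union>i. U i)" "riesz_content (\<Union>i. U i) < L \<phi> + e/4"
        using content_approx[of "e/4"] e by auto
      obtain N where N: "L \<phi> - e/4 \<le> (\<Sum>i<N. riesz_content (U i))"
        using content_subadditive[OF U(1) \<phi>(1), of "e/4"] e by auto
      have "riesz_outer (\<Union>i. A i) \<le> ennreal (riesz_content (\<Union>i. U i))"
        using U(1,2) by (intro outer_le openin_Union) auto
      also have "\<dots> \<le> ennreal ((\<Sum>i<N. riesz_content (U i)) + e/2)"
        using N \<phi>(2) by (intro ennreal_leI) linarith
      also have "\<dots> = (\<Sum>i<N. ennreal (riesz_content (U i))) + ennreal (e/2)"
        using e content_nonneg by (subst ennreal_plus) (auto intro!: sum_nonneg simp: sum_ennreal)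
      also have "\<dots> \<le> (\<Sum>i. ennreal (riesz_content (U i))) + ennreal (e/2)"
        by (intro add_right_mono sum_le_suminf) auto
      also have "(\<Sum>i. ennreal (riesz_content (U i))) \<le> (\<Sum>i. riesz_outer (A i) + ennreal (e/2) * ennreal ((1/2)^Suc i))"
        using U(3) by (intro suminf_le) auto
      also have "(\<Sum>i. riesz_outer (A i) + ennreal (e/2) * ennreal ((1/2)^Suc i)) = (\<Sum>i. riesz_outer (A i)) + (\<Sum>i. ennreal (e/2) * ennreal ((1/2)^Suc i))"
        by (intro suminf_add[symmetric]) auto
      also have "(\<Sum>i. ennreal (e/2) * ennreal ((1/2)^Suc i)) = ennreal (e/2)"
        unfolding ennreal_suminf_cmult
          by (subst suminf_ennreal_eq[OF zero_le_power power_half_series]) auto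
      finally show "riesz_outer (\<Union>i. A i) \<le> (\<Sum>i. riesz_outer (A i)) + ennreal e"
        using e by (simp add: add.assoc flip: ennreal_plus)
    qed
  qed
qed

text \<open>Splitting \<open>V\<close> along an open \<open>U\<close>: a bump in \<open>V \<inter> U\<close>, cut down to live on a closed set, and a bump
  off that closed set can be added without exceeding 1.\<close>

lemma content_split:
  assumes U: "openin X U" and V: "openin X V"
  shows "ennreal (riesz_content (V \<inter> U)) + riesz_outer (V - U) \<le> ennreal (riesz_content V)"
proof (rule ennreal_le_epsilon)
  fix e :: real assume e: "0 < e"
  obtain \<psi> where \<psi>: "\<psi> \<in> bumps X (V \<inter> U)" "riesz_content (V \<inter> U) < L \<psi> + e/3"
    using content_approx[of "e/3"] e by auto
  have \<psi>c: "continuous_map X euclideanreal \<psi>" using \<psi> by (auto simp: bumps_def)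
  define K where "K = {x \<in> topspace X. e/3 \<le> \<psi> x}"
  have K: "closedin X K" unfolding K_def by (rule closedin_superlevel[OF \<psi>c])
  have KU: "K \<subseteq> U" using \<psi>(1) e by (force simp: K_def bumps_def)
  have VK: "openin X (V - K)" using V K by blast
  obtain \<eta> where \<eta>: "\<eta> \<in> bumps X (V - K)" "riesz_content (V - K) < L \<eta> + e/3"
    using content_approx[of "e/3"] e by auto
  have \<eta>c: "continuous_map X euclideanreal \<eta>" using \<eta> by (auto simp: bumps_def)
  let ?\<psi> = "\<lambda>x. max (\<psi> x - e/3) 0"
  have c: "continuous_map X euclideanreal ?\<psi>" using \<psi>c by (intro continuous_intros) auto
  have "(\<lambda>x. ?\<psi> x + \<eta> x) \<in> bumps X V"
  proof -
    have "0 \<le> ?\<psi> x + \<eta> x \<and> ?\<psi> x + \<eta> x \<le> 1 \<and> (x \<notin> V \<longrightarrow> ?\<psi> x + \<eta> x = 0)" if x: "x \<in> topspace X" for x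
    proof (cases "x \<in> K")
      case True
      then have "\<eta> x = 0" using \<eta>(1) x by (auto simp: bumps_def)
      then show ?thesis using \<psi>(1) x e by (auto simp: bumps_def)
    next
      case False
      then have "?\<psi> x = 0" using x by (auto simp: K_def)
      then show ?thesis using \<eta>(1) x e by (auto simp: bumps_def)
    qed
    then show ?thesis using c \<eta>c by (auto simp: bumps_def intro!: continuous_map_add)
  qed
  then have "L ?\<psi> + L \<eta> \<le> riesz_content V" using L_le_content L_add[OF c \<eta>c] by force
  moreover have "L \<psi> - e/3 \<le> L ?\<psi>"
    using L_mono[of "\<lambda>x. \<psi> x - e/3" ?\<psi>] c \<psi>c L_diff[OF \<psi>c, of "\<lambda>_. e/3"]
    by (simp add: L_const continuous_map_diff)
  ultimately have "riesz_content (V \<inter> U) + riesz_content (V - K) \<le> riesz_content V + e" using \<psi>(2) \<eta>(2) by linarith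
  then have "ennreal (riesz_content (V \<inter> U)) + ennreal (riesz_content (V - K)) \<le> ennreal (riesz_content V) + ennreal e"
    using e content_nonneg by (simp flip: ennreal_plus)
  moreover have "riesz_outer (V - U) \<le> ennreal (riesz_content (V - K))" using KU VK by (intro outer_le) auto
  ultimately show "ennreal (riesz_content (V \<inter> U)) + riesz_outer (V - U) \<le> ennreal (riesz_content V) + ennreal e"
    by (meson add_left_mono order_trans)
qed

text \<open>\<open>content_split\<close> is Caratheodory's condition for open test sets. An
  arbitrary test set inherits it by an infimum over its open supersets.\<close>

lemma open_in_lambda_system:
  assumes U: "openin X U"
  shows "U \<in> lambda_system (topspace X) (Pow (topspace X)) riesz_outer"
  unfolding lambda_system_def
proof (intro CollectI conjI ballI)
  show "U \<in> Pow (topspace X)" using U openin_subset by auto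
  fix E assume E: "E \<in> Pow (topspace X)"
  have eqs: "(topspace X - U) \<inter> E = E - U" using E by auto
  show "riesz_outer (U \<inter> E) + riesz_outer ((topspace X - U) \<inter> E) = riesz_outer E"
  proof (rule antisym)
    interpret sigma_algebra "topspace X" "Pow (topspace X)" by (rule sigma_algebra_Pow)
    have "subadditive (Pow (topspace X)) riesz_outer"
      using outer_measure_space_outer countably_subadditive_subadditive
      by (auto simp: outer_measure_space_def)
    then have "riesz_outer ((U \<inter> E) \<union> (E - U)) \<le> riesz_outer (U \<inter> E) + riesz_outer (E - U)"
      using E by (intro subadditiveD) auto
    moreover have "(U \<inter> E) \<union> (E - U) = E" by auto
    ultimately show "riesz_outer E \<le> riesz_outer (U \<inter> E) + riesz_outer ((topspace X - U) \<inter> E)" using eqs by simp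
    show "riesz_outer (U \<inter> E) + riesz_outer ((topspace X - U) \<inter> E) \<le> riesz_outer E"
      unfolding riesz_outer_def[of E]
    proof (rule INF_greatest)
      fix V assume "V \<in> {V. openin X V \<and> E \<subseteq> V}"
      then have V: "openin X V" "E \<subseteq> V" by auto
      have "riesz_outer (U \<inter> E) \<le> ennreal (riesz_content (V \<inter> U))" using U V by (intro outer_le) auto
      moreover have "riesz_outer (E - U) \<le> riesz_outer (V - U)" using V by (intro outer_mono) auto
      ultimately show "riesz_outer (U \<inter> E) + riesz_outer ((topspace X - U) \<inter> E) \<le> ennreal (riesz_content V)"
        using content_split[OF U V(1)] eqs by (metis add_mono order_trans)
    qed
  qed
qed

section \<open>The Riesz measure, its regularity and its integrals\<close>

definition riesz :: "'x measure" where
  "riesz = measure_of (topspace X) {U. openin X U} riesz_outer"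

lemma sets_riesz: "sets riesz = sets (borel_of X)"
  unfolding riesz_def sets_borel_of by (rule sets_measure_of) (auto dest: openin_subset)

text \<open>Caratheodory's sigma-algebra contains the open sets, hence the Borel sets. So
  \<open>riesz_outer\<close> is countably additive there and \<open>measure_of\<close> does not fall
  back on the zero measure.\<close>

lemma emeasure_riesz: "E \<in> sets (borel_of X) \<Longrightarrow> emeasure riesz E = riesz_outer E"
proof -
  assume E: "E \<in> sets (borel_of X)"
  interpret P: sigma_algebra "topspace X" "Pow (topspace X)" by (rule sigma_algebra_Pow)
  let ?L = "lambda_system (topspace X) (Pow (topspace X)) riesz_outer"
  have ms: "measure_space (topspace X) ?L riesz_outer"
    by (rule P.caratheodory_lemma[OF outer_measure_space_outer])
  then have "sigma_sets (topspace X) {U. openin X U} \<subseteq> ?L"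
    using open_in_lambda_system
    by (intro sigma_algebra.sigma_sets_subset) (auto simp: measure_space_def)
  then have sub: "sets riesz \<subseteq> ?L" by (simp add: sets_riesz sets_borel_of)
  have "countably_additive ?L riesz_outer" "positive ?L riesz_outer" using ms by (auto simp: measure_space_def)
  then have "countably_additive (sets riesz) riesz_outer" "positive (sets riesz) riesz_outer"
    using sub unfolding countably_additive_def positive_def by (meson order_trans subset_iff)+
  then show ?thesis using E
    by (intro emeasure_measure_of[OF riesz_def]) (auto simp: sets_riesz dest: openin_subset)
qed

lemma emeasure_riesz_open: "openin X U \<Longrightarrow> emeasure riesz U = ennreal (riesz_content U)"
  by (simp add: emeasure_riesz openin_sets_borel_of outer_open)

lemma measure_riesz_open: "openin X U \<Longrightarrow> measure riesz U = riesz_content U"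
  by (simp add: measure_def emeasure_riesz_open content_nonneg)

lemma prob_space_riesz: "prob_space riesz"
proof
  have "space riesz = topspace X" using sets_eq_imp_space_eq[OF sets_riesz] by simp
  then show "emeasure riesz (space riesz) = 1"
    by (simp add: emeasure_riesz_open content_topspace)
qed

text \<open>Let \<open>K\<close> be the level set, at height \<open>e/2\<close>, of a nearly optimal
  bump for \<open>U\<close>. Every open set around \<open>K\<close> carries that bump lowered by
  \<open>e/2\<close> and cut at 0, so the outer measure of \<open>K\<close> is close to the content
  of \<open>U\<close>.\<close>

lemma riesz_prob_meas: "riesz \<in> prob_meas X"
proof (rule prob_measI_inner_open[OF chausX sets_riesz prob_space_riesz])
  interpret prob_space riesz by (rule prob_space_riesz)
  fix U and e :: real assume U: "openin X U" and e: "0 < e"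
  obtain \<phi> where \<phi>: "\<phi> \<in> bumps X U" "riesz_content U < L \<phi> + e/2"
    using content_approx[of "e/2"] e by auto
  have c: "continuous_map X euclideanreal \<phi>" using \<phi> by (auto simp: bumps_def)
  define K where "K = {x \<in> topspace X. e/2 \<le> \<phi> x}"
  have K: "closedin X K" unfolding K_def by (rule closedin_superlevel[OF c])
  have KU: "K \<subseteq> U" using \<phi>(1) e by (force simp: K_def bumps_def)
  have "ennreal (L \<phi> - e/2) \<le> riesz_outer K"
    unfolding riesz_outer_def
  proof (rule INF_greatest)
    fix V assume "V \<in> {V. openin X V \<and> K \<subseteq> V}"
    then have V: "openin X V" "K \<subseteq> V" by auto
    let ?\<phi> = "\<lambda>x. max (\<phi> x - e/2) 0"
    have c': "continuous_map X euclideanreal ?\<phi>" using c by (intro continuous_intros) auto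
    have "?\<phi> \<in> bumps X V" using c' \<phi>(1) V(2) e by (auto simp: bumps_def K_def)
    then have "L ?\<phi> \<le> riesz_content V" by (rule L_le_content)
    moreover have "L \<phi> - e/2 \<le> L ?\<phi>"
      using L_mono[of "\<lambda>x. \<phi> x - e/2" ?\<phi>] c c' L_diff[OF c, of "\<lambda>_. e/2"]
      by (simp add: L_const continuous_map_diff)
    ultimately show "ennreal (L \<phi> - e/2) \<le> ennreal (riesz_content V)" by (intro ennreal_leI) linarith
  qed
  also have "riesz_outer K = emeasure riesz K" using K by (simp add: emeasure_riesz closedin_sets_borel_of)
  finally have "L \<phi> - e/2 \<le> measure riesz K"
    by (smt (verit) emeasure_eq_measure ennreal_le_iff measure_nonneg)
  then have "measure riesz U < measure riesz K + e" using \<phi>(2) U by (simp add: measure_riesz_open)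
  then show "\<exists>K. closedin X K \<and> K \<subseteq> U \<and> measure riesz U < measure riesz K + e" using K KU by blast
qed

text \<open>Slice \<open>\<phi>\<close> into \<open>n\<close> layers of height \<open>1/n\<close>; each layer dominates the indicator of the superlevel
  set that supports the next one.\<close>

lemma L_le_integral_unit:
  assumes c: "continuous_map X euclideanreal \<phi>" and b: "\<And>x. x \<in> topspace X \<Longrightarrow> 0 \<le> \<phi> x \<and> \<phi> x \<le> 1"
  shows "L \<phi> \<le> (\<integral>x. \<phi> x \<partial>riesz)"
proof (rule field_le_epsilon)
  interpret prob_space riesz by (rule prob_space_riesz)
  note sp = prob_measD(1)[OF riesz_prob_meas]
  fix e :: real assume e: "0 < e"
  obtain n :: nat where n: "1 / e < real n" using reals_Archimedean2 by blast
  then have n0: "0 < n" using e by (metis divide_pos_pos gr0I of_nat_0 less_asym zero_less_one)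
  define lay where "lay k x = min 1 (max 0 (real n * \<phi> x - real k))" for k x
  have lamc: "continuous_map X euclideanreal (lay k)" for k
    unfolding lay_def using c by (intro continuous_intros) auto
  define G where "G k = {x \<in> topspace X. real k / real n < \<phi> x}" for k
  have G: "openin X (G k)" for k unfolding G_def by (rule openin_superlevel[OF c])
  have GS: "G k \<in> sets riesz" for k using G by (simp add: sets_riesz openin_sets_borel_of)
  have Gn: "x \<in> G k \<longleftrightarrow> x \<in> topspace X \<and> real k < real n * \<phi> x" for x k
    using n0 by (auto simp: G_def field_simps)
  have lamb: "lay k \<in> bumps X (G k)" for k using lamc Gn by (auto simp: bumps_def lay_def)
  have slices: "(\<Sum>k<m. lay k x) = min (real m) (max 0 (real n * \<phi> x))" for m x
    by (induction m) (auto simp: lay_def)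
  have sum: "(\<Sum>k<n. lay k x) = real n * \<phi> x" if "x \<in> topspace X" for x
    using b[OF that] slices[of x n] by (simp add: mult_left_le)
  have ilam: "integrable riesz (lay k)" for k by (rule integrable_continuous[OF chausX riesz_prob_meas lamc])
  have step: "L (lay (Suc k)) \<le> (\<integral>x. lay k x \<partial>riesz)" for k
  proof -
    have "L (lay (Suc k)) \<le> riesz_content (G (Suc k))" by (rule L_le_content[OF lamb])
    also have "\<dots> = (\<integral>x. indicator (G (Suc k)) x \<partial>riesz)" using GS by (simp add: measure_riesz_open[OF G])
    also have "\<dots> \<le> (\<integral>x. lay k x \<partial>riesz)"
      using ilam GS
    proof (intro integral_mono)
        fix x assume "x \<in> space riesz"
        then show "indicator (G (Suc k)) x \<le> lay k x"
          by (auto simp: Gn lay_def split: split_indicator)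
      qed (auto simp: emeasure_eq_measure)
    finally show ?thesis .
  qed
  have "real n * L \<phi> = L (\<lambda>x. real n * \<phi> x)" using L_scale[OF c] by simp
  also have "\<dots> \<le> L (\<lambda>x. \<Sum>k<n. lay k x)"
    using sum c lamc by (intro L_mono continuous_intros) auto
  also have "\<dots> = (\<Sum>k<n. L (lay k))" using lamc by (intro L_sum) auto
  \<comment> \<open>One nonnegative layer is added at the top in order to shift the index. The
    bottom layer then stays unmatched; it contributes at most 1, which is the error
    \<open>1/n\<close> after division by \<open>n\<close>.\<close>
  also have "\<dots> \<le> (\<Sum>k<Suc n. L (lay k))" using L_bump[OF lamb] by simp
  also have "\<dots> = L (lay 0) + (\<Sum>k<n. L (lay (Suc k)))" by (rule sum.lessThan_Suc_shift)
  also have "\<dots> \<le> 1 + (\<Sum>k<n. \<integral>x. lay k x \<partial>riesz)"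
    using L_bump[OF lamb] step by (intro add_mono sum_mono) auto
  also have "(\<Sum>k<n. \<integral>x. lay k x \<partial>riesz) = (\<integral>x. (\<Sum>k<n. lay k x) \<partial>riesz)"
    using ilam by (intro Bochner_Integration.integral_sum[symmetric])
  also have "\<dots> = (\<integral>x. real n * \<phi> x \<partial>riesz)"
    using sum by (intro Bochner_Integration.integral_cong) (auto simp: sp)
  finally have "real n * L \<phi> \<le> 1 + real n * (\<integral>x. \<phi> x \<partial>riesz)" by simp
  then have "L \<phi> \<le> 1 / real n + (\<integral>x. \<phi> x \<partial>riesz)" using n0 by (simp add: field_simps)
  moreover have "1 / real n \<le> e" using n n0 e by (simp add: field_simps)
  ultimately show "L \<phi> \<le> (\<integral>x. \<phi> x \<partial>riesz) + e" by linarith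
qed

text \<open>An affine rescaling moves the values into the unit interval. Both sides respect it,
  because \<open>L\<close> is 1 on the constant 1 and \<open>riesz\<close> has total mass 1.\<close>

lemma L_le_integral:
  assumes c: "continuous_map X euclideanreal \<phi>"
  shows "L \<phi> \<le> (\<integral>x. \<phi> x \<partial>riesz)"
proof -
  interpret prob_space riesz by (rule prob_space_riesz)
  obtain B where B: "\<And>x. x \<in> topspace X \<Longrightarrow> norm (\<phi> x) \<le> B"
    using continuous_map_bounded[OF chausX c] by blast
  define C where "C = \<bar>B\<bar> + 1"
  have C: "0 < C" "\<And>x. x \<in> topspace X \<Longrightarrow> \<bar>\<phi> x\<bar> \<le> C" using B by (force simp: C_def)+
  have i: "integrable riesz \<phi>" by (rule integrable_continuous[OF chausX riesz_prob_meas c])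
  let ?\<psi> = "\<lambda>x. (1 / (2*C)) * (\<phi> x + C)"
  have c2: "continuous_map X euclideanreal (\<lambda>x. \<phi> x + C)" using c by (intro continuous_map_add continuous_map_const[THEN iffD2]) auto
  have "L ?\<psi> \<le> (\<integral>x. ?\<psi> x \<partial>riesz)"
  proof (rule L_le_integral_unit)
    show "continuous_map X euclideanreal ?\<psi>" by (rule continuous_map_real_mult_left[OF c2])
    fix x assume "x \<in> topspace X"
    then show "0 \<le> ?\<psi> x \<and> ?\<psi> x \<le> 1" using C(1) C(2)[of x] by (auto simp: field_simps)
  qed
  moreover have "L ?\<psi> = (1 / (2*C)) * (L \<phi> + C)"
    using L_scale[OF c2, of "1 / (2*C)"] L_add[OF c, of "\<lambda>_. C"] by (simp only: L_const continuous_map_const) simp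
  moreover have "(\<integral>x. ?\<psi> x \<partial>riesz) = (1 / (2*C)) * ((\<integral>x. \<phi> x \<partial>riesz) + C)"
    using i by (simp add: prob_space)
  ultimately show ?thesis using C(1) by (simp add: divide_le_cancel)
qed

theorem integral_riesz:
  assumes c: "continuous_map X euclideanreal \<phi>"
  shows "(\<integral>x. \<phi> x \<partial>riesz) = L \<phi>"
proof (rule antisym)
  have "L (\<lambda>x. -1 * \<phi> x) \<le> (\<integral>x. -1 * \<phi> x \<partial>riesz)"
    using c by (intro L_le_integral continuous_intros)
  then show "(\<integral>x. \<phi> x \<partial>riesz) \<le> L \<phi>" using L_scale[OF c, of "-1"] by simp
qed (rule L_le_integral[OF c])

end

section \<open>Complex-valued continuous functions\<close>

lemma continuous_map_euclidean_compose:
  assumes "continuous_map X euclidean f" "continuous_on UNIV g"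
  shows "continuous_map X euclidean (\<lambda>x. g (f x))"
  using continuous_map_compose[of X euclidean f euclidean g] assms by (simp add: o_def)

lemma continuous_map_complex_iff:
  "continuous_map X euclidean f \<longleftrightarrow>
     continuous_map X euclideanreal (\<lambda>x. Re (f x)) \<and> continuous_map X euclideanreal (\<lambda>x. Im (f x))"
proof
  assume R: "continuous_map X euclideanreal (\<lambda>x. Re (f x)) \<and> continuous_map X euclideanreal (\<lambda>x. Im (f x))"
  have "continuous_map X euclidean (\<lambda>x. of_real (Re (f x)) + complex_of_real (Im (f x)) * \<i>)"
    using R by (intro continuous_map_add continuous_map_euclidean_compose[where g = of_real]
       continuous_map_euclidean_compose[where g = "\<lambda>x. of_real x * \<i>"] continuous_intros) auto
  then show "continuous_map X euclidean f" by (simp add: complex_eq[symmetric] mult.commute)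
qed (auto intro!: continuous_map_euclidean_compose[where g = Re] continuous_map_euclidean_compose[where g = Im] continuous_intros)

lemma integral_complex_eq:
  assumes "integrable M (f :: _ \<Rightarrow> complex)"
  shows "(\<integral>x. f x \<partial>M) = Complex (\<integral>x. Re (f x) \<partial>M) (\<integral>x. Im (f x) \<partial>M)"
  using integral_Re[OF assms] integral_Im[OF assms] by (simp add: complex_eq_iff)

section \<open>Stochastic maps\<close>

lemma topspace_vague [simp]: "topspace (vague_topology X) = prob_meas X"
proof -
  have "prob_meas X \<in> {{M \<in> prob_meas X. (\<integral>x. \<phi> x \<partial>M) \<in> U} |\<phi> (U :: complex set).
        continuous_map X euclidean \<phi> \<and> open U}"
    by (intro CollectI exI[of _ "\<lambda>_. 0"] exI[of _ UNIV]) auto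
  then show ?thesis unfolding vague_topology_def topology_generated_by_topspace by blast
qed

text \<open>This is the universal property of an initial topology, with the integrals as the
  defining maps.\<close>

lemma continuous_map_vague_iff:
  "continuous_map X (vague_topology Y) \<mu> \<longleftrightarrow> (\<forall>x\<in>topspace X. \<mu> x \<in> prob_meas Y) \<and>
     (\<forall>\<phi> :: 'y \<Rightarrow> complex. continuous_map Y euclidean \<phi> \<longrightarrow>
        continuous_map X euclidean (\<lambda>x. \<integral>y. \<phi> y \<partial>\<mu> x))" (is "?l \<longleftrightarrow> ?r")
proof
  assume l: ?l
  then have pm: "\<mu> x \<in> prob_meas Y" if "x \<in> topspace X" for x
    using that by (auto simp: continuous_map_def)
  have "openin X {x \<in> topspace X. (\<integral>y. \<phi> y \<partial>\<mu> x) \<in> U}"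
    if "continuous_map Y euclidean \<phi>" "open U" for \<phi> :: "'y \<Rightarrow> complex" and U
  proof -
    have "openin (vague_topology Y) {M \<in> prob_meas Y. (\<integral>x. \<phi> x \<partial>M) \<in> U}"
      unfolding vague_topology_def using that by (intro topology_generated_by_Basis) auto
    then have "openin X {x \<in> topspace X. \<mu> x \<in> {M \<in> prob_meas Y. (\<integral>x. \<phi> x \<partial>M) \<in> U}}"
      using l openin_continuous_map_preimage by blast
    moreover have "{x \<in> topspace X. \<mu> x \<in> {M \<in> prob_meas Y. (\<integral>x. \<phi> x \<partial>M) \<in> U}}
        = {x \<in> topspace X. (\<integral>y. \<phi> y \<partial>\<mu> x) \<in> U}" using pm by auto
    ultimately show ?thesis by simp
  qed
  then show ?r using pm by (auto simp: continuous_map_def)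
next
  assume r: ?r
  show ?l
    unfolding vague_topology_def continuous_on_generated_topo_iff
  proof (intro conjI allI impI)
    fix V assume "V \<in> {{M \<in> prob_meas Y. (\<integral>x. \<phi> x \<partial>M) \<in> U} |\<phi> (U :: complex set).
        continuous_map Y euclidean \<phi> \<and> open U}"
    then obtain \<phi> :: "'y \<Rightarrow> complex" and U where V: "V = {M \<in> prob_meas Y. (\<integral>x. \<phi> x \<partial>M) \<in> U}"
      "continuous_map Y euclidean \<phi>" "open U" by blast
    then have "openin X {x \<in> topspace X. (\<integral>y. \<phi> y \<partial>\<mu> x) \<in> U}"
      using r by (intro openin_continuous_map_preimage[where Y = euclidean]) auto
    moreover have "{x \<in> topspace X. (\<integral>y. \<phi> y \<partial>\<mu> x) \<in> U} = \<mu> -` V \<inter> topspace X"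
      using r V(1) by auto
    ultimately show "openin X (\<mu> -` V \<inter> topspace X)" by simp
  next
    show "\<mu> ` topspace X \<subseteq> \<Union>{{M \<in> prob_meas Y. (\<integral>x. \<phi> x \<partial>M) \<in> U} |\<phi> (U :: complex set).
        continuous_map Y euclidean \<phi> \<and> open U}"
      using r topspace_vague[of Y] unfolding vague_topology_def topology_generated_by_topspace by auto
  qed
qed

lemma stochD:
  assumes "\<mu> \<in> stoch X Y"
  shows "\<mu> \<in> extensional (topspace X)" "x \<in> topspace X \<Longrightarrow> \<mu> x \<in> prob_meas Y"
    and "continuous_map Y euclidean \<phi> \<Longrightarrow> continuous_map X euclidean (\<lambda>x. \<integral>y. (\<phi> y :: complex) \<partial>\<mu> x)"
  using assms by (auto simp: stoch_def continuous_map_vague_iff)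

lemma stoch_continuous_real:
  assumes "\<mu> \<in> stoch X Y" "continuous_map Y euclideanreal \<phi>"
  shows "continuous_map X euclideanreal (\<lambda>x. \<integral>y. \<phi> y \<partial>\<mu> x)"
proof -
  have "continuous_map Y euclidean (\<lambda>y. complex_of_real (\<phi> y))"
    using assms(2) by (intro continuous_map_euclidean_compose[where g = of_real] continuous_intros)
  from stochD(3)[OF assms(1) this] show ?thesis
    by (simp add: continuous_map_complex_iff)
qed

lemma stochI:
  fixes \<mu> :: "'x \<Rightarrow> 'y measure"
  assumes Y: "chaus Y" and "\<mu> \<in> extensional (topspace X)"
    and pm: "\<And>x. x \<in> topspace X \<Longrightarrow> \<mu> x \<in> prob_meas Y"
    and c: "\<And>\<phi>. continuous_map Y euclideanreal \<phi> \<Longrightarrow> continuous_map X euclideanreal (\<lambda>x. \<integral>y. \<phi> y \<partial>\<mu> x)"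
  shows "\<mu> \<in> stoch X Y"
proof -
  have "continuous_map X euclidean (\<lambda>x. \<integral>y. \<phi> y \<partial>\<mu> x)"
    if \<phi>: "continuous_map Y euclidean \<phi>" for \<phi> :: "'y \<Rightarrow> complex"
  proof -
    have "continuous_map X euclidean (\<lambda>x. Complex (\<integral>y. Re (\<phi> y) \<partial>\<mu> x) (\<integral>y. Im (\<phi> y) \<partial>\<mu> x))"
      using \<phi> c by (simp add: continuous_map_complex_iff)
    moreover have "Complex (\<integral>y. Re (\<phi> y) \<partial>\<mu> x) (\<integral>y. Im (\<phi> y) \<partial>\<mu> x) = (\<integral>y. \<phi> y \<partial>\<mu> x)"
      if "x \<in> topspace X" for x
      using integral_complex_eq[OF integrable_continuous[OF Y pm[OF that] \<phi>]] by (rule sym)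
    ultimately show ?thesis by (rule continuous_map_eq)
  qed
  then show ?thesis using assms(2) pm unfolding stoch_def continuous_map_vague_iff by blast
qed

lemma stoch_eqI:
  assumes "chaus Y" "\<mu> \<in> stoch X Y" "\<nu> \<in> stoch X Y"
    and "\<And>x \<phi>. x \<in> topspace X \<Longrightarrow> continuous_map Y euclideanreal \<phi> \<Longrightarrow> (\<integral>y. \<phi> y \<partial>\<mu> x) = (\<integral>y. \<phi> y \<partial>\<nu> x)"
  shows "\<mu> = \<nu>"
  using stochD(1)[OF assms(2)] stochD(1)[OF assms(3)]
proof (rule extensionalityI)
  fix x assume x: "x \<in> topspace X"
  show "\<mu> x = \<nu> x"
    by (rule prob_meas_eqI[OF assms(1) stochD(2)[OF assms(2) x] stochD(2)[OF assms(3) x] assms(4)[OF x]])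
qed

section \<open>Integrals of directed suprema\<close>

text \<open>For nonnegative \<open>t\<close> the sum counts the naturals below \<open>t\<close>,
  that is, the ceiling of \<open>t\<close> cut off at \<open>n\<close>. This bound and the next one,
  which has a slack of 1, discretise a function with values in the unit interval into
  \<open>n\<close> level sets.\<close>

lemma sum_of_bool_less_ge: "min (real n) t \<le> (\<Sum>k<n. of_bool (real k < t))"
  by (induction n) auto

lemma sum_of_bool_less_le: "0 \<le> t \<Longrightarrow> (\<Sum>k<n. of_bool (real k < t)) \<le> min (real n) (t + 1)"
  by (induction n) auto

text \<open>This replaces the monotone convergence theorem for upward directed families of continuous functions, whose
  pointwise supremum need not be attained along a sequence; it relies on inner regularity.\<close>

lemma integral_directed_sup_approx:
  assumes Y: "chaus Y" and M: "M \<in> prob_meas Y" and "\<F> \<noteq> {}"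
    and \<F>: "\<And>f. f \<in> \<F> \<Longrightarrow> continuous_map Y euclideanreal f"
           "\<And>f y. f \<in> \<F> \<Longrightarrow> y \<in> topspace Y \<Longrightarrow> 0 \<le> f y"
           "\<And>f y. f \<in> \<F> \<Longrightarrow> y \<in> topspace Y \<Longrightarrow> f y \<le> g y"
    and dir: "\<And>f f'. f \<in> \<F> \<Longrightarrow> f' \<in> \<F> \<Longrightarrow> \<exists>h\<in>\<F>. \<forall>y\<in>topspace Y. f y \<le> h y \<and> f' y \<le> h y"
    and g1: "\<And>y. y \<in> topspace Y \<Longrightarrow> g y \<le> 1"
    and sup: "\<And>y t. y \<in> topspace Y \<Longrightarrow> t < g y \<Longrightarrow> \<exists>f\<in>\<F>. t < f y"
    and e: "0 < (e::real)"
  obtains f where "f \<in> \<F>" "(\<integral>y. g y \<partial>M) \<le> (\<integral>y. f y \<partial>M) + e"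
proof -
  interpret prob_space M using M prob_measD by blast
  note sp = prob_measD(1)[OF M]
  have dirfin: "\<exists>h\<in>\<F>. \<forall>f\<in>S. \<forall>y\<in>topspace Y. f y \<le> h y" if "finite S" "S \<subseteq> \<F>" for S
    using that
  proof (induction S rule: finite_induct)
    case empty
    then show ?case using \<open>\<F> \<noteq> {}\<close> by auto
  next
    case (insert f S)
    then obtain h where h: "h \<in> \<F>" "\<forall>f\<in>S. \<forall>y\<in>topspace Y. f y \<le> h y" by auto
    obtain h' where "h' \<in> \<F>" "\<forall>y\<in>topspace Y. f y \<le> h' y \<and> h y \<le> h' y"
      using dir[of f h] insert.prems h(1) by auto
    then show ?case using h(2) by (intro bexI[of _ h']) (auto intro: order_trans)
  qed
  \<comment> \<open>The superlevel sets of \<open>g\<close> are unions of open sets: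
    \<open>g\<close> is lower semicontinuous and hence Borel, although it need not be
    continuous.\<close>
  have lev: "{y \<in> topspace Y. t < g y} = (\<Union>f\<in>\<F>. {y \<in> topspace Y. t < f y})" for t
    using sup \<F>(3) by (auto intro: less_le_trans)
  have op: "openin Y {y \<in> topspace Y. t < g y}" for t
    unfolding lev using openin_superlevel \<F>(1) by (intro openin_Union) auto
  have gm: "g \<in> borel_measurable M"
    using openin_sets_borel_of[OF op] by (simp add: borel_measurable_iff_greater sp prob_measD(2)[OF M])
  have g0: "0 \<le> g y" if "y \<in> topspace Y" for y using \<F>(2,3) \<open>\<F> \<noteq> {}\<close> that by (meson all_not_in_conv order_trans)
  have gi: "integrable M g"
    using g0 g1 by (intro integrable_const_bound[of _ 1] gm) (auto simp: sp intro!: AE_I2)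
  \<comment> \<open>With this \<open>n\<close> the discretisation costs at most \<open>e/2\<close>;
    the other half pays for replacing every level set \<open>G k\<close> by a compact subset
    \<open>K k\<close>.\<close>
  obtain n :: nat where n: "2 / e < real n" using reals_Archimedean2 by blast
  then have n0: "0 < n" using e by (metis divide_pos_pos gr0I of_nat_0 less_asym zero_less_numeral)
  have n1: "1 / real n \<le> e / 2" using n n0 e by (simp add: field_simps)
  define G where "G k = {y \<in> topspace Y. real k / real n < g y}" for k
  have Go: "openin Y (G k)" for k unfolding G_def by (rule op)
  have GS: "G k \<in> sets M" for k using Go openin_sets_borel_of prob_measD(2)[OF M] by auto
  have "\<exists>K. closedin Y K \<and> K \<subseteq> G k \<and> measure M (G k) < measure M K + e/2" for k
    using inner_closed_approx[OF Y M Go, of "e/2"] e by (metis half_gt_zero)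
  then obtain K where K: "\<And>k. closedin Y (K k)" "\<And>k. K k \<subseteq> G k" "\<And>k. measure M (G k) < measure M (K k) + e/2"
    by metis
  have KS: "K k \<in> sets M" for k using K(1) closedin_sets_borel_of prob_measD(2)[OF M] by auto
  \<comment> \<open>By compactness finitely many members of the family exceed the level on
    \<open>K k\<close>, and by directedness a single one does.\<close>
  have "\<exists>f\<in>\<F>. \<forall>y\<in>K k. real k / real n < f y" for k
  proof -
    have "compactin Y (K k)" using K(1) chaus_closed_eq_compact[OF Y] by blast
    moreover have "\<forall>V\<in>(\<lambda>f. {y \<in> topspace Y. real k / real n < f y}) ` \<F>. openin Y V"
      using openin_superlevel \<F>(1) by blast
    moreover have "K k \<subseteq> \<Union>((\<lambda>f. {y \<in> topspace Y. real k / real n < f y}) ` \<F>)"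
      using K(2)[of k] unfolding G_def lev .
    ultimately have "\<exists>\<V>. finite \<V> \<and> \<V> \<subseteq> (\<lambda>f. {y \<in> topspace Y. real k / real n < f y}) ` \<F> \<and> K k \<subseteq> \<Union>\<V>"
      unfolding compactin_def by (metis (no_types, lifting))
    then obtain S where S: "finite S" "S \<subseteq> \<F>" "K k \<subseteq> (\<Union>f\<in>S. {y \<in> topspace Y. real k / real n < f y})"
      by (metis (no_types, lifting) finite_subset_image)
    then obtain h where h: "h \<in> \<F>" "\<forall>f\<in>S. \<forall>y\<in>topspace Y. f y \<le> h y" using dirfin by blast
    have "real k / real n < h y" if yK: "y \<in> K k" for y
    proof -
      obtain f where "f \<in> S" "y \<in> topspace Y" "real k / real n < f y" using S(3) yK by blast
      then show ?thesis using h(2) by fastforce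
    qed
    then show ?thesis using h(1) by blast
  qed
  then obtain f where f: "\<And>k. f k \<in> \<F>" "\<And>k y. y \<in> K k \<Longrightarrow> real k / real n < f k y" by metis
  \<comment> \<open>Directedness is used a second time, to find one member above the functions
    chosen for all \<open>n\<close> levels.\<close>
  have "f ` {..<n} \<subseteq> \<F>" using f(1) by auto
  then obtain h where h: "h \<in> \<F>" "\<And>k y. k < n \<Longrightarrow> y \<in> topspace Y \<Longrightarrow> f k y \<le> h y"
    using dirfin[of "f ` {..<n}"] by auto
  have hi: "integrable M h" by (rule integrable_continuous[OF Y M \<F>(1)[OF h(1)]])
  have "real n * g y \<le> (\<Sum>k<n. indicator (G k) y)" if y: "y \<in> topspace Y" for y
  proof -
    have "real n * g y = min (real n) (real n * g y)" using g1[OF y] by (simp add: mult_left_le)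
    also have "\<dots> \<le> (\<Sum>k<n. of_bool (real k < real n * g y))" by (rule sum_of_bool_less_ge)
    also have "\<dots> = (\<Sum>k<n. indicator (G k) y)"
      using y n0 by (intro sum.cong) (auto simp: G_def field_simps split: split_indicator)
    finally show ?thesis .
  qed
  then have "(\<integral>y. real n * g y \<partial>M) \<le> (\<integral>y. (\<Sum>k<n. indicator (G k) y) \<partial>M)"
    using gi GS by (intro integral_mono) (auto simp: sp emeasure_eq_measure)
  also have "\<dots> = (\<Sum>k<n. measure M (G k))"
    using GS by (subst Bochner_Integration.integral_sum) (auto simp: emeasure_eq_measure)
  also have "\<dots> \<le> (\<Sum>k<n. measure M (K k) + e/2)"
    using K(3) by (intro sum_mono less_imp_le)
  also have "\<dots> = (\<Sum>k<n. measure M (K k)) + real n * (e/2)" by (simp add: sum.distrib)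
  also have "(\<Sum>k<n. measure M (K k)) = (\<integral>y. (\<Sum>k<n. indicator (K k) y) \<partial>M)"
    using KS by (subst Bochner_Integration.integral_sum) (auto simp: emeasure_eq_measure)
  also have "\<dots> \<le> (\<integral>y. real n * h y + 1 \<partial>M)"
  proof (intro integral_mono)
    fix y assume "y \<in> space M"
    then have y: "y \<in> topspace Y" by (simp add: sp)
    have "(\<Sum>k<n. indicator (K k) y) \<le> (\<Sum>k<n. of_bool (real k < real n * h y) :: real)"
    proof (intro sum_mono)
      fix k assume "k \<in> {..<n}"
      then have "y \<in> K k \<Longrightarrow> real k / real n < h y" using f(2)[of y k] h(2)[of k y] y by auto
      then show "indicator (K k) y \<le> (of_bool (real k < real n * h y) :: real)"
        using n0 by (auto simp: field_simps split: split_indicator)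
    qed
    also have "\<dots> \<le> real n * h y + 1"
      using sum_of_bool_less_le[of "real n * h y" n] \<F>(2)[OF h(1) y] by (simp del: sum_of_bool_eq)
    finally show "(\<Sum>k<n. indicator (K k) y) \<le> real n * h y + 1" .
  qed (use hi KS in \<open>auto simp: emeasure_eq_measure\<close>)
  also have "\<dots> = real n * (\<integral>y. h y \<partial>M) + 1" using hi by (simp add: prob_space)
  finally have "real n * (\<integral>y. g y \<partial>M) \<le> real n * (\<integral>y. h y \<partial>M) + 1 + real n * (e/2)" by simp
  then have "(\<integral>y. g y \<partial>M) \<le> (\<integral>y. h y \<partial>M) + 1 / real n + e/2" using n0 by (simp add: field_simps)
  then show ?thesis using that[OF h(1)] n1 by linarith
qed

section \<open>Composition of kernels preserves regularity\<close>

context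
  fixes Y :: "'y topology" and Z :: "'z topology" and \<nu> :: "'y \<Rightarrow> 'z measure"
  assumes Y: "chaus Y" and Z: "chaus Z" and \<nu>: "\<nu> \<in> stoch Y Z"
begin

lemma stoch_bumps_max:
  assumes "\<phi> \<in> bumps Z U" "\<psi> \<in> bumps Z U"
  shows "(\<lambda>z. max (\<phi> z) (\<psi> z)) \<in> bumps Z U"
  using assms unfolding bumps_def by (simp add: continuous_map_real_max le_max_iff_disj)

lemma stoch_bump_le:
  assumes "openin Z U" "\<phi> \<in> bumps Z U" "y \<in> topspace Y"
  shows "0 \<le> (\<integral>z. \<phi> z \<partial>\<nu> y)" "(\<integral>z. \<phi> z \<partial>\<nu> y) \<le> measure (\<nu> y) U"
  using bump_integral_bounds(2,3)[OF Z stochD(2)[OF \<nu> assms(3)] assms(2)] openin_sets_borel_of[OF assms(1)]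
    prob_measD(2)[OF stochD(2)[OF \<nu> assms(3)]] by simp_all

lemma stoch_bump_sup:
  assumes "openin Z U" "y \<in> topspace Y" "t < measure (\<nu> y) U"
  shows "\<exists>\<phi>\<in>bumps Z U. t < (\<integral>z. \<phi> z \<partial>\<nu> y)"
proof -
  have "0 < measure (\<nu> y) U - t" using assms by simp
  then obtain \<phi> where "\<phi> \<in> bumps Z U" "measure (\<nu> y) U < (\<integral>z. \<phi> z \<partial>\<nu> y) + (measure (\<nu> y) U - t)"
    using bump_approx[OF Z stochD(2)[OF \<nu> assms(2)] assms(1)] by blast
  then show ?thesis by (intro bexI[of _ \<phi>]) auto
qed

text \<open>The function is lower semicontinuous, as a supremum of the continuous functions obtained
  by integrating the bumps in \<open>U\<close>.\<close>

lemma stoch_open_measurable: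
  assumes U: "openin Z U"
  shows "(\<lambda>y. measure (\<nu> y) U) \<in> borel_measurable (borel_of Y)"
proof -
  have "openin Y {y \<in> topspace Y. t < measure (\<nu> y) U}" for t
  proof -
    have "{y \<in> topspace Y. t < measure (\<nu> y) U} = (\<Union>\<phi>\<in>bumps Z U. {y \<in> topspace Y. t < (\<integral>z. \<phi> z \<partial>\<nu> y)})"
      using stoch_bump_sup[OF U] stoch_bump_le(2)[OF U] by (auto intro: less_le_trans)
    then show ?thesis
      using openin_superlevel[OF stoch_continuous_real[OF \<nu>]] by (auto simp: bumps_def)
  qed
  from openin_sets_borel_of[OF this] show ?thesis by (simp add: borel_measurable_iff_greater)
qed

text \<open>Measurability of a kernel needs checking only on a generator closed under intersection,
  here the open sets. Afterwards the Giry \<open>bind\<close> is available as the composite.\<close>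

lemma stoch_kernel: "\<nu> \<in> measurable (borel_of Y) (prob_algebra (borel_of Z))"
proof (rule measurable_prob_algebra_generated[OF sets_borel_of])
  show "Int_stable {U. openin Z U}" by (auto simp: Int_stable_def)
  show "{U. openin Z U} \<subseteq> Pow (topspace Z)" by (auto dest: openin_subset)
  fix y assume "y \<in> space (borel_of Y)"
  then show "prob_space (\<nu> y)" "sets (\<nu> y) = sets (borel_of Z)"
    using prob_measD(2,3)[OF stochD(2)[OF \<nu>]] by auto
next
  fix U assume "U \<in> {U. openin Z U}"
  then have "(\<lambda>y. ennreal (measure (\<nu> y) U)) \<in> borel_measurable (borel_of Y)"
    using stoch_open_measurable by auto
  moreover have "emeasure (\<nu> y) U = ennreal (measure (\<nu> y) U)" if "y \<in> space (borel_of Y)" for y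
  proof -
    interpret prob_space "\<nu> y" using prob_measD(3) stochD(2)[OF \<nu>] that by auto
    show ?thesis by (rule emeasure_eq_measure)
  qed
  ultimately show "(\<lambda>y. emeasure (\<nu> y) U) \<in> borel_measurable (borel_of Y)"
    by (subst measurable_cong) auto
qed

context
  fixes M :: "'y measure"
  assumes M: "M \<in> prob_meas Y"
begin

lemma stoch_kernel': "\<nu> \<in> measurable M (subprob_algebra (borel_of Z))"
  using measurable_prob_algebraD[OF stoch_kernel] by (simp add: measurable_cong_sets[OF prob_measD(2)[OF M] refl])

lemma prob_meas_space_nonempty: "space M \<noteq> {}"
  using prob_measD(1)[OF M] Y by (simp add: chaus_def)

lemma sets_bind_stoch: "sets (M \<bind> \<nu>) = sets (borel_of Z)"
  by (rule sets_bind[OF subprob_measurableD(2)[OF stoch_kernel'] prob_meas_space_nonempty])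

lemma prob_space_bind_stoch: "prob_space (M \<bind> \<nu>)"
proof -
  interpret prob_space M using M prob_measD by blast
  show ?thesis
    using prob_measD(3)[OF stochD(2)[OF \<nu>]] prob_measD(1)[OF M]
    by (intro prob_space_bind[OF _ stoch_kernel'] AE_I2) simp
qed

lemma integral_bind_stoch:
  assumes \<phi>: "continuous_map Z euclideanreal \<phi>"
  shows "(\<integral>z. \<phi> z \<partial>(M \<bind> \<nu>)) = (\<integral>y. (\<integral>z. \<phi> z \<partial>\<nu> y) \<partial>M)"
proof -
  obtain B where B: "\<And>z. z \<in> topspace Z \<Longrightarrow> norm (\<phi> z) \<le> B"
    using continuous_map_bounded[OF Z \<phi>] by blast
  show ?thesis
  proof (rule integral_bind[where B' = 1 and B = B])
    show "finite_measure M" using M prob_measD(3) prob_space.finite_measure by blast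
    show "AE y in M. emeasure (\<nu> y) (space (\<nu> y)) \<le> ennreal 1"
      using stochD(2)[OF \<nu>] prob_measD(1)[OF M] prob_measD(3) prob_space.emeasure_space_1
      by (intro AE_I2) fastforce
  qed (use B stoch_kernel' continuous_map_borel_of[OF \<phi>] in auto)
qed

lemma measure_bind_stoch:
  assumes U: "openin Z U"
  shows "measure (M \<bind> \<nu>) U = (\<integral>y. measure (\<nu> y) U \<partial>M)"
proof -
  interpret prob_space M using M prob_measD by blast
  have "emeasure (M \<bind> \<nu>) U = (\<integral>\<^sup>+y. emeasure (\<nu> y) U \<partial>M)"
    using emeasure_bind[OF prob_meas_space_nonempty stoch_kernel'] openin_sets_borel_of[OF U] by blast
  also have "\<dots> = (\<integral>\<^sup>+y. ennreal (measure (\<nu> y) U) \<partial>M)"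
    using prob_measD(1)[OF M] prob_measD(3) stochD(2)[OF \<nu>]
    by (intro nn_integral_cong finite_measure.emeasure_eq_measure prob_space.finite_measure) auto
  also have "\<dots> = ennreal (\<integral>y. measure (\<nu> y) U \<partial>M)"
    using prob_meas_measurable[OF M stoch_open_measurable[OF U]] prob_measD(1)[OF M] prob_measD(3) stochD(2)[OF \<nu>]
    by (intro nn_integral_eq_integral integrable_const_bound[of _ 1])
       (auto intro!: AE_I2 prob_space.prob_le_1)
  finally show ?thesis by (simp add: measure_def)
qed

text \<open>The integrals of the bumps in \<open>U\<close> against \<open>\<nu> y\<close> form a
  family of functions of \<open>y\<close> that is directed because bumps are closed under maxima. So
  a single bump nearly attains the composite measure of \<open>U\<close>, and a level set of this
  bump is the closed set required.\<close>

lemma bind_stoch_prob_meas: "M \<bind> \<nu> \<in> prob_meas Z"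
proof (rule prob_measI_inner_open[OF Z sets_bind_stoch prob_space_bind_stoch])
  interpret MN: prob_space "M \<bind> \<nu>" by (rule prob_space_bind_stoch)
  have sp: "space (M \<bind> \<nu>) = topspace Z" using sets_eq_imp_space_eq[OF sets_bind_stoch] by simp
  fix U and e :: real assume U: "openin Z U" and e: "0 < e"
  let ?F = "(\<lambda>\<phi> y. \<integral>z. \<phi> z \<partial>\<nu> y) ` bumps Z U"
  have "\<exists>f\<in>?F. (\<integral>y. measure (\<nu> y) U \<partial>M) \<le> (\<integral>y. f y \<partial>M) + e/4"
  proof (rule integral_directed_sup_approx[OF Y M, of ?F "\<lambda>y. measure (\<nu> y) U" "e/4"])
    show "?F \<noteq> {}" by (auto simp: bumps_def intro!: exI[of _ "\<lambda>_. 0"])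
    fix f assume f: "f \<in> ?F"
    show "continuous_map Y euclideanreal f" using f stoch_continuous_real[OF \<nu>] by (auto simp: bumps_def)
    show "0 \<le> f y" "f y \<le> measure (\<nu> y) U" if "y \<in> topspace Y" for y using f stoch_bump_le[OF U _ that] by auto
    fix f' assume f': "f' \<in> ?F"
    obtain \<phi> \<psi> where \<phi>\<psi>: "\<phi> \<in> bumps Z U" "\<psi> \<in> bumps Z U" "f = (\<lambda>y. \<integral>z. \<phi> z \<partial>\<nu> y)" "f' = (\<lambda>y. \<integral>z. \<psi> z \<partial>\<nu> y)"
      using f f' by auto
    have i: "integrable (\<nu> y) \<phi>'" if "\<phi>' \<in> bumps Z U" "y \<in> topspace Y" for \<phi>' y
      using integrable_continuous[OF Z stochD(2)[OF \<nu>]] that by (auto simp: bumps_def)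
    have "f y \<le> (\<integral>z. max (\<phi> z) (\<psi> z) \<partial>\<nu> y) \<and> f' y \<le> (\<integral>z. max (\<phi> z) (\<psi> z) \<partial>\<nu> y)" if "y \<in> topspace Y" for y
      unfolding \<phi>\<psi>(3,4) using i[OF _ that] \<phi>\<psi>(1,2) stoch_bumps_max[OF \<phi>\<psi>(1,2)]
      by (intro conjI integral_mono) auto
    then show "\<exists>h\<in>?F. \<forall>y\<in>topspace Y. f y \<le> h y \<and> f' y \<le> h y"
      by (intro bexI[OF _ imageI[OF stoch_bumps_max[OF \<phi>\<psi>(1,2)]]] ballI)
  next
    show "measure (\<nu> y) U \<le> 1" if "y \<in> topspace Y" for y
      using prob_space.prob_le_1 prob_measD(3) stochD(2)[OF \<nu> that] by blast
    show "\<exists>f\<in>?F. t < f y" if "y \<in> topspace Y" "t < measure (\<nu> y) U" for y t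
      using stoch_bump_sup[OF U that] by auto
  qed (use e in auto)
  then obtain \<phi> where \<phi>: "\<phi> \<in> bumps Z U" "(\<integral>y. measure (\<nu> y) U \<partial>M) \<le> (\<integral>y. (\<integral>z. \<phi> z \<partial>\<nu> y) \<partial>M) + e/4" by auto
  have \<phi>c: "continuous_map Z euclideanreal \<phi>" using \<phi>(1) by (auto simp: bumps_def)
  \<comment> \<open>Since \<open>\<phi>\<close> is at most 1, it is at most the indicator of
    \<open>K\<close> plus \<open>e/4\<close>. With the \<open>e/4\<close> from the choice of
    \<open>\<phi>\<close> the total error is \<open>e/2\<close>.\<close>
  define K where "K = {z \<in> topspace Z. e/4 \<le> \<phi> z}"
  have K: "closedin Z K" unfolding K_def by (rule closedin_superlevel[OF \<phi>c])
  have KU: "K \<subseteq> U" using \<phi>(1) e by (force simp: K_def bumps_def)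
  have KS: "K \<in> sets (M \<bind> \<nu>)" using K by (simp add: sets_bind_stoch closedin_sets_borel_of)
  have "measure (M \<bind> \<nu>) U \<le> (\<integral>z. \<phi> z \<partial>(M \<bind> \<nu>)) + e/4"
    using \<phi>(2) by (simp add: measure_bind_stoch[OF U] integral_bind_stoch[OF \<phi>c])
  also have "(\<integral>z. \<phi> z \<partial>(M \<bind> \<nu>)) \<le> (\<integral>z. indicator K z + e/4 \<partial>(M \<bind> \<nu>))"
  proof (intro integral_mono)
    show "integrable (M \<bind> \<nu>) \<phi>"
      using \<phi>(1) continuous_map_borel_of[OF \<phi>c] measurable_cong_sets[OF sets_bind_stoch refl]
      by (intro MN.integrable_const_bound[of _ 1]) (auto simp: sp bumps_def intro!: AE_I2)
    show "integrable (M \<bind> \<nu>) (\<lambda>z. indicator K z + e/4)" using KS by (auto simp: MN.emeasure_eq_measure)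
    show "\<phi> z \<le> indicator K z + e/4" if "z \<in> space (M \<bind> \<nu>)" for z
      using \<phi>(1) that e by (auto simp: sp K_def bumps_def split: split_indicator)
  qed
  also have "(\<integral>z. indicator K z + e/4 \<partial>(M \<bind> \<nu>)) = measure (M \<bind> \<nu>) K + e/4"
    using KS by (simp add: MN.emeasure_eq_measure MN.prob_space)
  finally have "measure (M \<bind> \<nu>) U < measure (M \<bind> \<nu>) K + e" using e by simp
  then show "\<exists>K. closedin Z K \<and> K \<subseteq> U \<and> measure (M \<bind> \<nu>) U < measure (M \<bind> \<nu>) K + e"
    using K KU by blast
qed

text \<open>Links the explicit set function in the definition of composition to \<open>bind\<close>:
  both agree on every Borel set, so \<open>measure_of\<close> rebuilds \<open>bind\<close>.\<close>

lemma measure_of_eq_bind: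
  "measure_of (topspace Z) (sets (borel_of Z)) (\<lambda>E. \<integral>\<^sup>+y. emeasure (\<nu> y) E \<partial>M) = M \<bind> \<nu>"
proof -
  have "measure_of (topspace Z) (sets (borel_of Z)) (\<lambda>E. \<integral>\<^sup>+y. emeasure (\<nu> y) E \<partial>M)
      = measure_of (topspace Z) (sets (borel_of Z)) (emeasure (M \<bind> \<nu>))"
    using sets.sets_into_space[of _ "borel_of Z"] sets.sigma_sets_eq[of "borel_of Z"]
      emeasure_bind[OF prob_meas_space_nonempty stoch_kernel']
    by (intro measure_of_eq) auto
  also have "\<dots> = measure_of (space (M \<bind> \<nu>)) (sets (M \<bind> \<nu>)) (emeasure (M \<bind> \<nu>))"
    using prob_measD[OF bind_stoch_prob_meas] by simp
  finally show ?thesis by (simp add: measure_of_of_measure)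
qed

end

end

section \<open>The category laws for stochastic maps\<close>

lemma stoch_comp_eq_bind:
  assumes "chaus Y" "chaus Z" "\<mu> \<in> stoch X Y" "\<nu> \<in> stoch Y Z" "x \<in> topspace X"
  shows "stoch_comp X Z \<nu> \<mu> x = \<mu> x \<bind> \<nu>"
  using measure_of_eq_bind[OF assms(1,2,4) stochD(2)[OF assms(3,5)]] assms(5) by (simp add: stoch_comp_def)

lemma integral_stoch_comp:
  assumes "chaus Y" "chaus Z" "\<mu> \<in> stoch X Y" "\<nu> \<in> stoch Y Z" "x \<in> topspace X"
    and "continuous_map Z euclideanreal \<phi>"
  shows "(\<integral>z. \<phi> z \<partial>stoch_comp X Z \<nu> \<mu> x) = (\<integral>y. (\<integral>z. \<phi> z \<partial>\<nu> y) \<partial>\<mu> x)"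
  using stoch_comp_eq_bind[OF assms(1-5)] integral_bind_stoch[OF assms(1,2,4) stochD(2)[OF assms(3,5)] assms(6)] by simp

lemma stoch_comp_in_stoch:
  assumes "chaus Y" "chaus Z" "\<mu> \<in> stoch X Y" "\<nu> \<in> stoch Y Z"
  shows "stoch_comp X Z \<nu> \<mu> \<in> stoch X Z"
proof (rule stochI[OF assms(2)])
  show "stoch_comp X Z \<nu> \<mu> \<in> extensional (topspace X)" by (simp add: stoch_comp_def)
  show "stoch_comp X Z \<nu> \<mu> x \<in> prob_meas Z" if "x \<in> topspace X" for x
    using stoch_comp_eq_bind[OF assms that] bind_stoch_prob_meas[OF assms(1,2,4) stochD(2)[OF assms(3) that]] by simp
  fix \<phi> assume \<phi>: "continuous_map Z euclideanreal \<phi>"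
  have "continuous_map X euclideanreal (\<lambda>x. \<integral>y. (\<integral>z. \<phi> z \<partial>\<nu> y) \<partial>\<mu> x)"
    using assms(3,4) \<phi> by (intro stoch_continuous_real)
  then show "continuous_map X euclideanreal (\<lambda>x. \<integral>z. \<phi> z \<partial>stoch_comp X Z \<nu> \<mu> x)"
    by (rule continuous_map_eq) (simp add: integral_stoch_comp[OF assms _ \<phi>])
qed

lemma integral_return_continuous:
  assumes "x \<in> topspace X" "continuous_map X euclidean \<phi>"
  shows "(\<integral>y. \<phi> y \<partial>return (borel_of X) x) = (\<phi> x :: 'b::{banach, second_countable_topology})"
  using assms continuous_map_borel_of by (intro integral_return) auto

lemma dirac_map_in_stoch:
  assumes "chaus Y" "continuous_map X Y f"
  shows "dirac_map X Y f \<in> stoch X Y"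
proof (rule stochI[OF assms(1)])
  have f: "f x \<in> topspace Y" if "x \<in> topspace X" for x using assms(2) that by (auto simp: continuous_map_def)
  show "dirac_map X Y f \<in> extensional (topspace X)" by (simp add: dirac_map_def)
  show "dirac_map X Y f x \<in> prob_meas Y" if "x \<in> topspace X" for x
    using return_prob_meas[OF assms(1) f[OF that]] that by (simp add: dirac_map_def)
  fix \<phi> assume \<phi>: "continuous_map Y euclideanreal \<phi>"
  have "continuous_map X euclideanreal (\<phi> \<circ> f)" using assms(2) \<phi> by (rule continuous_map_compose)
  then show "continuous_map X euclideanreal (\<lambda>x. \<integral>y. \<phi> y \<partial>dirac_map X Y f x)"
    by (rule continuous_map_eq) (use f \<phi> in \<open>simp add: dirac_map_def integral_return_continuous\<close>)
qed

lemma stoch_id_in_stoch: "chaus X \<Longrightarrow> stoch_id X \<in> stoch X X"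
  unfolding stoch_id_def by (rule dirac_map_in_stoch) auto

lemma integral_dirac_map:
  assumes "continuous_map X Y f" "x \<in> topspace X" "continuous_map Y euclidean \<phi>"
  shows "(\<integral>y. \<phi> y \<partial>dirac_map X Y f x) = (\<phi> (f x) :: 'b::{banach, second_countable_topology})"
proof -
  have "f x \<in> topspace Y" using assms by (auto simp: continuous_map_def)
  then show ?thesis using assms by (simp add: dirac_map_def integral_return_continuous)
qed

lemma integral_stoch_id:
  "\<lbrakk>x \<in> topspace X; continuous_map X euclidean \<phi>\<rbrakk>
    \<Longrightarrow> (\<integral>y. \<phi> y \<partial>stoch_id X x) = (\<phi> x :: 'b::{banach, second_countable_topology})"
  unfolding stoch_id_def by (simp add: integral_dirac_map)

lemma stoch_comp_id_right:
  assumes "chaus X" "chaus Y" "\<mu> \<in> stoch X Y"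
  shows "stoch_comp X Y \<mu> (stoch_id X) = \<mu>"
proof (rule stoch_eqI[OF assms(2)])
  show "stoch_comp X Y \<mu> (stoch_id X) \<in> stoch X Y"
    by (rule stoch_comp_in_stoch[OF assms(1,2) stoch_id_in_stoch[OF assms(1)] assms(3)])
  fix x \<phi> assume "x \<in> topspace X" "continuous_map Y euclideanreal \<phi>"
  then show "(\<integral>y. \<phi> y \<partial>stoch_comp X Y \<mu> (stoch_id X) x) = (\<integral>y. \<phi> y \<partial>\<mu> x)"
    by (simp add: integral_stoch_comp[OF assms(1,2) stoch_id_in_stoch[OF assms(1)] assms(3)]
        integral_stoch_id stoch_continuous_real[OF assms(3)])
qed (rule assms(3))

lemma stoch_comp_id_left:
  assumes "chaus Y" "\<mu> \<in> stoch X Y"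
  shows "stoch_comp X Y (stoch_id Y) \<mu> = \<mu>"
proof (rule stoch_eqI[OF assms(1)])
  show "stoch_comp X Y (stoch_id Y) \<mu> \<in> stoch X Y"
    by (rule stoch_comp_in_stoch[OF assms(1,1,2) stoch_id_in_stoch[OF assms(1)]])
  fix x \<phi> assume x: "x \<in> topspace X" and \<phi>: "continuous_map Y euclideanreal \<phi>"
  have "(\<integral>y. (\<integral>z. \<phi> z \<partial>stoch_id Y y) \<partial>\<mu> x) = (\<integral>y. \<phi> y \<partial>\<mu> x)"
    using prob_measD(1)[OF stochD(2)[OF assms(2) x]] \<phi>
    by (intro Bochner_Integration.integral_cong) (auto simp: integral_stoch_id)
  then show "(\<integral>y. \<phi> y \<partial>stoch_comp X Y (stoch_id Y) \<mu> x) = (\<integral>y. \<phi> y \<partial>\<mu> x)"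
    by (simp add: integral_stoch_comp[OF assms(1,1,2) stoch_id_in_stoch[OF assms(1)] x \<phi>])
qed (rule assms(2))

text \<open>Both sides integrate a test function to the same iterated integral, in the same order of
  integration.\<close>

lemma stoch_comp_assoc:
  assumes "chaus Y" "chaus Z" "chaus W" "\<mu> \<in> stoch X Y" "\<nu> \<in> stoch Y Z" "\<kappa> \<in> stoch Z W"
  shows "stoch_comp X W (stoch_comp Y W \<kappa> \<nu>) \<mu> = stoch_comp X W \<kappa> (stoch_comp X Z \<nu> \<mu>)"
proof (rule stoch_eqI[OF assms(3)])
  have \<kappa>\<nu>: "stoch_comp Y W \<kappa> \<nu> \<in> stoch Y W" by (rule stoch_comp_in_stoch[OF assms(2,3,5,6)])
  have \<nu>\<mu>: "stoch_comp X Z \<nu> \<mu> \<in> stoch X Z" by (rule stoch_comp_in_stoch[OF assms(1,2,4,5)])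
  show "stoch_comp X W (stoch_comp Y W \<kappa> \<nu>) \<mu> \<in> stoch X W"
    by (rule stoch_comp_in_stoch[OF assms(1,3,4) \<kappa>\<nu>])
  show "stoch_comp X W \<kappa> (stoch_comp X Z \<nu> \<mu>) \<in> stoch X W"
    by (rule stoch_comp_in_stoch[OF assms(2,3) \<nu>\<mu> assms(6)])
  fix x \<phi> assume x: "x \<in> topspace X" and \<phi>: "continuous_map W euclideanreal \<phi>"
  have "(\<integral>w. \<phi> w \<partial>stoch_comp X W (stoch_comp Y W \<kappa> \<nu>) \<mu> x) = (\<integral>y. (\<integral>w. \<phi> w \<partial>stoch_comp Y W \<kappa> \<nu> y) \<partial>\<mu> x)"
    by (rule integral_stoch_comp[OF assms(1,3,4) \<kappa>\<nu> x \<phi>])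
  also have "\<dots> = (\<integral>y. (\<integral>z. (\<integral>w. \<phi> w \<partial>\<kappa> z) \<partial>\<nu> y) \<partial>\<mu> x)"
    using prob_measD(1)[OF stochD(2)[OF assms(4) x]]
    by (intro Bochner_Integration.integral_cong) (auto simp: integral_stoch_comp[OF assms(2,3,5,6) _ \<phi>])
  also have "\<dots> = (\<integral>z. (\<integral>w. \<phi> w \<partial>\<kappa> z) \<partial>stoch_comp X Z \<nu> \<mu> x)"
    by (rule integral_stoch_comp[OF assms(1,2,4,5) x stoch_continuous_real[OF assms(6) \<phi>], symmetric])
  also have "\<dots> = (\<integral>w. \<phi> w \<partial>stoch_comp X W \<kappa> (stoch_comp X Z \<nu> \<mu>) x)"
    by (rule integral_stoch_comp[OF assms(2,3) \<nu>\<mu> assms(6) x \<phi>, symmetric])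
  finally show "(\<integral>w. \<phi> w \<partial>stoch_comp X W (stoch_comp Y W \<kappa> \<nu>) \<mu> x)
      = (\<integral>w. \<phi> w \<partial>stoch_comp X W \<kappa> (stoch_comp X Z \<nu> \<mu>) x)" .
qed

section \<open>Characters of commutative C*-algebras\<close>

context comm_cstar_algebra
begin

text \<open>The locale \<open>algebra\<close> speaks about the operations of the record
  \<open>complex_ring\<close>. These versions use plain complex arithmetic, and they write
  subtraction as addition of a multiple by -1, so that the scalar laws handle it.\<close>

lemma
  shows add_closed [simp]: "\<lbrakk>x \<in> carrier A; y \<in> carrier A\<rbrakk> \<Longrightarrow> x \<oplus>\<^bsub>A\<^esub> y \<in> carrier A"
    and mult_closed [simp]: "\<lbrakk>x \<in> carrier A; y \<in> carrier A\<rbrakk> \<Longrightarrow> x \<otimes>\<^bsub>A\<^esub> y \<in> carrier A"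
    and scale_closed [simp]: "x \<in> carrier A \<Longrightarrow> c \<odot>\<^bsub>A\<^esub> x \<in> carrier A"
    and one_closed_A [simp]: "\<one>\<^bsub>A\<^esub> \<in> carrier A"
    and zero_closed_A [simp]: "\<zero>\<^bsub>A\<^esub> \<in> carrier A"
    and scale_one [simp]: "x \<in> carrier A \<Longrightarrow> 1 \<odot>\<^bsub>A\<^esub> x = x"
    and scale_scale: "x \<in> carrier A \<Longrightarrow> c \<odot>\<^bsub>A\<^esub> (d \<odot>\<^bsub>A\<^esub> x) = (c * d) \<odot>\<^bsub>A\<^esub> x"
    and scale_add_left: "x \<in> carrier A \<Longrightarrow> (c + d) \<odot>\<^bsub>A\<^esub> x = c \<odot>\<^bsub>A\<^esub> x \<oplus>\<^bsub>A\<^esub> d \<odot>\<^bsub>A\<^esub> x"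
    and scale_add_right: "\<lbrakk>x \<in> carrier A; y \<in> carrier A\<rbrakk> \<Longrightarrow> c \<odot>\<^bsub>A\<^esub> (x \<oplus>\<^bsub>A\<^esub> y) = c \<odot>\<^bsub>A\<^esub> x \<oplus>\<^bsub>A\<^esub> c \<odot>\<^bsub>A\<^esub> y"
    and scale_mult_left: "\<lbrakk>x \<in> carrier A; y \<in> carrier A\<rbrakk> \<Longrightarrow> (c \<odot>\<^bsub>A\<^esub> x) \<otimes>\<^bsub>A\<^esub> y = c \<odot>\<^bsub>A\<^esub> (x \<otimes>\<^bsub>A\<^esub> y)"
    and scale_mult_right: "\<lbrakk>x \<in> carrier A; y \<in> carrier A\<rbrakk> \<Longrightarrow> x \<otimes>\<^bsub>A\<^esub> (c \<odot>\<^bsub>A\<^esub> y) = c \<odot>\<^bsub>A\<^esub> (x \<otimes>\<^bsub>A\<^esub> y)"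
    and scale_zero [simp]: "x \<in> carrier A \<Longrightarrow> 0 \<odot>\<^bsub>A\<^esub> x = \<zero>\<^bsub>A\<^esub>"
    and scale_zero_right [simp]: "c \<odot>\<^bsub>A\<^esub> \<zero>\<^bsub>A\<^esub> = \<zero>\<^bsub>A\<^esub>"
    and diff_eq_scale: "\<lbrakk>x \<in> carrier A; y \<in> carrier A\<rbrakk> \<Longrightarrow> x \<ominus>\<^bsub>A\<^esub> y = x \<oplus>\<^bsub>A\<^esub> (-1) \<odot>\<^bsub>A\<^esub> y"
proof -
  show m: "c \<odot>\<^bsub>A\<^esub> x \<in> carrier A" if "x \<in> carrier A" for c x
    using smult_closed[of c x] that by (simp add: complex_ring_def)
  show "x \<oplus>\<^bsub>A\<^esub> y \<in> carrier A" "x \<otimes>\<^bsub>A\<^esub> y \<in> carrier A" if "x \<in> carrier A" "y \<in> carrier A" for x y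
    using that by simp_all
  show "\<one>\<^bsub>A\<^esub> \<in> carrier A" "\<zero>\<^bsub>A\<^esub> \<in> carrier A" by simp_all
  show "1 \<odot>\<^bsub>A\<^esub> x = x" if "x \<in> carrier A" for x
    using smult_one[OF that] by (simp add: complex_ring_def)
  show "c \<odot>\<^bsub>A\<^esub> (d \<odot>\<^bsub>A\<^esub> x) = (c * d) \<odot>\<^bsub>A\<^esub> x" if "x \<in> carrier A" for c d x
    using smult_assoc1[of c d x] that by (simp add: complex_ring_def)
  show a: "(c + d) \<odot>\<^bsub>A\<^esub> x = c \<odot>\<^bsub>A\<^esub> x \<oplus>\<^bsub>A\<^esub> d \<odot>\<^bsub>A\<^esub> x" if "x \<in> carrier A" for c d x
    using smult_l_distr[of c d x] that by (simp add: complex_ring_def)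
  show "c \<odot>\<^bsub>A\<^esub> (x \<oplus>\<^bsub>A\<^esub> y) = c \<odot>\<^bsub>A\<^esub> x \<oplus>\<^bsub>A\<^esub> c \<odot>\<^bsub>A\<^esub> y" if "x \<in> carrier A" "y \<in> carrier A" for c x y
    using smult_r_distr[of c x y] that by (simp add: complex_ring_def)
  show l: "(c \<odot>\<^bsub>A\<^esub> x) \<otimes>\<^bsub>A\<^esub> y = c \<odot>\<^bsub>A\<^esub> (x \<otimes>\<^bsub>A\<^esub> y)" if "x \<in> carrier A" "y \<in> carrier A" for c x y
    using smult_assoc2[of c x y] that by (simp add: complex_ring_def)
  show "x \<otimes>\<^bsub>A\<^esub> (c \<odot>\<^bsub>A\<^esub> y) = c \<odot>\<^bsub>A\<^esub> (x \<otimes>\<^bsub>A\<^esub> y)" if "x \<in> carrier A" "y \<in> carrier A" for c x y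
    using l[of y x c] that m by (simp add: m_comm)
  show z: "0 \<odot>\<^bsub>A\<^esub> x = \<zero>\<^bsub>A\<^esub>" if "x \<in> carrier A" for x
    using smult_l_null[OF that] by (simp add: complex_ring_def)
  show "c \<odot>\<^bsub>A\<^esub> \<zero>\<^bsub>A\<^esub> = \<zero>\<^bsub>A\<^esub>" for c
    using smult_r_null[of c] by (simp add: complex_ring_def)
  have n: "\<ominus>\<^bsub>A\<^esub> x = (-1) \<odot>\<^bsub>A\<^esub> x" if "x \<in> carrier A" for x
  proof -
    have "(-1) \<odot>\<^bsub>A\<^esub> x \<oplus>\<^bsub>A\<^esub> x = \<zero>\<^bsub>A\<^esub>"
      using a[OF that, of "-1" 1] z[OF that] smult_one[OF that] by (simp add: complex_ring_def)
    then show ?thesis using that m by (simp add: M.minus_equality)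
  qed
  show "x \<ominus>\<^bsub>A\<^esub> y = x \<oplus>\<^bsub>A\<^esub> (-1) \<odot>\<^bsub>A\<^esub> y" if "x \<in> carrier A" "y \<in> carrier A" for x y
    using that n by (simp add: a_minus_def)
qed

lemma add_neg_self [simp]: "x \<in> carrier A \<Longrightarrow> x \<oplus>\<^bsub>A\<^esub> (-1) \<odot>\<^bsub>A\<^esub> x = \<zero>\<^bsub>A\<^esub>"
  using scale_add_left[of x 1 "-1"] by simp

lemma neg_add_self [simp]: "x \<in> carrier A \<Longrightarrow> (-1) \<odot>\<^bsub>A\<^esub> x \<oplus>\<^bsub>A\<^esub> x = \<zero>\<^bsub>A\<^esub>"
  using scale_add_left[of x "-1" 1] by simp

lemma cnorm_zero [simp]: "cnorm A \<zero>\<^bsub>A\<^esub> = 0"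
  by (simp add: cnorm_eq_0_iff)

lemma adj_one [simp]: "adj A \<one>\<^bsub>A\<^esub> = \<one>\<^bsub>A\<^esub>"
proof -
  have "adj A (adj A \<one>\<^bsub>A\<^esub> \<otimes>\<^bsub>A\<^esub> \<one>\<^bsub>A\<^esub>) = adj A \<one>\<^bsub>A\<^esub> \<otimes>\<^bsub>A\<^esub> adj A (adj A \<one>\<^bsub>A\<^esub>)"
    by (intro adj_mult) (auto simp: adj_closed)
  then show ?thesis by (simp add: adj_adj adj_closed)
qed

lemma cnorm_one [simp]: "cnorm A \<one>\<^bsub>A\<^esub> = 1"
proof -
  have "cnorm A \<one>\<^bsub>A\<^esub> = (cnorm A \<one>\<^bsub>A\<^esub>)\<^sup>2" using cstar_identity[of "\<one>\<^bsub>A\<^esub>"] by simp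
  moreover have "cnorm A \<one>\<^bsub>A\<^esub> \<noteq> 0" using cnorm_eq_0_iff[of "\<one>\<^bsub>A\<^esub>"] one_neq_zero by simp
  ultimately show ?thesis by (simp add: power2_eq_square)
qed

text \<open>Let \<open>y\<close> be the product of the adjoint of \<open>x\<close> with
  \<open>x\<close>; it is self-adjoint. By commutativity \<open>x \<otimes> x\<close> and
  \<open>y\<close> give the same element when multiplied by their own adjoints, so the C*-identity
  equates their norms. Applied to \<open>x\<close>, it evaluates the norm of
  \<open>y\<close>.\<close>

lemma cnorm_square:
  assumes x: "x \<in> carrier A"
  shows "cnorm A (x \<otimes>\<^bsub>A\<^esub> x) = (cnorm A x)\<^sup>2"
proof -
  let ?y = "adj A x \<otimes>\<^bsub>A\<^esub> x"
  have x': "adj A x \<in> carrier A" using adj_closed x .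
  have y: "?y \<in> carrier A" using x x' by simp
  have adjy: "adj A ?y = ?y" using adj_mult[OF x' x] adj_adj[OF x] by simp
  have "adj A (x \<otimes>\<^bsub>A\<^esub> x) \<otimes>\<^bsub>A\<^esub> (x \<otimes>\<^bsub>A\<^esub> x) = adj A ?y \<otimes>\<^bsub>A\<^esub> ?y"
    unfolding adjy adj_mult[OF x x] using x x' by (simp add: m_ac)
  then have "(cnorm A (x \<otimes>\<^bsub>A\<^esub> x))\<^sup>2 = (cnorm A ?y)\<^sup>2"
    using cstar_identity[of "x \<otimes>\<^bsub>A\<^esub> x"] cstar_identity[OF y] x by simp
  then have "cnorm A (x \<otimes>\<^bsub>A\<^esub> x) = cnorm A ?y" using x y by (simp add: cnorm_nonneg)
  then show ?thesis using cstar_identity[OF x] by simp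
qed

sublocale cs: Metric_space "carrier A" "cstar_dist A"
proof
  show "0 \<le> cstar_dist A x y" for x y by (simp add: cstar_dist_def cnorm_nonneg diff_eq_scale)
  show "cstar_dist A x y = cstar_dist A y x" for x y
  proof (cases "x \<in> carrier A \<and> y \<in> carrier A")
    case True
    then have "x \<ominus>\<^bsub>A\<^esub> y = (-1) \<odot>\<^bsub>A\<^esub> (y \<ominus>\<^bsub>A\<^esub> x)"
      by (simp add: diff_eq_scale scale_add_right scale_scale M.a_comm)
    then have "cnorm A (x \<ominus>\<^bsub>A\<^esub> y) = cnorm A (y \<ominus>\<^bsub>A\<^esub> x)"
      using cnorm_smult[of "y \<ominus>\<^bsub>A\<^esub> x" "-1"] True by simp
    then show ?thesis by (simp add: cstar_dist_def)
  qed (auto simp: cstar_dist_def)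
  show "cstar_dist A x y = 0 \<longleftrightarrow> x = y" if xy: "x \<in> carrier A" "y \<in> carrier A" for x y
  proof -
    have "x = y" if "x \<ominus>\<^bsub>A\<^esub> y = \<zero>\<^bsub>A\<^esub>"
    proof -
      have "(x \<ominus>\<^bsub>A\<^esub> y) \<oplus>\<^bsub>A\<^esub> y = x \<oplus>\<^bsub>A\<^esub> ((-1) \<odot>\<^bsub>A\<^esub> y \<oplus>\<^bsub>A\<^esub> y)"
        using xy by (simp add: diff_eq_scale M.a_assoc del: neg_add_self)
      then show ?thesis using xy that by simp
    qed
    then show ?thesis using xy by (auto simp: cstar_dist_def cnorm_eq_0_iff diff_eq_scale)
  qed
  show "cstar_dist A x z \<le> cstar_dist A x y + cstar_dist A y z"
    if "x \<in> carrier A" "y \<in> carrier A" "z \<in> carrier A" for x y z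
  proof -
    have "(x \<ominus>\<^bsub>A\<^esub> y) \<oplus>\<^bsub>A\<^esub> (y \<ominus>\<^bsub>A\<^esub> z) = (x \<oplus>\<^bsub>A\<^esub> (-1) \<odot>\<^bsub>A\<^esub> z) \<oplus>\<^bsub>A\<^esub> ((-1) \<odot>\<^bsub>A\<^esub> y \<oplus>\<^bsub>A\<^esub> y)"
      using that by (simp add: diff_eq_scale M.a_ac del: add_neg_self neg_add_self)
    then have "x \<ominus>\<^bsub>A\<^esub> z = (x \<ominus>\<^bsub>A\<^esub> y) \<oplus>\<^bsub>A\<^esub> (y \<ominus>\<^bsub>A\<^esub> z)" using that by (simp add: diff_eq_scale)
    then show ?thesis using cnorm_triangle[of "x \<ominus>\<^bsub>A\<^esub> y" "y \<ominus>\<^bsub>A\<^esub> z"] that by (simp add: cstar_dist_def)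
  qed
qed

section \<open>Square-preserving seminorms and a minimal one\<close>

text \<open>Extensionality makes the pointwise order antisymmetric, as Zorn's lemma demands. The
  bound by the norm survives infima and later becomes the norm bound of the character.\<close>

definition uniform_seminorm :: "('a \<Rightarrow> real) \<Rightarrow> bool" where
  "uniform_seminorm p \<longleftrightarrow> p \<in> extensional (carrier A) \<and>
     (\<forall>x\<in>carrier A. 0 \<le> p x \<and> p x \<le> cnorm A x) \<and>
     (\<forall>x\<in>carrier A. \<forall>y\<in>carrier A. p (x \<oplus>\<^bsub>A\<^esub> y) \<le> p x + p y) \<and>
     (\<forall>c. \<forall>x\<in>carrier A. p (c \<odot>\<^bsub>A\<^esub> x) = cmod c * p x) \<and>
     (\<forall>x\<in>carrier A. \<forall>y\<in>carrier A. p (x \<otimes>\<^bsub>A\<^esub> y) \<le> p x * p y) \<and>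
     (\<forall>x\<in>carrier A. p (x \<otimes>\<^bsub>A\<^esub> x) = (p x)\<^sup>2) \<and> p \<one>\<^bsub>A\<^esub> = 1"

lemma uniform_seminormD:
  assumes "uniform_seminorm p"
  shows "p \<in> extensional (carrier A)"
    and "x \<in> carrier A \<Longrightarrow> 0 \<le> p x" "x \<in> carrier A \<Longrightarrow> p x \<le> cnorm A x"
    and "x \<in> carrier A \<Longrightarrow> y \<in> carrier A \<Longrightarrow> p (x \<oplus>\<^bsub>A\<^esub> y) \<le> p x + p y"
    and "x \<in> carrier A \<Longrightarrow> p (c \<odot>\<^bsub>A\<^esub> x) = cmod c * p x"
    and "x \<in> carrier A \<Longrightarrow> y \<in> carrier A \<Longrightarrow> p (x \<otimes>\<^bsub>A\<^esub> y) \<le> p x * p y"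
    and "x \<in> carrier A \<Longrightarrow> p (x \<otimes>\<^bsub>A\<^esub> x) = (p x)\<^sup>2"
    and "p \<one>\<^bsub>A\<^esub> = 1"
  using assms unfolding uniform_seminorm_def by blast+

lemma uniform_seminorm_cnorm: "uniform_seminorm (restrict (cnorm A) (carrier A))"
  unfolding uniform_seminorm_def
  by (auto simp: cnorm_nonneg cnorm_triangle cnorm_smult cnorm_mult cnorm_square)

text \<open>The quotients \<open>p (x b\<^sup>n) / p b\<^sup>n\<close> decrease in \<open>n\<close>; the localised seminorm is their limit.\<close>

lemma uniform_seminorm_localise:
  assumes p: "uniform_seminorm p" and b: "b \<in> carrier A" and pb: "p b \<noteq> 0"
  obtains q where "uniform_seminorm q" "\<forall>x\<in>carrier A. q x \<le> p x"
    "\<forall>x\<in>carrier A. q (x \<otimes>\<^bsub>A\<^esub> b) = p b * q x"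
    "\<forall>a\<in>carrier A. \<forall>c. (\<forall>x\<in>carrier A. p (x \<otimes>\<^bsub>A\<^esub> a) = c * p x) \<longrightarrow> (\<forall>x\<in>carrier A. q (x \<otimes>\<^bsub>A\<^esub> a) = c * q x)"
proof -
  note P = uniform_seminormD[OF p]
  have pb0: "0 < p b" using P(2)[OF b] pb by simp
  define pw where "pw n = b [^]\<^bsub>A\<^esub> n" for n :: nat
  have pw [simp]: "pw n \<in> carrier A" for n using b by (simp add: pw_def)
  have pw_add: "pw (m + n) = pw m \<otimes>\<^bsub>A\<^esub> pw n" for m n using b by (simp add: pw_def nat_pow_mult)
  have pw_0: "pw 0 = \<one>\<^bsub>A\<^esub>" by (simp add: pw_def)
  have pw_1: "pw 1 = b" using b by (simp add: pw_def)
  define s where "s n x = p (x \<otimes>\<^bsub>A\<^esub> pw n) / p b ^ n" for n x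
  have s0: "0 \<le> s n x" if "x \<in> carrier A" for n x
    using P(2) that pb0 by (simp add: s_def)
  have s_Suc: "s (Suc n) x \<le> s n x" if "x \<in> carrier A" for n x
  proof -
    have "x \<otimes>\<^bsub>A\<^esub> pw (Suc n) = (x \<otimes>\<^bsub>A\<^esub> pw n) \<otimes>\<^bsub>A\<^esub> b"
      using that b pw_add[of n 1] pw_1 by (simp add: m_assoc)
    then have "p (x \<otimes>\<^bsub>A\<^esub> pw (Suc n)) \<le> p (x \<otimes>\<^bsub>A\<^esub> pw n) * p b" using P(6) that b by simp
    then show ?thesis using pb0 by (simp add: s_def field_simps)
  qed
  have dec: "decseq (\<lambda>n. s n x)" if "x \<in> carrier A" for x
    using s_Suc[OF that] by (rule decseq_SucI)
  define q where "q = (\<lambda>x\<in>carrier A. lim (\<lambda>n. s n x))"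
  have lim: "(\<lambda>n. s n x) \<longlonglongrightarrow> q x" if x: "x \<in> carrier A" for x
  proof -
    obtain l where "(\<lambda>n. s n x) \<longlonglongrightarrow> l" using decseq_convergent[OF dec[OF x] allI[OF s0[OF x]]] by metis
    then show ?thesis using x limI[of "\<lambda>n. s n x" l] by (simp add: q_def)
  qed
  have qs: "q x \<le> s n x" if "x \<in> carrier A" for n x
    using decseq_ge[OF dec[OF that] lim[OF that]] .
  \<comment> \<open>Along doubled indices the power of \<open>b\<close> splits evenly between the
    two factors of a product, which gives both submultiplicativity and preservation of squares in
    the limit.\<close>
  have lim2: "(\<lambda>n. s (n + n) x) \<longlonglongrightarrow> q x" if "x \<in> carrier A" for x
  proof -
    have "strict_mono (\<lambda>n::nat. n + n)" by (auto simp: strict_mono_def)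
    from LIMSEQ_subseq_LIMSEQ[OF lim[OF that] this] show ?thesis by (simp add: o_def)
  qed
  have q0: "0 \<le> q x" if "x \<in> carrier A" for x
    using s0[OF that] by (intro LIMSEQ_le_const[OF lim[OF that]]) auto
  have qp: "q x \<le> p x" if "x \<in> carrier A" for x
    using qs[OF that, of 0] that by (simp add: s_def pw_0)
  have q_mult: "q (x \<otimes>\<^bsub>A\<^esub> y) \<le> q x * q y" if xy: "x \<in> carrier A" "y \<in> carrier A" for x y
  proof (rule LIMSEQ_le_const[OF tendsto_mult[OF lim[OF xy(1)] lim[OF xy(2)]]])
    have "q (x \<otimes>\<^bsub>A\<^esub> y) \<le> s n x * s n y" for n
    proof -
      have "(x \<otimes>\<^bsub>A\<^esub> y) \<otimes>\<^bsub>A\<^esub> pw (n + n) = (x \<otimes>\<^bsub>A\<^esub> pw n) \<otimes>\<^bsub>A\<^esub> (y \<otimes>\<^bsub>A\<^esub> pw n)"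
        using xy by (simp add: pw_add m_ac)
      then have "p ((x \<otimes>\<^bsub>A\<^esub> y) \<otimes>\<^bsub>A\<^esub> pw (n + n)) \<le> p (x \<otimes>\<^bsub>A\<^esub> pw n) * p (y \<otimes>\<^bsub>A\<^esub> pw n)"
        using P(6) xy by simp
      then have "s (n + n) (x \<otimes>\<^bsub>A\<^esub> y) \<le> s n x * s n y"
        using pb0 by (simp add: s_def power_add divide_right_mono)
      then show ?thesis using qs[of "x \<otimes>\<^bsub>A\<^esub> y" "n + n"] xy by simp
    qed
    then show "\<exists>N. \<forall>n\<ge>N. q (x \<otimes>\<^bsub>A\<^esub> y) \<le> s n x * s n y" by blast
  qed
  have q_sq: "q (x \<otimes>\<^bsub>A\<^esub> x) = (q x)\<^sup>2" if x: "x \<in> carrier A" for x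
  proof -
    have "s (n + n) (x \<otimes>\<^bsub>A\<^esub> x) = (s n x)\<^sup>2" for n
    proof -
      have "(x \<otimes>\<^bsub>A\<^esub> x) \<otimes>\<^bsub>A\<^esub> pw (n + n) = (x \<otimes>\<^bsub>A\<^esub> pw n) \<otimes>\<^bsub>A\<^esub> (x \<otimes>\<^bsub>A\<^esub> pw n)"
        using x by (simp add: pw_add m_ac)
      then show ?thesis using P(7)[of "x \<otimes>\<^bsub>A\<^esub> pw n"] x by (simp add: s_def power_add power2_eq_square)
    qed
    then have "(\<lambda>n. (s n x)\<^sup>2) \<longlonglongrightarrow> q (x \<otimes>\<^bsub>A\<^esub> x)" using lim2[of "x \<otimes>\<^bsub>A\<^esub> x"] x by simp
    moreover have "(\<lambda>n. (s n x)\<^sup>2) \<longlonglongrightarrow> (q x)\<^sup>2" using lim[OF x] by (rule tendsto_power)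
    ultimately show ?thesis by (rule LIMSEQ_unique)
  qed
  have p_pw2: "p (pw (2 ^ k)) = p b ^ (2 ^ k)" for k
  proof (induction k)
    case (Suc k)
    have "pw (2 ^ Suc k) = pw (2 ^ k) \<otimes>\<^bsub>A\<^esub> pw (2 ^ k)" using pw_add[of "2 ^ k" "2 ^ k"] by (simp add: mult_2)
    then show ?case using P(7)[OF pw, of "2 ^ k"] Suc by (simp add: power_mult[symmetric] mult.commute)
  qed (use pw_1 in simp)
  \<comment> \<open>Preservation of squares gives the value 1 only at exponents that are powers of
    2. Monotonicity in \<open>n\<close> carries it to all exponents, because \<open>n\<close> lies
    below \<open>2 ^ n\<close>.\<close>
  have s_one: "s n \<one>\<^bsub>A\<^esub> = 1" for n
  proof (rule antisym)
    have "s n \<one>\<^bsub>A\<^esub> \<le> s 0 \<one>\<^bsub>A\<^esub>" using decseqD[OF dec[of "\<one>\<^bsub>A\<^esub>"], of 0 n] by simp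
    then show "s n \<one>\<^bsub>A\<^esub> \<le> 1" by (simp add: s_def pw_0 P(8))
    have "s (2 ^ n) \<one>\<^bsub>A\<^esub> = 1" using p_pw2[of n] pb0 by (simp add: s_def)
    then show "1 \<le> s n \<one>\<^bsub>A\<^esub>" using decseqD[OF dec[of "\<one>\<^bsub>A\<^esub>"], of n "2 ^ n"] less_exp[of n] by simp
  qed
  have q_scale: "q (c \<odot>\<^bsub>A\<^esub> x) = cmod c * q x" if x: "x \<in> carrier A" for c x
  proof -
    have "s n (c \<odot>\<^bsub>A\<^esub> x) = cmod c * s n x" for n
      using x P(5) by (simp add: s_def scale_mult_left)
    then have "(\<lambda>n. cmod c * s n x) \<longlonglongrightarrow> q (c \<odot>\<^bsub>A\<^esub> x)" using lim[of "c \<odot>\<^bsub>A\<^esub> x"] x by simp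
    then show ?thesis using tendsto_mult_left[OF lim[OF x]] LIMSEQ_unique by blast
  qed
  have q_add: "q (x \<oplus>\<^bsub>A\<^esub> y) \<le> q x + q y" if xy: "x \<in> carrier A" "y \<in> carrier A" for x y
  proof (rule LIMSEQ_le[OF lim tendsto_add[OF lim[OF xy(1)] lim[OF xy(2)]]])
    have "s n (x \<oplus>\<^bsub>A\<^esub> y) \<le> s n x + s n y" for n
      using P(4)[of "x \<otimes>\<^bsub>A\<^esub> pw n" "y \<otimes>\<^bsub>A\<^esub> pw n"] xy pb0
      by (simp add: s_def l_distr add_divide_distrib[symmetric] divide_right_mono)
    then show "\<exists>N. \<forall>n\<ge>N. s n (x \<oplus>\<^bsub>A\<^esub> y) \<le> s n x + s n y" by blast
  qed (use xy in simp)
  have q_one: "q \<one>\<^bsub>A\<^esub> = 1" using lim[of "\<one>\<^bsub>A\<^esub>"] by (simp add: s_one LIMSEQ_const_iff)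
  show ?thesis
  proof (rule that)
    have "q x \<le> cnorm A x" if "x \<in> carrier A" for x using qp[OF that] P(3)[OF that] by simp
    then show "uniform_seminorm q"
      unfolding uniform_seminorm_def
      using q0 q_add q_scale q_mult q_sq q_one by (auto simp: q_def)
    show "\<forall>x\<in>carrier A. q x \<le> p x" using qp by blast
    show "\<forall>x\<in>carrier A. q (x \<otimes>\<^bsub>A\<^esub> b) = p b * q x"
    proof
      fix x assume x: "x \<in> carrier A"
      have "s n (x \<otimes>\<^bsub>A\<^esub> b) = p b * s (Suc n) x" for n
        using x b pw_add[of 1 n] pw_1 pb0 by (simp add: s_def m_assoc)
      then have "(\<lambda>n. p b * s (Suc n) x) \<longlonglongrightarrow> q (x \<otimes>\<^bsub>A\<^esub> b)" using lim[of "x \<otimes>\<^bsub>A\<^esub> b"] x b by simp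
      moreover have "(\<lambda>n. p b * s (Suc n) x) \<longlonglongrightarrow> p b * q x"
        using lim[OF x] by (intro tendsto_mult_left LIMSEQ_Suc)
      ultimately show "q (x \<otimes>\<^bsub>A\<^esub> b) = p b * q x" by (rule LIMSEQ_unique)
    qed
    show "\<forall>a\<in>carrier A. \<forall>c. (\<forall>x\<in>carrier A. p (x \<otimes>\<^bsub>A\<^esub> a) = c * p x) \<longrightarrow> (\<forall>x\<in>carrier A. q (x \<otimes>\<^bsub>A\<^esub> a) = c * q x)"
    proof (intro ballI allI impI)
      fix a c x assume a: "a \<in> carrier A" and pa: "\<forall>x\<in>carrier A. p (x \<otimes>\<^bsub>A\<^esub> a) = c * p x" and x: "x \<in> carrier A"
      have "s n (x \<otimes>\<^bsub>A\<^esub> a) = c * s n x" for n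
        using pa[rule_format, of "x \<otimes>\<^bsub>A\<^esub> pw n"] x a by (simp add: s_def m_ac)
      then have "(\<lambda>n. c * s n x) \<longlonglongrightarrow> q (x \<otimes>\<^bsub>A\<^esub> a)" using lim[of "x \<otimes>\<^bsub>A\<^esub> a"] x a by simp
      then show "q (x \<otimes>\<^bsub>A\<^esub> a) = c * q x" using tendsto_mult_left[OF lim[OF x]] LIMSEQ_unique by blast
    qed
  qed
qed

text \<open>The chain condition supplies one member that is nearly optimal at two given points at
  once. Without it the infimum could fail to be subadditive and submultiplicative.\<close>

lemma uniform_seminorm_INF:
  assumes ne: "C \<noteq> {}" and C: "\<And>p. p \<in> C \<Longrightarrow> uniform_seminorm p"
    and chain: "\<And>p q. p \<in> C \<Longrightarrow> q \<in> C \<Longrightarrow> (\<forall>x\<in>carrier A. p x \<le> q x) \<or> (\<forall>x\<in>carrier A. q x \<le> p x)"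
  defines "u \<equiv> (\<lambda>x\<in>carrier A. INF p\<in>C. p x)"
  shows "uniform_seminorm u" "\<And>p x. p \<in> C \<Longrightarrow> x \<in> carrier A \<Longrightarrow> u x \<le> p x"
    "\<And>a c. \<lbrakk>a \<in> carrier A; 0 \<le> c; \<And>p x. p \<in> C \<Longrightarrow> x \<in> carrier A \<Longrightarrow> p (x \<otimes>\<^bsub>A\<^esub> a) = c * p x\<rbrakk>
       \<Longrightarrow> (\<And>x. x \<in> carrier A \<Longrightarrow> u (x \<otimes>\<^bsub>A\<^esub> a) = c * u x)"
proof -
  note P = uniform_seminormD[OF C]
  have bdd: "bdd_below ((\<lambda>p. p x) ` C)" if "x \<in> carrier A" for x
    using P(2) that by (intro bdd_belowI[of _ 0]) auto
  show up: "u x \<le> p x" if "p \<in> C" "x \<in> carrier A" for p x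
    using that bdd by (auto simp: u_def intro!: cINF_lower)
  have uge: "l \<le> u x" if "x \<in> carrier A" "\<And>p. p \<in> C \<Longrightarrow> l \<le> p x" for l x
    using that ne by (auto simp: u_def intro!: cINF_greatest)
  have u0: "0 \<le> u x" if "x \<in> carrier A" for x using uge P(2) that by auto
  have approx: "\<exists>p\<in>C. p x < u x + e \<and> p y < u y + e" if xy: "x \<in> carrier A" "y \<in> carrier A" and e: "0 < e" for x y e
  proof -
    have one: "\<exists>p\<in>C. p z < u z + e" if "z \<in> carrier A" for z
      using uge[OF that, of "u z + e"] e by force
    obtain p q where pq: "p \<in> C" "p x < u x + e" "q \<in> C" "q y < u y + e" using one xy by blast
    consider "\<forall>x\<in>carrier A. p x \<le> q x" | "\<forall>x\<in>carrier A. q x \<le> p x" using chain pq by blast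
    then show ?thesis
    proof cases
      case 1 then show ?thesis using pq xy by (intro bexI[of _ p]) (auto intro: le_less_trans)
    next
      case 2 then show ?thesis using pq xy by (intro bexI[of _ q]) (auto intro: le_less_trans)
    qed
  qed
  have add: "u (x \<oplus>\<^bsub>A\<^esub> y) \<le> u x + u y" if xy: "x \<in> carrier A" "y \<in> carrier A" for x y
  proof (rule field_le_epsilon)
    fix e :: real assume "0 < e"
    then obtain p where "p \<in> C" "p x < u x + e/2" "p y < u y + e/2" using approx[OF xy, of "e/2"] by auto
    then show "u (x \<oplus>\<^bsub>A\<^esub> y) \<le> u x + u y + e" using up[of p "x \<oplus>\<^bsub>A\<^esub> y"] P(4)[of p x y] xy by simp
  qed
  have mult: "u (x \<otimes>\<^bsub>A\<^esub> y) \<le> u x * u y" if xy: "x \<in> carrier A" "y \<in> carrier A" for x y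
  proof -
    have "u (x \<otimes>\<^bsub>A\<^esub> y) \<le> (u x + e) * (u y + e)" if "0 < e" for e
    proof -
      obtain p where p: "p \<in> C" "p x < u x + e" "p y < u y + e" using approx[OF xy \<open>0 < e\<close>] by auto
      have "p x * p y \<le> (u x + e) * (u y + e)"
        using p P(2)[OF p(1)] u0 xy that by (intro mult_mono) auto
      then show ?thesis using up[OF p(1), of "x \<otimes>\<^bsub>A\<^esub> y"] P(6)[OF p(1), of x y] xy by simp
    qed
    then have "\<forall>\<^sub>F e in at_right 0. u (x \<otimes>\<^bsub>A\<^esub> y) \<le> (u x + e) * (u y + e)"
      by (auto simp: eventually_at_right_less intro: eventually_mono[OF eventually_at_right_less])
    moreover have "((\<lambda>e. (u x + e) * (u y + e)) \<longlongrightarrow> (u x + 0) * (u y + 0)) (at_right 0)"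
      by (intro tendsto_intros)
    ultimately show ?thesis by (intro tendsto_lowerbound) auto
  qed
  have const: "u x = c" if "x \<in> carrier A" "\<And>p. p \<in> C \<Longrightarrow> p x = c" for x c
  proof (rule antisym)
    show "u x \<le> c" using up ne that by (metis ex_in_conv)
    show "c \<le> u x" using that by (intro uge) auto
  qed
  have one: "u \<one>\<^bsub>A\<^esub> = 1" using P(8) by (intro const) auto
  \<comment> \<open>All members agree on scalar multiples of the unit, so submultiplicativity of the
    infimum already yields the upper half of homogeneity.\<close>
  have scale: "u (c \<odot>\<^bsub>A\<^esub> x) = cmod c * u x" if x: "x \<in> carrier A" for c x
  proof (rule antisym)
    have "u (c \<odot>\<^bsub>A\<^esub> \<one>\<^bsub>A\<^esub>) = cmod c"
    proof (rule const)
      show "p (c \<odot>\<^bsub>A\<^esub> \<one>\<^bsub>A\<^esub>) = cmod c" if "p \<in> C" for p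
        using P(5)[OF that, of "\<one>\<^bsub>A\<^esub>" c] P(8)[OF that] by simp
    qed simp
    moreover have "u (c \<odot>\<^bsub>A\<^esub> x) \<le> u (c \<odot>\<^bsub>A\<^esub> \<one>\<^bsub>A\<^esub>) * u x"
      using mult[of "c \<odot>\<^bsub>A\<^esub> \<one>\<^bsub>A\<^esub>" x] x by (simp add: scale_mult_left)
    ultimately show "u (c \<odot>\<^bsub>A\<^esub> x) \<le> cmod c * u x"
      by simp
    show "cmod c * u x \<le> u (c \<odot>\<^bsub>A\<^esub> x)"
    proof (rule uge)
      show "cmod c * u x \<le> p (c \<odot>\<^bsub>A\<^esub> x)" if "p \<in> C" for p
        using mult_left_mono[OF up[OF that x], of "cmod c"] P(5)[OF that x] by simp
    qed (use x in simp)
  qed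
  have sq: "u (x \<otimes>\<^bsub>A\<^esub> x) = (u x)\<^sup>2" if x: "x \<in> carrier A" for x
  proof (rule antisym)
    show "u (x \<otimes>\<^bsub>A\<^esub> x) \<le> (u x)\<^sup>2" using mult[OF x x] by (simp add: power2_eq_square)
    show "(u x)\<^sup>2 \<le> u (x \<otimes>\<^bsub>A\<^esub> x)"
    proof (rule uge)
      show "(u x)\<^sup>2 \<le> p (x \<otimes>\<^bsub>A\<^esub> x)" if "p \<in> C" for p
        using power_mono[OF up[OF that x] u0[OF x], of 2] P(7)[OF that x] by simp
    qed (use x in simp)
  qed
  have le: "u x \<le> cnorm A x" if "x \<in> carrier A" for x
    using ne up P(3) that by (meson ex_in_conv order_trans)
  show "uniform_seminorm u"
    unfolding uniform_seminorm_def using u0 le add scale mult sq one by (auto simp: u_def)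
  show "u (x \<otimes>\<^bsub>A\<^esub> a) = c * u x" if a: "a \<in> carrier A" and c: "0 \<le> c"
    and pa: "\<And>p x. p \<in> C \<Longrightarrow> x \<in> carrier A \<Longrightarrow> p (x \<otimes>\<^bsub>A\<^esub> a) = c * p x" and x: "x \<in> carrier A" for a c x
  proof (rule antisym)
    have "p a = c" if "p \<in> C" for p using pa[OF that, of "\<one>\<^bsub>A\<^esub>"] P(8)[OF that] a by simp
    then have "u a = c" using a by (intro const)
    then show "u (x \<otimes>\<^bsub>A\<^esub> a) \<le> c * u x" using mult[OF x a] by (simp add: mult.commute)
    show "c * u x \<le> u (x \<otimes>\<^bsub>A\<^esub> a)"
    proof (rule uge)
      show "c * u x \<le> p (x \<otimes>\<^bsub>A\<^esub> a)" if "p \<in> C" for p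
        using mult_left_mono[OF up[OF that x] c] pa[OF that x] by simp
    qed (use x a in simp)
  qed
qed

lemma multiplicative_seminorm_exists:
  assumes a: "a \<in> carrier A"
  obtains p where "uniform_seminorm p" "p a = cnorm A a"
    "\<And>x y. x \<in> carrier A \<Longrightarrow> y \<in> carrier A \<Longrightarrow> p (x \<otimes>\<^bsub>A\<^esub> y) = p x * p y"
proof -
  define S where "S = {p. uniform_seminorm p \<and> (\<forall>x\<in>carrier A. p (x \<otimes>\<^bsub>A\<^esub> a) = cnorm A a * p x)}"
  \<comment> \<open>The order is reversed: a maximal element for \<open>le\<close> is a pointwise
    minimal seminorm.\<close>
  define le where "le p q \<longleftrightarrow> (\<forall>x\<in>carrier A. q x \<le> p x)" for p q :: "'a \<Rightarrow> real"
  \<comment> \<open>Localising the norm at \<open>a\<close> gives a member. If \<open>a\<close> is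
    zero, localisation does not apply, but the norm itself satisfies the equation trivially.\<close>
  have "S \<noteq> {}"
  proof (cases "cnorm A a = 0")
    case True
    then have "a = \<zero>\<^bsub>A\<^esub>" using a cnorm_eq_0_iff by blast
    then have "restrict (cnorm A) (carrier A) \<in> S" using uniform_seminorm_cnorm by (simp add: S_def)
    then show ?thesis by blast
  next
    case False
    then obtain q where "uniform_seminorm q" "\<forall>x\<in>carrier A. q (x \<otimes>\<^bsub>A\<^esub> a) = restrict (cnorm A) (carrier A) a * q x"
      using uniform_seminorm_localise[OF uniform_seminorm_cnorm a] a by (metis restrict_apply')
    then have "q \<in> S" using a by (simp add: S_def)
    then show ?thesis by blast
  qed
  have "\<exists>p\<in>S. \<forall>q\<in>S. le p q \<longrightarrow> q = p"
  proof (rule predicate_Zorn)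
    have "p = q" if "p \<in> S" "q \<in> S" "le p q" "le q p" for p q
      using that uniform_seminormD(1)
      by (intro extensionalityI[of _ "carrier A"]) (auto simp: S_def le_def intro: antisym)
    then show "partial_order_on S (relation_of le S)"
      by (intro partial_order_on_relation_ofI) (auto simp: le_def intro: order_trans)
    fix C assume "C \<in> Chains (relation_of le S)"
    then have CS: "C \<subseteq> S" and chain: "\<And>p q. p \<in> C \<Longrightarrow> q \<in> C \<Longrightarrow> le p q \<or> le q p"
      by (auto simp: Chains_def relation_of_def)
    show "\<exists>u\<in>S. \<forall>p\<in>C. le p u"
    proof (cases "C = {}")
      case True
      then show ?thesis using \<open>S \<noteq> {}\<close> by blast
    next
      case False
      let ?u = "\<lambda>x\<in>carrier A. INF p\<in>C. p x"
      have c: "\<And>p. p \<in> C \<Longrightarrow> uniform_seminorm p"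
        "\<And>p q. p \<in> C \<Longrightarrow> q \<in> C \<Longrightarrow> (\<forall>x\<in>carrier A. p x \<le> q x) \<or> (\<forall>x\<in>carrier A. q x \<le> p x)"
        using CS chain by (auto simp: S_def le_def)
      have "?u (x \<otimes>\<^bsub>A\<^esub> a) = cnorm A a * ?u x" if "x \<in> carrier A" for x
      proof (rule uniform_seminorm_INF(3)[OF False _ _ a cnorm_nonneg[OF a] _ that])
        show "p (x \<otimes>\<^bsub>A\<^esub> a) = cnorm A a * p x" if "p \<in> C" "x \<in> carrier A" for p x
          using that CS by (auto simp: S_def)
      qed (fact c)+
      moreover have "uniform_seminorm ?u" by (rule uniform_seminorm_INF(1)[OF False]) (fact c)+
      ultimately have "?u \<in> S" unfolding S_def by blast
      moreover have "le p ?u" if "p \<in> C" for p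
        unfolding le_def using uniform_seminorm_INF(2)[OF False c that] by blast
      ultimately show ?thesis by blast
    qed
  qed
  then obtain p where p: "p \<in> S" "\<And>q. q \<in> S \<Longrightarrow> le p q \<Longrightarrow> q = p" by blast
  have us: "uniform_seminorm p" and pa: "\<And>x. x \<in> carrier A \<Longrightarrow> p (x \<otimes>\<^bsub>A\<^esub> a) = cnorm A a * p x"
    using p(1) by (auto simp: S_def)
  have "p a = cnorm A a" using pa[of "\<one>\<^bsub>A\<^esub>"] uniform_seminormD(8)[OF us] a by simp
  moreover have "p (x \<otimes>\<^bsub>A\<^esub> y) = p x * p y" if x: "x \<in> carrier A" and y: "y \<in> carrier A" for x y
  proof (cases "p y = 0")
    case True
    then show ?thesis
      using uniform_seminormD(6)[OF us x y] uniform_seminormD(2)[OF us, of "x \<otimes>\<^bsub>A\<^esub> y"] x y by simp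
  next
    case False
    obtain q where q: "uniform_seminorm q" "\<forall>x\<in>carrier A. q x \<le> p x"
      "\<forall>x\<in>carrier A. q (x \<otimes>\<^bsub>A\<^esub> y) = p y * q x"
      "\<forall>a\<in>carrier A. \<forall>c. (\<forall>x\<in>carrier A. p (x \<otimes>\<^bsub>A\<^esub> a) = c * p x) \<longrightarrow> (\<forall>x\<in>carrier A. q (x \<otimes>\<^bsub>A\<^esub> a) = c * q x)"
      by (rule uniform_seminorm_localise[OF us y False])
    \<comment> \<open>The seminorm localised at \<open>y\<close> still satisfies the equation for
      \<open>a\<close>, so minimality forces it to equal \<open>p\<close>. Its equation for
      \<open>y\<close> then states that \<open>y\<close> is multiplicative for
      \<open>p\<close>.\<close>
    have "q \<in> S" using q(1) q(4)[rule_format, OF a] pa by (simp add: S_def)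
    then have "q = p" using p(2) q(2) by (simp add: le_def)
    then show ?thesis using q(3) x by (simp add: mult.commute)
  qed
  ultimately show ?thesis using that us by blast
qed

section \<open>Ostrowski's argument: from a multiplicative seminorm to a character\<close>

definition add_scalar :: "'a \<Rightarrow> complex \<Rightarrow> 'a" where
  "add_scalar x c = x \<oplus>\<^bsub>A\<^esub> c \<odot>\<^bsub>A\<^esub> \<one>\<^bsub>A\<^esub>"

lemma add_scalar_closed [simp]: "x \<in> carrier A \<Longrightarrow> add_scalar x c \<in> carrier A"
  by (simp add: add_scalar_def)

lemma add_scalar_shift: "x \<in> carrier A \<Longrightarrow> add_scalar (add_scalar x c) d = add_scalar x (c + d)"
  by (simp add: add_scalar_def scale_add_left M.a_assoc)

lemma add_scalar_zero [simp]: "x \<in> carrier A \<Longrightarrow> add_scalar x 0 = x"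
  by (simp add: add_scalar_def)

lemma add_scalar_mult:
  assumes x: "x \<in> carrier A"
  shows "add_scalar x c \<otimes>\<^bsub>A\<^esub> add_scalar x (- c) = add_scalar (x \<otimes>\<^bsub>A\<^esub> x) (- (c * c))"
proof -
  have "c \<odot>\<^bsub>A\<^esub> x \<oplus>\<^bsub>A\<^esub> (- c) \<odot>\<^bsub>A\<^esub> x = \<zero>\<^bsub>A\<^esub>" using scale_add_left[OF x, of c "- c"] x by simp
  moreover have "add_scalar x c \<otimes>\<^bsub>A\<^esub> add_scalar x (- c) = (x \<otimes>\<^bsub>A\<^esub> x \<oplus>\<^bsub>A\<^esub> (- (c * c)) \<odot>\<^bsub>A\<^esub> \<one>\<^bsub>A\<^esub>) \<oplus>\<^bsub>A\<^esub> (c \<odot>\<^bsub>A\<^esub> x \<oplus>\<^bsub>A\<^esub> (- c) \<odot>\<^bsub>A\<^esub> x)"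
    using x by (simp add: add_scalar_def l_distr r_distr scale_mult_left scale_mult_right scale_add_right scale_scale M.a_ac)
  ultimately show ?thesis using x by (simp add: add_scalar_def)
qed

context
  fixes p
  assumes us: "uniform_seminorm p"
    and p_mult: "\<And>x y. x \<in> carrier A \<Longrightarrow> y \<in> carrier A \<Longrightarrow> p (x \<otimes>\<^bsub>A\<^esub> y) = p x * p y"
begin

lemmas pD = uniform_seminormD[OF us]

lemma p_scalar: "p (c \<odot>\<^bsub>A\<^esub> \<one>\<^bsub>A\<^esub>) = cmod c"
  using pD(5)[of "\<one>\<^bsub>A\<^esub>" c] pD(8) by simp

lemma p_add_scalar_le: "x \<in> carrier A \<Longrightarrow> p (add_scalar x c) \<le> p x + cmod c"
  using pD(4)[of x "c \<odot>\<^bsub>A\<^esub> \<one>\<^bsub>A\<^esub>"] p_scalar by (simp add: add_scalar_def)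

text \<open>A complex square root of \<open>- c\<close> factors \<open>x\<^sup>2 + c\<close> into
  two translates of \<open>x\<close>. This is where the scalars have to be complex.\<close>

lemma p_add_scalar_lower_square:
  assumes x: "x \<in> carrier A" and r: "0 \<le> r" "\<And>c. r \<le> p (add_scalar x c)"
  shows "r\<^sup>2 \<le> p (add_scalar (x \<otimes>\<^bsub>A\<^esub> x) c)"
proof -
  define d where "d = csqrt (- c)"
  have "- (d * d) = c" using power2_csqrt[of "- c"] by (simp add: d_def power2_eq_square)
  then have "p (add_scalar (x \<otimes>\<^bsub>A\<^esub> x) c) = p (add_scalar x d) * p (add_scalar x (- d))"
    using p_mult[of "add_scalar x d" "add_scalar x (- d)"] add_scalar_mult[OF x, of d] x by simp
  moreover have "r * r \<le> p (add_scalar x d) * p (add_scalar x (- d))"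
    using pD(2) x r(1) by (intro mult_mono r(2)) auto
  ultimately show ?thesis by (simp add: power2_eq_square)
qed

text \<open>Factor \<open>x\<^sup>m - \<mu>\<^sup>m\<close>, where \<open>m = 2\<^sup>k\<close>, as \<open>x - \<mu>\<close> times the factors \<open>x\<^sup>j + \<mu>\<^sup>j\<close> for the powers \<open>j < m\<close> of 2;
  the seminorm of such a factor is at least \<open>r\<^sup>j\<close>.\<close>

lemma p_add_scalar_power_bound:
  assumes "x \<in> carrier A" "0 < r" "\<And>c. r \<le> p (add_scalar x c)"
  shows "p (add_scalar x (- \<mu>)) * r ^ (2 ^ k - 1) \<le> p x ^ (2 ^ k) + cmod \<mu> ^ (2 ^ k)"
  using assms
proof (induction k arbitrary: x r \<mu>)
  case 0
  then show ?case using p_add_scalar_le[of x "- \<mu>"] by simp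
next
  case (Suc k)
  note x = Suc.prems(1)
  have r2: "r\<^sup>2 \<le> p (add_scalar (x \<otimes>\<^bsub>A\<^esub> x) c)" for c
    by (rule p_add_scalar_lower_square[OF x _ Suc.prems(3)]) (use Suc.prems(2) in simp)
  \<comment> \<open>The induction hypothesis is applied to the squares of \<open>x\<close>,
    \<open>r\<close> and \<open>\<mu>\<close>, which doubles the exponent of \<open>r\<close>. The
    extra factor \<open>r\<close> bounds the new factor \<open>x + \<mu>\<close> from below.\<close>
  have e: "(2::nat) ^ Suc k - 1 = 2 * (2 ^ k - 1) + 1"
  proof -
    have "1 \<le> (2::nat) ^ k" by simp
    then show ?thesis unfolding power_Suc by linarith
  qed
  have "p (add_scalar x (- \<mu>)) * r \<le> p (add_scalar x \<mu>) * p (add_scalar x (- \<mu>))"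
    using Suc.prems pD(2) by (simp add: mult.commute mult_right_mono)
  also have "\<dots> = p (add_scalar (x \<otimes>\<^bsub>A\<^esub> x) (- \<mu>\<^sup>2))"
    using p_mult[of "add_scalar x \<mu>" "add_scalar x (- \<mu>)"] add_scalar_mult[OF x] x by (simp add: power2_eq_square)
  finally have "p (add_scalar x (- \<mu>)) * r * (r\<^sup>2) ^ (2 ^ k - 1)
      \<le> p (add_scalar (x \<otimes>\<^bsub>A\<^esub> x) (- \<mu>\<^sup>2)) * (r\<^sup>2) ^ (2 ^ k - 1)"
    using Suc.prems(2) by (intro mult_right_mono) auto
  also have "\<dots> \<le> p (x \<otimes>\<^bsub>A\<^esub> x) ^ (2 ^ k) + cmod (\<mu>\<^sup>2) ^ (2 ^ k)"
    using x Suc.prems(2) r2 by (intro Suc.IH) auto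
  finally have "p (add_scalar x (- \<mu>)) * r * (r\<^sup>2) ^ (2 ^ k - 1) \<le> (p x)\<^sup>2 ^ (2 ^ k) + (cmod \<mu>)\<^sup>2 ^ (2 ^ k)"
    by (simp add: pD(7)[OF x] norm_power)
  moreover have "r ^ (2 ^ Suc k - 1) = r * (r\<^sup>2) ^ (2 ^ k - 1)"
    unfolding e by (simp add: power_mult)
  moreover have "t ^ (2 ^ Suc k) = t\<^sup>2 ^ (2 ^ k)" for t :: real
    by (simp add: power_mult)
  ultimately show ?case by (simp only: mult.assoc)
qed

text \<open>Dividing the power bound by \<open>r ^ (2 ^ k - 1)\<close> leaves \<open>r\<close> times
  1 plus a power of \<open>cmod \<mu> / r\<close>, which tends to \<open>r\<close> because that
  ratio is below 1.\<close>

lemma p_add_scalar_constant: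
  assumes x: "x \<in> carrier A" and r: "0 < r" "\<And>c. r \<le> p (add_scalar x c)" "p x = r" and \<mu>: "cmod \<mu> < r"
  shows "p (add_scalar x (- \<mu>)) = r"
proof (rule antisym)
  let ?q = "cmod \<mu> / r"
  have q: "0 \<le> ?q" "?q < 1" using \<mu> r by auto
  have "p (add_scalar x (- \<mu>)) \<le> r * (1 + ?q ^ k)" for k
  proof -
    have e: "r ^ (2 ^ k) = r * r ^ (2 ^ k - 1)"
      by (metis One_nat_def Suc_pred pos2 power_Suc zero_less_power)
    have "p (add_scalar x (- \<mu>)) * r ^ (2 ^ k - 1) \<le> r ^ (2 ^ k) + cmod \<mu> ^ (2 ^ k)"
      using p_add_scalar_power_bound[OF x r(1,2), of \<mu> k] r(3) by simp
    also have "\<dots> = (r * (1 + ?q ^ (2 ^ k))) * r ^ (2 ^ k - 1)"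
      using r(1) by (simp add: e power_divide distrib_left distrib_right)
    finally have "p (add_scalar x (- \<mu>)) \<le> r * (1 + ?q ^ (2 ^ k))" using r(1) by simp
    also have "\<dots> \<le> r * (1 + ?q ^ k)"
      using r(1) q less_exp[of k] by (intro mult_left_mono add_left_mono power_decreasing) auto
    finally show ?thesis .
  qed
  moreover have "(\<lambda>k. r * (1 + ?q ^ k)) \<longlonglongrightarrow> r * (1 + 0)"
    using q by (intro tendsto_intros LIMSEQ_power_zero) auto
  ultimately show "p (add_scalar x (- \<mu>)) \<le> r" by (intro LIMSEQ_le_const) auto
qed (rule r)

text \<open>A nonzero minimum \<open>r\<close> of \<open>p (x + c)\<close> is attained on a whole disc of radius \<open>r\<close>, hence everywhere,
  although \<open>p (x + c)\<close> is unbounded in \<open>c\<close>.\<close>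

lemma p_minimum_zero:
  assumes x: "x \<in> carrier A" and m: "\<And>c. p x \<le> p (add_scalar x c)"
  shows "p x = 0"
proof (rule ccontr)
  assume "p x \<noteq> 0"
  then have r: "0 < p x" using pD(2)[OF x] by simp
  \<comment> \<open>Half the radius keeps each step strictly inside the disc. The translate reached
    is again a minimum of the same value, so steps can be repeated.\<close>
  define \<mu> where "\<mu> = complex_of_real (p x / 2)"
  have \<mu>: "cmod \<mu> < p x" using r by (simp add: \<mu>_def norm_mult)
  have n: "p (add_scalar x (- (of_nat n * \<mu>))) = p x" for n
  proof (induction n)
    case (Suc n)
    let ?y = "add_scalar x (- (of_nat n * \<mu>))"
    have "p (add_scalar ?y (- \<mu>)) = p x"
    proof (rule p_add_scalar_constant[OF _ r _ _ \<mu>])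
      show "?y \<in> carrier A" using x by simp
      show "p x \<le> p (add_scalar ?y c)" for c using m x by (simp add: add_scalar_shift)
    qed (rule Suc)
    then show ?case using x by (simp add: add_scalar_shift algebra_simps)
  qed (use x in simp)
  \<comment> \<open>After \<open>n\<close> steps the scalar has modulus \<open>n * p x / 2\<close>.
    It is also a difference of two elements of seminorm \<open>p x\<close>, so its modulus is at
    most \<open>2 * p x\<close>; this fails beyond 4 steps.\<close>
  obtain n :: nat where n4: "4 < real n" using reals_Archimedean2 by blast
  let ?y = "add_scalar x (- (of_nat n * \<mu>))"
  have "real n * (p x / 2) = p ((- (of_nat n * \<mu>)) \<odot>\<^bsub>A\<^esub> \<one>\<^bsub>A\<^esub>)"
    using r by (simp add: p_scalar norm_mult \<mu>_def)
  also have "(- (of_nat n * \<mu>)) \<odot>\<^bsub>A\<^esub> \<one>\<^bsub>A\<^esub> = ?y \<oplus>\<^bsub>A\<^esub> (-1) \<odot>\<^bsub>A\<^esub> x"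
  proof -
    have "?y \<oplus>\<^bsub>A\<^esub> (-1) \<odot>\<^bsub>A\<^esub> x = (- (of_nat n * \<mu>)) \<odot>\<^bsub>A\<^esub> \<one>\<^bsub>A\<^esub> \<oplus>\<^bsub>A\<^esub> (x \<oplus>\<^bsub>A\<^esub> (-1) \<odot>\<^bsub>A\<^esub> x)"
      using x by (simp add: add_scalar_def M.a_ac del: add_neg_self neg_add_self)
    also have "x \<oplus>\<^bsub>A\<^esub> (-1) \<odot>\<^bsub>A\<^esub> x = \<zero>\<^bsub>A\<^esub>" using x by simp
    finally show ?thesis by simp
  qed
  also have "p \<dots> \<le> p ?y + p ((-1) \<odot>\<^bsub>A\<^esub> x)" using x by (intro pD(4)) auto
  also have "\<dots> = 2 * p x" using n[of n] pD(5)[OF x, of "-1"] by simp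
  finally have "real n * p x \<le> 4 * p x" by simp
  then show False using r n4 by simp
qed

text \<open>The function of the scalar is 1-Lipschitz, and outside the disc of radius
  \<open>2 * p x\<close> it is at least its value at 0. A minimum over this disc is therefore
  global, and a global minimum is zero.\<close>

lemma p_diff_scalar_zero:
  assumes x: "x \<in> carrier A"
  shows "\<exists>c. p (add_scalar x (- c)) = 0"
proof -
  let ?f = "\<lambda>c. p (add_scalar x (- c))"
  have lip: "?f c \<le> ?f d + cmod (c - d)" for c d
    using p_add_scalar_le[of "add_scalar x (- d)" "d - c"] x by (simp add: add_scalar_shift norm_minus_commute)
  have "\<bar>?f c - ?f d\<bar> \<le> 1 * cmod (c - d)" for c d
    using lip[of c d] lip[of d c] by (simp add: norm_minus_commute abs_le_iff)
  then have "continuous_on UNIV ?f"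
    by (intro Lipschitz.lipschitz_on_continuous_on[of 1] lipschitz_onI) (auto simp: dist_norm)
  then have "continuous_on (cball 0 (2 * p x)) ?f" by (rule continuous_on_subset) simp
  then obtain c where c: "c \<in> cball 0 (2 * p x)" "\<And>d. d \<in> cball 0 (2 * p x) \<Longrightarrow> ?f c \<le> ?f d"
    using continuous_attains_inf[of "cball 0 (2 * p x)" ?f] pD(2)[OF x] by auto
  have "?f c \<le> ?f d" for d
  proof (cases "cmod d \<le> 2 * p x")
    case False
    have "d \<odot>\<^bsub>A\<^esub> \<one>\<^bsub>A\<^esub> = x \<oplus>\<^bsub>A\<^esub> (-1) \<odot>\<^bsub>A\<^esub> add_scalar x (- d)"
    proof -
      have "x \<oplus>\<^bsub>A\<^esub> (-1) \<odot>\<^bsub>A\<^esub> add_scalar x (- d) = (x \<oplus>\<^bsub>A\<^esub> (-1) \<odot>\<^bsub>A\<^esub> x) \<oplus>\<^bsub>A\<^esub> d \<odot>\<^bsub>A\<^esub> \<one>\<^bsub>A\<^esub>"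
        using x by (simp add: add_scalar_def scale_add_right scale_scale M.a_ac del: add_neg_self neg_add_self)
      also have "x \<oplus>\<^bsub>A\<^esub> (-1) \<odot>\<^bsub>A\<^esub> x = \<zero>\<^bsub>A\<^esub>" using x by simp
      finally show ?thesis by simp
    qed
    then have "cmod d \<le> p x + ?f d"
      using p_scalar[of d] pD(4)[of x "(-1) \<odot>\<^bsub>A\<^esub> add_scalar x (- d)"] pD(5)[of "add_scalar x (- d)" "-1"] x by simp
    then have "?f 0 \<le> ?f d" using False x by simp
    moreover have "?f c \<le> ?f 0" using c(2)[of 0] pD(2)[OF x] by simp
    ultimately show ?thesis by simp
  qed (use c(2) in auto)
  then have "p (add_scalar x (- c)) = 0"
    using x by (intro p_minimum_zero) (auto simp: add_scalar_shift, metis add.commute diff_add_cancel minus_diff_eq uminus_add_conv_diff minus_minus)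
  then show ?thesis by blast
qed

definition char_of :: "'a \<Rightarrow> complex" where
  "char_of = (\<lambda>x\<in>carrier A. SOME c. p (add_scalar x (- c)) = 0)"

lemma char_of: "x \<in> carrier A \<Longrightarrow> p (add_scalar x (- char_of x)) = 0"
  using someI_ex[OF p_diff_scalar_zero] by (simp add: char_of_def)

text \<open>Two admissible scalars differ by a scalar multiple of the unit of seminorm 0, but
  \<open>p\<close> of such a multiple is the modulus of the scalar. The algebraic laws of
  \<open>char_of\<close> then follow by exhibiting the right scalar.\<close>

lemma char_of_unique:
  assumes x: "x \<in> carrier A" and "p (add_scalar x (- c)) = 0"
  shows "char_of x = c"
proof -
  let ?d = "char_of x"
  have "(?d - c) \<odot>\<^bsub>A\<^esub> \<one>\<^bsub>A\<^esub> = add_scalar x (- c) \<oplus>\<^bsub>A\<^esub> (-1) \<odot>\<^bsub>A\<^esub> add_scalar x (- ?d)"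
  proof -
    have "add_scalar x (- c) \<oplus>\<^bsub>A\<^esub> (-1) \<odot>\<^bsub>A\<^esub> add_scalar x (- ?d) = (x \<oplus>\<^bsub>A\<^esub> (-1) \<odot>\<^bsub>A\<^esub> x) \<oplus>\<^bsub>A\<^esub> ((- c) \<odot>\<^bsub>A\<^esub> \<one>\<^bsub>A\<^esub> \<oplus>\<^bsub>A\<^esub> ?d \<odot>\<^bsub>A\<^esub> \<one>\<^bsub>A\<^esub>)"
      using x by (simp add: add_scalar_def scale_add_right scale_scale M.a_ac del: add_neg_self neg_add_self)
    also have "x \<oplus>\<^bsub>A\<^esub> (-1) \<odot>\<^bsub>A\<^esub> x = \<zero>\<^bsub>A\<^esub>" using x by simp
    finally show ?thesis by (simp flip: scale_add_left add: add.commute)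
  qed
  then have "cmod (?d - c) \<le> 0"
    using p_scalar[of "?d - c"] pD(4)[of "add_scalar x (- c)" "(-1) \<odot>\<^bsub>A\<^esub> add_scalar x (- ?d)"]
      pD(5)[of "add_scalar x (- ?d)" "-1"] char_of[OF x] assms(2) x by simp
  then show ?thesis by simp
qed

lemma p_zeroI: "x \<in> carrier A \<Longrightarrow> p x \<le> 0 \<Longrightarrow> p x = 0"
  using pD(2) by (simp add: antisym)

lemma cmod_char_of:
  assumes x: "x \<in> carrier A"
  shows "cmod (char_of x) = p x"
proof -
  have "add_scalar (add_scalar x (- char_of x)) (char_of x) = x" using x by (simp add: add_scalar_shift)
  then have "p x \<le> cmod (char_of x)"
    using p_add_scalar_le[of "add_scalar x (- char_of x)" "char_of x"] char_of[OF x] x by simp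
  moreover have "char_of x \<odot>\<^bsub>A\<^esub> \<one>\<^bsub>A\<^esub> = x \<oplus>\<^bsub>A\<^esub> (-1) \<odot>\<^bsub>A\<^esub> add_scalar x (- char_of x)"
  proof -
    have "x \<oplus>\<^bsub>A\<^esub> (-1) \<odot>\<^bsub>A\<^esub> add_scalar x (- char_of x) = (x \<oplus>\<^bsub>A\<^esub> (-1) \<odot>\<^bsub>A\<^esub> x) \<oplus>\<^bsub>A\<^esub> char_of x \<odot>\<^bsub>A\<^esub> \<one>\<^bsub>A\<^esub>"
      using x by (simp add: add_scalar_def scale_add_right scale_scale M.a_ac del: add_neg_self neg_add_self)
    also have "x \<oplus>\<^bsub>A\<^esub> (-1) \<odot>\<^bsub>A\<^esub> x = \<zero>\<^bsub>A\<^esub>" using x by simp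
    finally show ?thesis by simp
  qed
  then have "cmod (char_of x) \<le> p x"
    using p_scalar[of "char_of x"] pD(4)[of x "(-1) \<odot>\<^bsub>A\<^esub> add_scalar x (- char_of x)"]
      pD(5)[of "add_scalar x (- char_of x)" "-1"] char_of[OF x] x by simp
  ultimately show ?thesis by simp
qed

lemma char_of_add:
  assumes x: "x \<in> carrier A" and y: "y \<in> carrier A"
  shows "char_of (x \<oplus>\<^bsub>A\<^esub> y) = char_of x + char_of y"
proof (rule char_of_unique)
  have "add_scalar (x \<oplus>\<^bsub>A\<^esub> y) (- (char_of x + char_of y)) = add_scalar x (- char_of x) \<oplus>\<^bsub>A\<^esub> add_scalar y (- char_of y)"
    using x y scale_add_left[of "\<one>\<^bsub>A\<^esub>" "- char_of x" "- char_of y"] by (simp add: add_scalar_def M.a_ac)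
  then show "p (add_scalar (x \<oplus>\<^bsub>A\<^esub> y) (- (char_of x + char_of y))) = 0"
    using pD(4)[of "add_scalar x (- char_of x)" "add_scalar y (- char_of y)"] char_of x y by (intro p_zeroI) auto
qed (use x y in simp)

lemma char_of_scale:
  assumes x: "x \<in> carrier A"
  shows "char_of (c \<odot>\<^bsub>A\<^esub> x) = c * char_of x"
proof (rule char_of_unique)
  have "add_scalar (c \<odot>\<^bsub>A\<^esub> x) (- (c * char_of x)) = c \<odot>\<^bsub>A\<^esub> add_scalar x (- char_of x)"
    using x by (simp add: add_scalar_def scale_add_right scale_scale)
  then show "p (add_scalar (c \<odot>\<^bsub>A\<^esub> x) (- (c * char_of x))) = 0" using pD(5) char_of[OF x] x by simp
qed (use x in simp)

lemma char_of_mult: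
  assumes x: "x \<in> carrier A" and y: "y \<in> carrier A"
  shows "char_of (x \<otimes>\<^bsub>A\<^esub> y) = char_of x * char_of y"
proof (rule char_of_unique)
  let ?x = "add_scalar x (- char_of x)" and ?y = "add_scalar y (- char_of y)"
  have "x \<otimes>\<^bsub>A\<^esub> ?y \<oplus>\<^bsub>A\<^esub> char_of y \<odot>\<^bsub>A\<^esub> ?x
      = x \<otimes>\<^bsub>A\<^esub> y \<oplus>\<^bsub>A\<^esub> (- (char_of x * char_of y)) \<odot>\<^bsub>A\<^esub> \<one>\<^bsub>A\<^esub> \<oplus>\<^bsub>A\<^esub> ((- char_of y) \<odot>\<^bsub>A\<^esub> x \<oplus>\<^bsub>A\<^esub> char_of y \<odot>\<^bsub>A\<^esub> x)"
    using x y by (simp add: add_scalar_def r_distr scale_add_right scale_mult_right scale_scale M.a_ac mult.commute)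
  also have "(- char_of y) \<odot>\<^bsub>A\<^esub> x \<oplus>\<^bsub>A\<^esub> char_of y \<odot>\<^bsub>A\<^esub> x = \<zero>\<^bsub>A\<^esub>"
    using scale_add_left[OF x, of "- char_of y" "char_of y"] x by simp
  finally have "add_scalar (x \<otimes>\<^bsub>A\<^esub> y) (- (char_of x * char_of y)) = x \<otimes>\<^bsub>A\<^esub> ?y \<oplus>\<^bsub>A\<^esub> char_of y \<odot>\<^bsub>A\<^esub> ?x"
    using x y by (simp add: add_scalar_def)
  moreover have "p (x \<otimes>\<^bsub>A\<^esub> ?y \<oplus>\<^bsub>A\<^esub> char_of y \<odot>\<^bsub>A\<^esub> ?x) \<le> p (x \<otimes>\<^bsub>A\<^esub> ?y) + p (char_of y \<odot>\<^bsub>A\<^esub> ?x)"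
    using x y by (intro pD(4)) auto
  ultimately show "p (add_scalar (x \<otimes>\<^bsub>A\<^esub> y) (- (char_of x * char_of y))) = 0"
    using x y char_of p_mult[of x ?y] pD(5)[of ?x "char_of y"] by (intro p_zeroI) auto
qed (use x y in simp)

end

end

section \<open>Characters: norm, existence and compatibility with the adjoint\<close>

context comm_cstar_algebra
begin

lemma charactersD:
  assumes "\<omega> \<in> characters A"
  shows "\<omega> \<in> extensional (carrier A)"
    and "x \<in> carrier A \<Longrightarrow> y \<in> carrier A \<Longrightarrow> \<omega> (x \<oplus>\<^bsub>A\<^esub> y) = \<omega> x + \<omega> y"
    and "x \<in> carrier A \<Longrightarrow> \<omega> (c \<odot>\<^bsub>A\<^esub> x) = c * \<omega> x"
    and "x \<in> carrier A \<Longrightarrow> y \<in> carrier A \<Longrightarrow> \<omega> (x \<otimes>\<^bsub>A\<^esub> y) = \<omega> x * \<omega> y"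
  using assms unfolding characters_def by blast+

lemma character_one:
  assumes "\<omega> \<in> characters A"
  shows "\<omega> \<one>\<^bsub>A\<^esub> = 1"
proof -
  obtain a where a: "a \<in> carrier A" "\<omega> a \<noteq> 0" using assms unfolding characters_def by blast
  have "\<omega> a = \<omega> \<one>\<^bsub>A\<^esub> * \<omega> a" using charactersD(4)[OF assms one_closed_A a(1)] a(1) by simp
  then show ?thesis using a(2) by simp
qed

lemma character_diff:
  assumes "\<omega> \<in> characters A" "x \<in> carrier A" "y \<in> carrier A"
  shows "\<omega> (x \<ominus>\<^bsub>A\<^esub> y) = \<omega> x - \<omega> y"
  using assms by (simp add: diff_eq_scale charactersD(2,3)[OF assms(1)])

lemma cnorm_power_less_one:
  assumes x: "x \<in> carrier A" and "cnorm A x < 1" "0 < (e::real)"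
  shows "\<exists>n. cnorm A (x [^]\<^bsub>A\<^esub> (Suc n :: nat)) < e"
proof -
  have le: "cnorm A (x [^]\<^bsub>A\<^esub> (Suc n :: nat)) \<le> cnorm A x ^ Suc n" for n
  proof (induction n)
    case (Suc n)
    have "cnorm A (x [^]\<^bsub>A\<^esub> Suc (Suc n)) \<le> cnorm A (x [^]\<^bsub>A\<^esub> Suc n) * cnorm A x"
      using x cnorm_mult[of "x [^]\<^bsub>A\<^esub> Suc n" x] by simp
    also have "\<dots> \<le> cnorm A x ^ Suc n * cnorm A x"
      using Suc x by (intro mult_right_mono cnorm_nonneg)
    finally show ?case by (simp add: mult.commute)
  qed (use x in simp)
  have "(\<lambda>n. cnorm A x ^ Suc n) \<longlonglongrightarrow> 0"
    using assms cnorm_nonneg[OF x] by (intro LIMSEQ_Suc LIMSEQ_power_zero) auto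
  then have "\<forall>\<^sub>F n in sequentially. cnorm A x ^ Suc n < e" using assms(3) by (rule order_tendstoD(2))
  then obtain n where "cnorm A x ^ Suc n < e" using eventually_happens'[OF sequentially_bot] by blast
  then show ?thesis using le[of n] by (intro exI[of _ n]) simp
qed

text \<open>If \<open>cmod (\<omega> x) > cnorm A x\<close>, rescale to \<open>\<omega> y = 1\<close> and \<open>cnorm A y < 1\<close>: then \<open>\<omega>\<close> is 1 on powers of \<open>y\<close>
  tending to zero.\<close>

lemma cmod_character_le:
  assumes \<omega>: "\<omega> \<in> characters A" and x: "x \<in> carrier A"
  shows "cmod (\<omega> x) \<le> cnorm A x"
proof (rule ccontr)
  assume "\<not> cmod (\<omega> x) \<le> cnorm A x"
  then have gt: "cnorm A x < cmod (\<omega> x)" by simp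
  then have nz: "\<omega> x \<noteq> 0" using cnorm_nonneg[OF x] by auto
  define y where "y = (1 / \<omega> x) \<odot>\<^bsub>A\<^esub> x"
  have y: "y \<in> carrier A" using x by (simp add: y_def)
  have \<omega>y: "\<omega> y = 1" using x nz by (simp add: y_def charactersD(3)[OF \<omega>])
  have ny: "cnorm A y < 1" using x gt nz by (simp add: y_def cnorm_smult norm_divide divide_simps)
  have "continuous_map cs.mtopology euclidean \<omega>" using \<omega> by (simp add: characters_def)
  moreover have "open (ball (0::complex) 1)" by simp
  moreover have "\<omega> \<zero>\<^bsub>A\<^esub> \<in> ball 0 1"
    using charactersD(3)[OF \<omega> zero_closed_A, of 0] by simp
  ultimately obtain d where d: "0 < d" "\<And>z. z \<in> carrier A \<Longrightarrow> cstar_dist A \<zero>\<^bsub>A\<^esub> z < d \<Longrightarrow> \<omega> z \<in> ball 0 1"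
    unfolding cs.continuous_map_from_metric by (metis open_openin zero_closed_A)
  obtain n where n: "cnorm A (y [^]\<^bsub>A\<^esub> (Suc n :: nat)) < d"
    using cnorm_power_less_one[OF y ny d(1)] by blast
  have one: "\<omega> (y [^]\<^bsub>A\<^esub> (k::nat)) = 1" for k
    by (induction k) (use y in \<open>simp_all add: charactersD(4)[OF \<omega>] \<omega>y character_one[OF \<omega>]\<close>)
  have "cstar_dist A \<zero>\<^bsub>A\<^esub> (y [^]\<^bsub>A\<^esub> (Suc n :: nat)) < d"
  proof -
    have "cstar_dist A \<zero>\<^bsub>A\<^esub> z = cnorm A z" if "z \<in> carrier A" for z
      using that cs.commute[of "\<zero>\<^bsub>A\<^esub>" z] by (simp add: cstar_dist_def diff_eq_scale)
    then show ?thesis using n nat_pow_closed[OF y, of "Suc n"] by metis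
  qed
  from d(2)[OF nat_pow_closed[OF y] this] show False unfolding one by simp
qed

text \<open>Continuity is traded for a norm bound, and being nonzero for the value 1 at the unit.
  These are conditions that pass to pointwise limits, as compactness of the spectrum
  requires.\<close>

lemma charactersI:
  assumes "\<omega> \<in> extensional (carrier A)"
    and add: "\<And>x y. x \<in> carrier A \<Longrightarrow> y \<in> carrier A \<Longrightarrow> \<omega> (x \<oplus>\<^bsub>A\<^esub> y) = \<omega> x + \<omega> y"
    and scale: "\<And>c x. x \<in> carrier A \<Longrightarrow> \<omega> (c \<odot>\<^bsub>A\<^esub> x) = c * \<omega> x"
    and "\<And>x y. x \<in> carrier A \<Longrightarrow> y \<in> carrier A \<Longrightarrow> \<omega> (x \<otimes>\<^bsub>A\<^esub> y) = \<omega> x * \<omega> y"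
    and one: "\<omega> \<one>\<^bsub>A\<^esub> = 1"
    and le: "\<And>x. x \<in> carrier A \<Longrightarrow> cmod (\<omega> x) \<le> cnorm A x"
  shows "\<omega> \<in> characters A"
proof -
  have "continuous_map cs.mtopology euclidean \<omega>"
    unfolding cs.continuous_map_from_metric
  proof (intro conjI ballI allI impI)
    fix a U assume a: "a \<in> carrier A" and "openin euclidean U \<and> \<omega> a \<in> U"
    then have "open U" "\<omega> a \<in> U" by auto
    then obtain e where e: "0 < e" "ball (\<omega> a) e \<subseteq> U" by (rule openE)
    have "\<omega> x \<in> U" if x: "x \<in> carrier A" "cstar_dist A a x < e" for x
    proof -
      have "dist (\<omega> a) (\<omega> x) = cmod (\<omega> (a \<ominus>\<^bsub>A\<^esub> x))"
        using a x by (simp add: diff_eq_scale add scale dist_norm)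
      also have "\<dots> \<le> cstar_dist A a x" using le[of "a \<ominus>\<^bsub>A\<^esub> x"] a x by (simp add: cstar_dist_def diff_eq_scale)
      finally show ?thesis using e x by auto
    qed
    then show "\<exists>r>0. \<forall>x. x \<in> carrier A \<and> cstar_dist A a x < r \<longrightarrow> \<omega> x \<in> U" using e(1) by blast
  qed auto
  then show ?thesis using assms unfolding characters_def by (auto intro!: bexI[of _ "\<one>\<^bsub>A\<^esub>"])
qed

lemma character_norming:
  assumes a: "a \<in> carrier A"
  obtains \<omega> where "\<omega> \<in> characters A" "cmod (\<omega> a) = cnorm A a"
proof -
  obtain p where p: "uniform_seminorm p" "p a = cnorm A a"
    "\<And>x y. x \<in> carrier A \<Longrightarrow> y \<in> carrier A \<Longrightarrow> p (x \<otimes>\<^bsub>A\<^esub> y) = p x * p y"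
    using multiplicative_seminorm_exists[OF a] by metis
  have "char_of p \<in> characters A"
  proof (rule charactersI)
    show "char_of p \<in> extensional (carrier A)" by (simp add: char_of_def[OF p(1,3)])
    show "char_of p (x \<oplus>\<^bsub>A\<^esub> y) = char_of p x + char_of p y" "char_of p (x \<otimes>\<^bsub>A\<^esub> y) = char_of p x * char_of p y"
      if "x \<in> carrier A" "y \<in> carrier A" for x y
      using char_of_add[OF p(1,3) that] char_of_mult[OF p(1,3) that] by simp_all
    show "char_of p (c \<odot>\<^bsub>A\<^esub> x) = c * char_of p x" if "x \<in> carrier A" for c x
      using char_of_scale[OF p(1,3) that] by simp
    show "cmod (char_of p x) \<le> cnorm A x" if "x \<in> carrier A" for x
      using cmod_char_of[OF p(1,3) that] uniform_seminormD(3)[OF p(1) that] by simp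
    have "p (add_scalar \<one>\<^bsub>A\<^esub> (- 1)) = 0" using p(1) uniform_seminormD(5)[OF p(1), of "\<one>\<^bsub>A\<^esub>" 0] by (simp add: add_scalar_def)
    then show "char_of p \<one>\<^bsub>A\<^esub> = 1" by (intro char_of_unique[OF p(1,3)]) auto
  qed
  moreover have "cmod (char_of p a) = cnorm A a" using cmod_char_of[OF p(1,3) a] p(2) by simp
  ultimately show ?thesis using that by blast
qed

text \<open>Arens' trick: compare \<open>\<omega> (a + i t)\<close> with the norm for large real \<open>t\<close>.\<close>

lemma character_self_adjoint:
  assumes \<omega>: "\<omega> \<in> characters A" and a: "a \<in> carrier A" and sa: "adj A a = a"
  shows "Im (\<omega> a) = 0"
proof (rule ccontr)
  assume nz: "Im (\<omega> a) \<noteq> 0"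
  let ?\<beta> = "Im (\<omega> a)"
  have "?\<beta>\<^sup>2 + 2 * ?\<beta> * t \<le> (cnorm A a)\<^sup>2" for t :: real
  proof -
    let ?x = "add_scalar a (\<i> * t)"
    have adjx: "adj A ?x = add_scalar a (- (\<i> * t))"
      using a sa by (simp add: add_scalar_def adj_add adj_smult)
    have "(cmod (\<omega> ?x))\<^sup>2 \<le> (cnorm A ?x)\<^sup>2" using cmod_character_le[OF \<omega>, of ?x] a by (simp add: power_mono)
    also have "\<dots> = cnorm A (adj A ?x \<otimes>\<^bsub>A\<^esub> ?x)" using cstar_identity[of ?x] a by simp
    also have "adj A ?x \<otimes>\<^bsub>A\<^esub> ?x = add_scalar (a \<otimes>\<^bsub>A\<^esub> a) (complex_of_real (t\<^sup>2))"
      unfolding adjx using add_scalar_mult[OF a, of "\<i> * t"] a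
      by (simp add: m_comm[of "add_scalar a (- (\<i> * t))"] power2_eq_square mult_ac)
    also have "cnorm A \<dots> \<le> cnorm A (a \<otimes>\<^bsub>A\<^esub> a) + cnorm A (complex_of_real (t\<^sup>2) \<odot>\<^bsub>A\<^esub> \<one>\<^bsub>A\<^esub>)"
      unfolding add_scalar_def using a by (intro cnorm_triangle) auto
    also have "\<dots> = (cnorm A a)\<^sup>2 + t\<^sup>2" using cnorm_square[OF a] by (simp add: cnorm_smult norm_power)
    also have "\<omega> ?x = \<omega> a + \<i> * t"
      using a by (simp add: add_scalar_def charactersD(2,3)[OF \<omega>] character_one[OF \<omega>])
    also have "(cmod (\<omega> a + \<i> * t))\<^sup>2 = (Re (\<omega> a))\<^sup>2 + (?\<beta> + t)\<^sup>2" by (simp add: cmod_power2)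
    finally have "(Re (\<omega> a))\<^sup>2 + (?\<beta> + t)\<^sup>2 \<le> (cnorm A a)\<^sup>2 + t\<^sup>2" .
    moreover have "0 \<le> (Re (\<omega> a))\<^sup>2" by simp
    moreover have "(?\<beta> + t)\<^sup>2 = ?\<beta>\<^sup>2 + 2 * ?\<beta> * t + t\<^sup>2" by (simp add: power2_sum)
    ultimately show ?thesis by linarith
  qed
  \<comment> \<open>This \<open>t\<close> turns the term linear in \<open>t\<close> into the squared
    norm plus 1.\<close>
  from this[of "((cnorm A a)\<^sup>2 + 1) / (2 * ?\<beta>)"] have "?\<beta>\<^sup>2 + ((cnorm A a)\<^sup>2 + 1) \<le> (cnorm A a)\<^sup>2"
    using nz by simp
  then show False using zero_le_power2[of ?\<beta>] by linarith
qed

lemma cartesian_decomposition: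
  assumes a: "a \<in> carrier A"
  obtains b c where "b \<in> carrier A" "c \<in> carrier A" "adj A b = b" "adj A c = c" "a = b \<oplus>\<^bsub>A\<^esub> \<i> \<odot>\<^bsub>A\<^esub> c"
proof -
  let ?b = "(1/2) \<odot>\<^bsub>A\<^esub> (a \<oplus>\<^bsub>A\<^esub> adj A a)" and ?c = "(- \<i> / 2) \<odot>\<^bsub>A\<^esub> (a \<oplus>\<^bsub>A\<^esub> (-1) \<odot>\<^bsub>A\<^esub> adj A a)"
  note a' = adj_closed[OF a]
  have "?b \<in> carrier A" "?c \<in> carrier A" using a a' by auto
  moreover have "adj A ?b = ?b" using a a' by (simp add: adj_smult adj_add adj_adj M.a_comm)
  moreover have "adj A ?c = ?c"
    using a a' by (simp add: adj_smult adj_add adj_adj scale_add_right scale_scale M.a_comm)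
  moreover have "a = ?b \<oplus>\<^bsub>A\<^esub> \<i> \<odot>\<^bsub>A\<^esub> ?c"
  proof -
    have "?b \<oplus>\<^bsub>A\<^esub> \<i> \<odot>\<^bsub>A\<^esub> ?c = ((1/2) \<odot>\<^bsub>A\<^esub> a \<oplus>\<^bsub>A\<^esub> (1/2) \<odot>\<^bsub>A\<^esub> a) \<oplus>\<^bsub>A\<^esub> ((1/2) \<odot>\<^bsub>A\<^esub> adj A a \<oplus>\<^bsub>A\<^esub> (- 1/2) \<odot>\<^bsub>A\<^esub> adj A a)"
      using a a' by (simp add: scale_add_right scale_scale M.a_ac)
    also have "(1/2) \<odot>\<^bsub>A\<^esub> a \<oplus>\<^bsub>A\<^esub> (1/2) \<odot>\<^bsub>A\<^esub> a = a" using scale_add_left[OF a, of "1/2" "1/2"] a by simp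
    also have "(1/2) \<odot>\<^bsub>A\<^esub> adj A a \<oplus>\<^bsub>A\<^esub> (- 1/2) \<odot>\<^bsub>A\<^esub> adj A a = \<zero>\<^bsub>A\<^esub>"
      using scale_add_left[OF a', of "1/2" "- 1/2"] a' by simp
    finally show ?thesis using a by simp
  qed
  ultimately show ?thesis using that by blast
qed

lemma character_adj:
  assumes \<omega>: "\<omega> \<in> characters A" and a: "a \<in> carrier A"
  shows "\<omega> (adj A a) = cnj (\<omega> a)"
proof -
  obtain b c where bc: "b \<in> carrier A" "c \<in> carrier A" "adj A b = b" "adj A c = c" "a = b \<oplus>\<^bsub>A\<^esub> \<i> \<odot>\<^bsub>A\<^esub> c"
    using cartesian_decomposition[OF a] by blast
  have "adj A a = b \<oplus>\<^bsub>A\<^esub> (- \<i>) \<odot>\<^bsub>A\<^esub> c" using bc by (simp add: adj_add adj_smult)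
  then have "\<omega> (adj A a) = \<omega> b - \<i> * \<omega> c" using bc by (simp add: charactersD(2,3)[OF \<omega>])
  moreover have "\<omega> a = \<omega> b + \<i> * \<omega> c" using bc by (simp add: charactersD(2,3)[OF \<omega>])
  moreover have "Im (\<omega> b) = 0" "Im (\<omega> c) = 0"
    using character_self_adjoint[OF \<omega>] bc by auto
  ultimately show ?thesis by (simp add: complex_eq_iff)
qed

lemma characters_separate:
  assumes "x \<in> carrier A" "y \<in> carrier A" "\<And>\<omega>. \<omega> \<in> characters A \<Longrightarrow> \<omega> x = \<omega> y"
  shows "x = y"
proof -
  obtain \<omega> where \<omega>: "\<omega> \<in> characters A" "cmod (\<omega> (x \<ominus>\<^bsub>A\<^esub> y)) = cnorm A (x \<ominus>\<^bsub>A\<^esub> y)"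
    using character_norming[of "x \<ominus>\<^bsub>A\<^esub> y"] assms by (auto simp: diff_eq_scale)
  then have "cstar_dist A x y = 0"
    using character_diff[OF \<omega>(1) assms(1,2)] assms(1,2) assms(3)[OF \<omega>(1)] by (simp add: cstar_dist_def)
  then show ?thesis using assms by simp
qed

end

section \<open>The spectrum is compact Hausdorff\<close>

lemma open_vimage_eval: "open W \<Longrightarrow> open ((\<lambda>h :: 'a \<Rightarrow> 'b::topological_space. h a) -` W)"
  by (rule open_vimage[OF _ continuous_on_product_coordinates])

text \<open>The \<open>t0_space\<close> and \<open>t1_space\<close> instances are there because the arity of \<open>t2_space\<close> has to be compatible
  with the library's metric on functions of countable domain.\<close>

instance "fun" :: (type, t0_space) t0_space
proof
  fix f g :: "'a \<Rightarrow> 'b" assume "f \<noteq> g"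
  then obtain a where "f a \<noteq> g a" by auto
  then obtain U where U: "open U \<and> \<not> (f a \<in> U \<longleftrightarrow> g a \<in> U)" by (rule exE[OF t0_space_class.t0_space])
  show "\<exists>U. open U \<and> \<not> (f \<in> U \<longleftrightarrow> g \<in> U)"
  proof (intro exI conjI)
    show "open ((\<lambda>h. h a) -` U)" using U by (intro open_vimage_eval) simp
    show "\<not> (f \<in> (\<lambda>h. h a) -` U \<longleftrightarrow> g \<in> (\<lambda>h. h a) -` U)" using U by simp
  qed
qed

instance "fun" :: (type, t1_space) t1_space
proof
  fix f g :: "'a \<Rightarrow> 'b" assume "f \<noteq> g"
  then obtain a where "f a \<noteq> g a" by auto
  then obtain U where U: "open U" "f a \<in> U" "g a \<notin> U" using t1_space by blast
  then show "\<exists>U. open U \<and> f \<in> U \<and> g \<notin> U"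
    by (intro exI[of _ "(\<lambda>h. h a) -` U"] conjI open_vimage_eval) simp_all
qed

text \<open>The Stone--Weierstrass locale \<open>function_ring_on\<close> works with a compact set
  in a \<open>t2_space\<close> type, and characters are elements of a function type.\<close>

instance "fun" :: (type, t2_space) t2_space
proof
  fix f g :: "'a \<Rightarrow> 'b" assume "f \<noteq> g"
  then obtain a where ne: "f a \<noteq> g a" by auto
  obtain U V where UV: "open U" "open V" "f a \<in> U" "g a \<in> V" "U \<inter> V = {}"
    using hausdorff[OF ne] by blast
  show "\<exists>U V. open U \<and> open V \<and> f \<in> U \<and> g \<in> V \<and> U \<inter> V = {}"
  proof (intro exI conjI)
    show "open ((\<lambda>h. h a) -` U)" "open ((\<lambda>h. h a) -` V)" using UV(1,2) by (simp_all add: open_vimage_eval)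
    show "((\<lambda>h. h a) -` U) \<inter> ((\<lambda>h. h a) -` V) = {}" using UV(5) by blast
  qed (use UV in simp_all)
qed

text \<open>Coordinates outside \<open>I\<close> are constant on extensional functions, so they add
  no open sets. The weak* topology can thus be handled as a subspace of the function type with its
  type-class topology.\<close>

lemma subtopology_product_eq_euclidean:
  fixes S :: "('i \<Rightarrow> 'b::topological_space) set"
  assumes S: "S \<subseteq> extensional I"
  shows "subtopology (product_topology (\<lambda>_. euclidean) I) S = top_of_set S" (is "?T = ?E")
proof -
  have ts: "topspace ?T = S" using S by (auto simp: PiE_def)
  have 1: "continuous_map ?T ?E id"
  proof -
    have "continuous_map ?T (product_topology (\<lambda>_. euclidean) UNIV) id"
      unfolding continuous_map_componentwise_UNIV
    proof
      fix i
      show "continuous_map ?T euclidean (\<lambda>x. id x i)"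
      proof (cases "i \<in> I")
        case True
        then show ?thesis
          by (auto intro!: continuous_map_from_subtopology continuous_map_product_projection)
      next
        case False
        have "continuous_map ?T euclidean (\<lambda>x. undefined :: 'b)" by simp
        then show ?thesis
          by (rule continuous_map_eq) (use False S ts in \<open>auto simp: extensional_def\<close>)
      qed
    qed
    then show ?thesis by (simp add: euclidean_product_topology continuous_map_in_subtopology ts)
  qed
  have 2: "continuous_map ?E ?T id"
    unfolding continuous_map_in_subtopology continuous_map_componentwise using S
    by (auto intro: continuous_on_subset[OF continuous_on_product_coordinates])
  show ?thesis
    unfolding topology_eq
  proof (intro allI iffI)
    fix U assume U: "openin ?T U"
    then have "U = {x \<in> topspace ?E. id x \<in> U}" using openin_subset ts by fastforce
    then show "openin ?E U" using openin_continuous_map_preimage[OF 2 U] by simp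
  next
    fix U assume U: "openin ?E U"
    then have "U = {x \<in> topspace ?T. id x \<in> U}" using openin_subset ts by fastforce
    then show "openin ?T U" using openin_continuous_map_preimage[OF 1 U] by simp
  qed
qed

lemma spec_obj_eq: "spec_obj A = top_of_set (characters A)"
  unfolding spec_obj_def by (rule subtopology_product_eq_euclidean) (auto simp: characters_def)

lemma topspace_spec_obj [simp]: "topspace (spec_obj A) = characters A"
  by (simp add: spec_obj_eq)

lemma continuous_map_eval: "continuous_map (spec_obj A) euclidean (\<lambda>\<omega>. \<omega> a)"
  unfolding spec_obj_eq by (auto intro: continuous_on_subset[OF continuous_on_product_coordinates])

lemma continuous_map_into_spec_obj:
  assumes "f \<in> topspace X \<rightarrow> characters A"
    and "\<And>a. a \<in> carrier A \<Longrightarrow> continuous_map X euclidean (\<lambda>x. f x a)"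
  shows "continuous_map X (spec_obj A) f"
  unfolding spec_obj_def continuous_map_in_subtopology continuous_map_componentwise
  using assms by (auto simp: characters_def)

context comm_cstar_algebra
begin

text \<open>The Banach--Alaoglu argument: by Tychonoff's theorem a product of discs is compact, and
  the algebraic conditions cut out a closed subset, which \<open>charactersI\<close> identifies with
  the characters.\<close>

lemma compact_characters: "compact (characters A)"
proof -
  \<comment> \<open>The singleton off the carrier encodes extensionality and is compact like the
    discs.\<close>
  let ?B = "\<lambda>a. if a \<in> carrier A then cball (0::complex) (cnorm A a) else {undefined}"
  let ?P = "PiE UNIV ?B"
  have "compactin (product_topology (\<lambda>_. euclidean) UNIV) ?P"
    by (simp add: compactin_PiE)
  then have P: "compact ?P" by (simp add: euclidean_product_topology)
  have c: "continuous_on UNIV (\<lambda>\<omega>::'a \<Rightarrow> complex. \<omega> a)" for a by (rule continuous_on_product_coordinates)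
  let ?Q = "(\<Inter>x\<in>carrier A. \<Inter>y\<in>carrier A. {\<omega>. \<omega> (x \<oplus>\<^bsub>A\<^esub> y) = \<omega> x + \<omega> y}) \<inter>
    (\<Inter>c. \<Inter>x\<in>carrier A. {\<omega>. \<omega> (c \<odot>\<^bsub>A\<^esub> x) = c * \<omega> x}) \<inter>
    (\<Inter>x\<in>carrier A. \<Inter>y\<in>carrier A. {\<omega>. \<omega> (x \<otimes>\<^bsub>A\<^esub> y) = \<omega> x * \<omega> y}) \<inter> {\<omega>::'a \<Rightarrow> complex. \<omega> \<one>\<^bsub>A\<^esub> = 1}"
  have "closed ?Q"
    by (intro closed_Int closed_INT ballI closed_Collect_eq continuous_intros c)
  then have "compact (?P \<inter> ?Q)" using P by (intro compact_Int_closed)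
  moreover have "?P \<inter> ?Q = characters A"
  proof (intro equalityI subsetI)
    fix \<omega> assume \<omega>: "\<omega> \<in> ?P \<inter> ?Q"
    then have "\<omega> a \<in> ?B a" for a by (auto simp: PiE_def Pi_def)
    then have "\<omega> \<in> extensional (carrier A)" "\<And>x. x \<in> carrier A \<Longrightarrow> cmod (\<omega> x) \<le> cnorm A x"
      by (auto simp: extensional_def) (metis mem_cball_0 singletonD)+
    then show "\<omega> \<in> characters A" using \<omega> by (intro charactersI) auto
  next
    fix \<omega> assume \<omega>: "\<omega> \<in> characters A"
    then show "\<omega> \<in> ?P \<inter> ?Q"
      using charactersD[OF \<omega>] character_one[OF \<omega>] cmod_character_le[OF \<omega>] by (auto simp: extensional_def)
  qed
  ultimately show ?thesis by simp
qed

lemma characters_nonempty: "characters A \<noteq> {}"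
  using character_norming[of "\<one>\<^bsub>A\<^esub>"] by auto

lemma chaus_spec_obj: "chaus (spec_obj A)"
proof -
  have "Hausdorff_space (spec_obj A)"
    unfolding spec_obj_def
    by (intro Hausdorff_space_subtopology) (simp add: Hausdorff_space_product_topology)
  then show ?thesis
    using compact_characters characters_nonempty
    by (simp add: chaus_def spec_obj_eq compact_space_subtopology)
qed

section \<open>Gelfand duality\<close>

lemma Gelfand_real_surj:
  assumes f: "continuous_map (spec_obj A) euclideanreal f"
  obtains a where "a \<in> carrier A" "adj A a = a" "\<And>\<omega>. \<omega> \<in> characters A \<Longrightarrow> \<omega> a = of_real (f \<omega>)"
proof -
  let ?S = "characters A"
  \<comment> \<open>Self-adjoint elements have real evaluations, and by commutativity their products
    are self-adjoint again, so these evaluations form a real algebra.\<close>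
  define R where "R = {g. continuous_on ?S g \<and>
     (\<exists>a\<in>carrier A. adj A a = a \<and> (\<forall>\<omega>\<in>?S. \<omega> a = complex_of_real (g \<omega>)))}"
  have fc: "continuous_on ?S f" using f by (simp add: spec_obj_eq)
  interpret function_ring_on R ?S
  proof
    show "compact ?S" by (rule compact_characters)
    show "continuous_on ?S g" if "g \<in> R" for g using that by (simp add: R_def)
    show "(\<lambda>x. g x + h x) \<in> R" if gh: "g \<in> R" "h \<in> R" for g h
    proof -
      obtain a b where ab: "a \<in> carrier A" "adj A a = a" "\<forall>\<omega>\<in>?S. \<omega> a = complex_of_real (g \<omega>)"
        "b \<in> carrier A" "adj A b = b" "\<forall>\<omega>\<in>?S. \<omega> b = complex_of_real (h \<omega>)"
        using gh unfolding R_def by blast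
      have "\<exists>a\<in>carrier A. adj A a = a \<and> (\<forall>\<omega>\<in>?S. \<omega> a = complex_of_real (g \<omega> + h \<omega>))"
        using ab by (intro bexI[of _ "a \<oplus>\<^bsub>A\<^esub> b"]) (auto simp: adj_add charactersD(2))
      then show ?thesis using gh by (simp add: R_def continuous_on_add)
    qed
    show "(\<lambda>x. g x * h x) \<in> R" if gh: "g \<in> R" "h \<in> R" for g h
    proof -
      obtain a b where ab: "a \<in> carrier A" "adj A a = a" "\<forall>\<omega>\<in>?S. \<omega> a = complex_of_real (g \<omega>)"
        "b \<in> carrier A" "adj A b = b" "\<forall>\<omega>\<in>?S. \<omega> b = complex_of_real (h \<omega>)"
        using gh unfolding R_def by blast
      have "\<exists>a\<in>carrier A. adj A a = a \<and> (\<forall>\<omega>\<in>?S. \<omega> a = complex_of_real (g \<omega> * h \<omega>))"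
        using ab by (intro bexI[of _ "a \<otimes>\<^bsub>A\<^esub> b"]) (auto simp: adj_mult charactersD(4) m_comm)
      then show ?thesis using gh by (simp add: R_def continuous_on_mult)
    qed
    show "(\<lambda>_. c) \<in> R" for c
    proof -
      have "\<exists>a\<in>carrier A. adj A a = a \<and> (\<forall>\<omega>\<in>?S. \<omega> a = complex_of_real c)"
        by (intro bexI[of _ "of_real c \<odot>\<^bsub>A\<^esub> \<one>\<^bsub>A\<^esub>"]) (auto simp: adj_smult charactersD(3) character_one)
      then show ?thesis by (simp add: R_def)
    qed
    show "\<exists>g\<in>R. g \<omega> \<noteq> g \<psi>" if \<omega>\<psi>: "\<omega> \<in> ?S" "\<psi> \<in> ?S" "\<omega> \<noteq> \<psi>" for \<omega> \<psi>
    proof -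
      \<comment> \<open>Characters that differ at an element differ at one of its two self-adjoint
        parts.\<close>
      have "\<exists>a\<in>carrier A. adj A a = a \<and> \<omega> a \<noteq> \<psi> a"
      proof (rule ccontr)
        assume no: "\<not> (\<exists>a\<in>carrier A. adj A a = a \<and> \<omega> a \<noteq> \<psi> a)"
        have "\<omega> a = \<psi> a" if a: "a \<in> carrier A" for a
        proof -
          obtain b c where "b \<in> carrier A" "c \<in> carrier A" "adj A b = b" "adj A c = c" "a = b \<oplus>\<^bsub>A\<^esub> \<i> \<odot>\<^bsub>A\<^esub> c"
            using cartesian_decomposition[OF a] by blast
          then show ?thesis
            using no by (simp add: charactersD(2,3)[OF \<omega>\<psi>(1)] charactersD(2,3)[OF \<omega>\<psi>(2)])
        qed
        then have "\<omega> = \<psi>" by (rule extensionalityI[OF charactersD(1)[OF \<omega>\<psi>(1)] charactersD(1)[OF \<omega>\<psi>(2)]])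
        then show False using \<omega>\<psi> by simp
      qed
      then obtain a where a: "a \<in> carrier A" "adj A a = a" "\<omega> a \<noteq> \<psi> a" by blast
      have im: "\<theta> a = of_real (Re (\<theta> a))" if "\<theta> \<in> ?S" for \<theta>
        using character_self_adjoint[OF that a(1,2)] by (simp add: complex_eq_iff)
      have R: "(\<lambda>\<omega>. Re (\<omega> a)) \<in> R"
        unfolding R_def using a im
        by (auto intro!: continuous_intros bexI[of _ a] continuous_on_subset[OF continuous_on_product_coordinates])
      have "Re (\<omega> a) \<noteq> Re (\<psi> a)" using im[OF \<omega>\<psi>(1)] im[OF \<omega>\<psi>(2)] a(3) by metis
      then show ?thesis by (intro bexI[OF _ R])
    qed
  qed
  have "\<exists>a\<in>carrier A. adj A a = a \<and> (\<forall>\<omega>\<in>?S. cmod (\<omega> a - of_real (f \<omega>)) < inverse (real (Suc n)))" for n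
  proof -
    obtain g where g: "g \<in> R" "\<forall>\<omega>\<in>?S. \<bar>f \<omega> - g \<omega>\<bar> < inverse (real (Suc n))"
      using Stone_Weierstrass_basic[OF fc, of "inverse (real (Suc n))"] by auto
    obtain a where a: "a \<in> carrier A" "adj A a = a" "\<forall>\<omega>\<in>?S. \<omega> a = complex_of_real (g \<omega>)"
      using g(1) unfolding R_def by blast
    have "cmod (\<omega> a - of_real (f \<omega>)) < inverse (real (Suc n))" if "\<omega> \<in> ?S" for \<omega>
    proof -
      have "\<omega> a - of_real (f \<omega>) = of_real (g \<omega> - f \<omega>)" using a(3) that by simp
      then have "cmod (\<omega> a - of_real (f \<omega>)) = \<bar>f \<omega> - g \<omega>\<bar>" by (metis norm_of_real abs_minus_commute)
      then show ?thesis using g(2) that by simp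
    qed
    then show ?thesis using a by blast
  qed
  then obtain s where s: "\<And>n. s n \<in> carrier A" "\<And>n. adj A (s n) = s n"
    "\<And>n \<omega>. \<omega> \<in> ?S \<Longrightarrow> cmod (\<omega> (s n) - of_real (f \<omega>)) < inverse (real (Suc n))"
    by metis
  \<comment> \<open>A norming character of the difference turns uniform closeness on the spectrum
    into closeness in the algebra. Approximants of \<open>f\<close> are therefore Cauchy.\<close>
  have dist: "cstar_dist A x y \<le> e"
    if xy: "x \<in> carrier A" "y \<in> carrier A" and le: "\<And>\<omega>. \<omega> \<in> ?S \<Longrightarrow> cmod (\<omega> x - \<omega> y) \<le> e" for x y e
  proof -
    obtain \<omega> where \<omega>: "\<omega> \<in> ?S" "cmod (\<omega> (x \<ominus>\<^bsub>A\<^esub> y)) = cnorm A (x \<ominus>\<^bsub>A\<^esub> y)"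
      using character_norming[of "x \<ominus>\<^bsub>A\<^esub> y"] xy by (auto simp: diff_eq_scale)
    then show ?thesis using le[OF \<omega>(1)] character_diff[OF \<omega>(1) xy] xy \<omega>(2) by (simp add: cstar_dist_def)
  qed
  have "cs.MCauchy s"
    unfolding cs.MCauchy_def
  proof (intro conjI allI impI)
    show "range s \<subseteq> carrier A" using s by auto
    fix e :: real assume e: "0 < e"
    obtain N where N: "inverse (real (Suc N)) < e/2" using reals_Archimedean[of "e/2"] e by auto
    have "cstar_dist A (s n) (s n') < e" if "N \<le> n" "N \<le> n'" for n n'
    proof -
      have b: "inverse (real (Suc k)) \<le> inverse (real (Suc N))" if "N \<le> k" for k using that by simp
      have "cmod (\<omega> (s n) - \<omega> (s n')) \<le> 2 * inverse (real (Suc N))" if "\<omega> \<in> ?S" for \<omega>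
      proof -
        have "cmod (\<omega> (s n) - \<omega> (s n')) \<le> cmod (\<omega> (s n) - of_real (f \<omega>)) + cmod (\<omega> (s n') - of_real (f \<omega>))"
          using norm_triangle_ineq4[of "\<omega> (s n) - of_real (f \<omega>)" "\<omega> (s n') - of_real (f \<omega>)"] by simp
        then show ?thesis
          using s(3)[OF that, of n] s(3)[OF that, of n'] b[OF \<open>N \<le> n\<close>] b[OF \<open>N \<le> n'\<close>] by linarith
      qed
      then have "cstar_dist A (s n) (s n') \<le> 2 * inverse (real (Suc N))" using s(1) by (intro dist) auto
      then show ?thesis using N by simp
    qed
    then show "\<exists>N. \<forall>n n'. N \<le> n \<longrightarrow> N \<le> n' \<longrightarrow> cstar_dist A (s n) (s n') < e" by blast
  qed
  then obtain a where "limitin cs.mtopology s a sequentially"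
    using complete unfolding cs.mcomplete_def by blast
  then have a: "a \<in> carrier A" and lim: "\<And>e. 0 < e \<Longrightarrow> \<forall>\<^sub>F n in sequentially. cstar_dist A (s n) a < e"
    using s(1) by (auto simp: cs.limitin_metric eventually_conj_iff)
  have \<omega>a: "\<omega> a = of_real (f \<omega>)" if \<omega>: "\<omega> \<in> ?S" for \<omega>
  proof (rule ccontr)
    define e where "e = cmod (\<omega> a - of_real (f \<omega>))"
    assume "\<omega> a \<noteq> of_real (f \<omega>)"
    then have e: "0 < e" by (simp add: e_def)
    have "\<forall>\<^sub>F n in sequentially. inverse (real (Suc n)) < e/2"
      using e by (intro order_tendstoD(2)[OF LIMSEQ_inverse_real_of_nat]) auto
    then have "\<forall>\<^sub>F n in sequentially. cstar_dist A (s n) a < e/2 \<and> inverse (real (Suc n)) < e/2"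
      using lim[of "e/2"] e by (intro eventually_conj) auto
    then obtain n where n: "cstar_dist A (s n) a < e/2" "inverse (real (Suc n)) < e/2"
      using eventually_happens'[OF sequentially_bot] by blast
    have "cmod (\<omega> (s n) - \<omega> a) \<le> cstar_dist A (s n) a"
      using cmod_character_le[OF \<omega>, of "s n \<ominus>\<^bsub>A\<^esub> a"] character_diff[OF \<omega> s(1) a, of n] s(1) a
      by (simp add: cstar_dist_def diff_eq_scale)
    then have "e < e/2 + e/2"
      using n s(3)[OF \<omega>, of n] norm_triangle_ineq4[of "\<omega> (s n) - of_real (f \<omega>)" "\<omega> (s n) - \<omega> a"]
      by (simp add: e_def)
    then show False by simp
  qed
  \<comment> \<open>The evaluations of \<open>a\<close> are real and the characters separate points,
    so no continuity of the adjoint has to be established.\<close>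
  have "adj A a = a"
  proof (rule characters_separate)
    show "\<omega> (adj A a) = \<omega> a" if "\<omega> \<in> characters A" for \<omega>
      using character_adj[OF that a] \<omega>a[OF that] by simp
  qed (use a adj_closed in auto)
  then show ?thesis using that a \<omega>a by blast
qed

lemma Gelfand_surj:
  assumes \<phi>: "continuous_map (spec_obj A) euclidean \<phi>"
  obtains a where "a \<in> carrier A" "\<And>\<omega>. \<omega> \<in> characters A \<Longrightarrow> \<omega> a = \<phi> \<omega>"
proof -
  obtain b where b: "b \<in> carrier A" "\<And>\<omega>. \<omega> \<in> characters A \<Longrightarrow> \<omega> b = of_real (Re (\<phi> \<omega>))"
    using Gelfand_real_surj[of "\<lambda>\<omega>. Re (\<phi> \<omega>)"] \<phi> unfolding continuous_map_complex_iff by metis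
  obtain c where c: "c \<in> carrier A" "\<And>\<omega>. \<omega> \<in> characters A \<Longrightarrow> \<omega> c = of_real (Im (\<phi> \<omega>))"
    using Gelfand_real_surj[of "\<lambda>\<omega>. Im (\<phi> \<omega>)"] \<phi> unfolding continuous_map_complex_iff by metis
  have "\<omega> (b \<oplus>\<^bsub>A\<^esub> \<i> \<odot>\<^bsub>A\<^esub> c) = \<phi> \<omega>" if "\<omega> \<in> characters A" for \<omega>
    using that b c complex_eq[of "\<phi> \<omega>"] by (simp add: charactersD(2,3))
  then show ?thesis using that[of "b \<oplus>\<^bsub>A\<^esub> \<i> \<odot>\<^bsub>A\<^esub> c"] b c by simp
qed

lemma cnorm_eq_SUP:
  assumes a: "a \<in> carrier A"
  shows "cnorm A a = (SUP \<omega>\<in>characters A. cmod (\<omega> a))"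
proof (rule antisym)
  obtain \<omega> where \<omega>: "\<omega> \<in> characters A" "cmod (\<omega> a) = cnorm A a" using character_norming[OF a] by blast
  have "bdd_above ((\<lambda>\<omega>. cmod (\<omega> a)) ` characters A)"
    using cmod_character_le a by (intro bdd_aboveI[of _ "cnorm A a"]) auto
  then show "cnorm A a \<le> (SUP \<omega>\<in>characters A. cmod (\<omega> a))" using \<omega> by (metis cSUP_upper)
  show "(SUP \<omega>\<in>characters A. cmod (\<omega> a)) \<le> cnorm A a"
    using cmod_character_le a characters_nonempty by (intro cSUP_least) auto
qed

end

section \<open>The algebra of continuous functions\<close>

lemma continuous_map_mult:
  fixes f :: "'a \<Rightarrow> 'b::real_normed_algebra"
  shows "\<lbrakk>continuous_map X euclidean f; continuous_map X euclidean g\<rbrakk>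
    \<Longrightarrow> continuous_map X euclidean (\<lambda>x. f x * g x)"
  by (simp add: continuous_map_atin tendsto_mult)

lemma continuous_map_cnj: "continuous_map X euclidean f \<Longrightarrow> continuous_map X euclidean (\<lambda>x. cnj (f x))"
  by (rule continuous_map_euclidean_compose[where g = cnj]) (auto intro: continuous_intros)

lemma continuous_map_restrict: "continuous_map X Y f \<Longrightarrow> continuous_map X Y (restrict f (topspace X))"
  by (erule continuous_map_eq) simp

lemma C_obj_simps [simp]:
  "mult (C_obj X) = (\<lambda>\<phi> \<psi>. \<lambda>x\<in>topspace X. \<phi> x * \<psi> x)"
  "one (C_obj X) = (\<lambda>x\<in>topspace X. 1)"
  "zero (C_obj X) = (\<lambda>x\<in>topspace X. 0)"
  "add (C_obj X) = (\<lambda>\<phi> \<psi>. \<lambda>x\<in>topspace X. \<phi> x + \<psi> x)"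
  "smult (C_obj X) = (\<lambda>c \<phi>. \<lambda>x\<in>topspace X. c * \<phi> x)"
  "adj (C_obj X) = (\<lambda>\<phi>. \<lambda>x\<in>topspace X. cnj (\<phi> x))"
  by (simp_all add: C_obj_def)

lemma cnorm_C_obj: "cnorm (C_obj X) \<phi> = (SUP x\<in>topspace X. cmod (\<phi> x))"
  by (simp add: C_obj_def)

lemma carrier_C_obj: "\<phi> \<in> carrier (C_obj X) \<longleftrightarrow> \<phi> \<in> extensional (topspace X) \<and> continuous_map X euclidean \<phi>"
  by (simp add: C_obj_def)

lemma restrict_in_C_obj: "continuous_map X euclidean \<phi> \<Longrightarrow> restrict \<phi> (topspace X) \<in> carrier (C_obj X)"
  by (simp add: carrier_C_obj continuous_map_restrict)

lemma C_objD: "\<phi> \<in> carrier (C_obj X) \<Longrightarrow> continuous_map X euclidean \<phi>"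
  by (simp add: carrier_C_obj)

lemma C_obj_eqI:
  assumes "\<phi> \<in> carrier (C_obj X)" "\<psi> \<in> carrier (C_obj X)" "\<And>x. x \<in> topspace X \<Longrightarrow> \<phi> x = \<psi> x"
  shows "\<phi> = \<psi>"
  using assms by (intro extensionalityI[of _ "topspace X"]) (auto simp: carrier_C_obj)

lemma restrict_C_obj: "\<phi> \<in> carrier (C_obj X) \<Longrightarrow> restrict \<phi> (topspace X) = \<phi>"
  by (simp add: carrier_C_obj extensional_restrict)

lemma
  assumes "\<phi> \<in> carrier (C_obj X)" "\<psi> \<in> carrier (C_obj X)"
  shows C_obj_add_closed: "(\<lambda>x\<in>topspace X. \<phi> x + \<psi> x) \<in> carrier (C_obj X)"
    and C_obj_mult_closed: "(\<lambda>x\<in>topspace X. \<phi> x * \<psi> x) \<in> carrier (C_obj X)"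
    and C_obj_scale_closed: "(\<lambda>x\<in>topspace X. c * \<phi> x) \<in> carrier (C_obj X)"
    and C_obj_adj_closed: "(\<lambda>x\<in>topspace X. cnj (\<phi> x)) \<in> carrier (C_obj X)"
  using assms by (auto intro!: restrict_in_C_obj continuous_map_add continuous_map_mult continuous_map_cnj
      simp: carrier_C_obj)

lemma C_obj_const_closed: "(\<lambda>x\<in>topspace X. c) \<in> carrier (C_obj X)"
  by (rule restrict_in_C_obj) simp

lemma cring_complex_ring: "cring complex_ring"
proof (intro cringI abelian_groupI comm_monoidI)
  fix x assume "x \<in> carrier complex_ring"
  show "\<exists>y\<in>carrier complex_ring. y \<oplus>\<^bsub>complex_ring\<^esub> x = \<zero>\<^bsub>complex_ring\<^esub>"
    by (intro bexI[of _ "- x"]) (auto simp: complex_ring_def)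
qed (auto simp: complex_ring_def algebra_simps)

lemma cring_C_obj: "cring (C_obj X)"
proof (intro cringI abelian_groupI comm_monoidI)
  fix \<phi> assume \<phi>: "\<phi> \<in> carrier (C_obj X)"
  show "\<exists>\<psi>\<in>carrier (C_obj X). \<psi> \<oplus>\<^bsub>C_obj X\<^esub> \<phi> = \<zero>\<^bsub>C_obj X\<^esub>"
    using \<phi> C_obj_scale_closed[OF \<phi> \<phi>, of "-1"]
    by (intro bexI[of _ "\<lambda>x\<in>topspace X. -1 * \<phi> x"]) (auto simp: fun_eq_iff restrict_def)
qed ((simp add: C_obj_add_closed C_obj_mult_closed C_obj_const_closed; fail) |
     (auto simp: fun_eq_iff restrict_def algebra_simps carrier_C_obj extensional_def; fail))+

lemma algebra_C_obj: "algebra complex_ring (C_obj X)"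
proof (rule algebraI[OF cring_complex_ring cring_C_obj])
  fix c d :: complex and \<phi> \<psi> assume \<phi>: "\<phi> \<in> carrier (C_obj X)" and \<psi>: "\<psi> \<in> carrier (C_obj X)"
  show "c \<odot>\<^bsub>C_obj X\<^esub> \<phi> \<in> carrier (C_obj X)" using C_obj_scale_closed[OF \<phi> \<phi>] by simp
  show "\<one>\<^bsub>complex_ring\<^esub> \<odot>\<^bsub>C_obj X\<^esub> \<phi> = \<phi>" using restrict_C_obj[OF \<phi>] by (simp add: complex_ring_def)
qed (auto simp: complex_ring_def fun_eq_iff restrict_def algebra_simps)

section \<open>The supremum norm on C(X) and its completeness\<close>

context
  fixes X :: "'x topology"
  assumes X: "chaus X"
begin

lemma cmod_le_cnorm_C_obj:
  assumes \<phi>: "\<phi> \<in> carrier (C_obj X)" and x: "x \<in> topspace X"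
  shows "cmod (\<phi> x) \<le> cnorm (C_obj X) \<phi>"
proof -
  obtain B where "\<And>x. x \<in> topspace X \<Longrightarrow> cmod (\<phi> x) \<le> B"
    using continuous_map_bounded[OF X C_objD[OF \<phi>]] by blast
  then have "bdd_above ((\<lambda>x. cmod (\<phi> x)) ` topspace X)" by (auto intro!: bdd_aboveI[of _ B])
  then show ?thesis unfolding cnorm_C_obj using x by (intro cSUP_upper)
qed

lemma cnorm_C_obj_le:
  assumes "\<And>x. x \<in> topspace X \<Longrightarrow> cmod (\<phi> x) \<le> B"
  shows "cnorm (C_obj X) \<phi> \<le> B"
  unfolding cnorm_C_obj using X assms unfolding chaus_def by (intro cSUP_least) auto

lemma chaus_point: obtains x where "x \<in> topspace X"
  using X unfolding chaus_def by blast

lemma cnorm_C_obj_nonneg: "\<phi> \<in> carrier (C_obj X) \<Longrightarrow> 0 \<le> cnorm (C_obj X) \<phi>"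
proof -
  assume \<phi>: "\<phi> \<in> carrier (C_obj X)"
  obtain x where "x \<in> topspace X" by (rule chaus_point)
  from cmod_le_cnorm_C_obj[OF \<phi> this] show ?thesis by (rule order_trans[OF norm_ge_zero])
qed

lemma cnorm_C_obj_eq_0:
  assumes \<phi>: "\<phi> \<in> carrier (C_obj X)"
  shows "cnorm (C_obj X) \<phi> = 0 \<longleftrightarrow> \<phi> = \<zero>\<^bsub>C_obj X\<^esub>"
proof
  assume "cnorm (C_obj X) \<phi> = 0"
  then have "\<phi> x = 0" if "x \<in> topspace X" for x using cmod_le_cnorm_C_obj[OF \<phi> that] by simp
  then show "\<phi> = \<zero>\<^bsub>C_obj X\<^esub>" using C_obj_eqI[OF \<phi> C_obj_const_closed] by simp
next
  assume "\<phi> = \<zero>\<^bsub>C_obj X\<^esub>"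
  then have "cnorm (C_obj X) \<phi> \<le> 0" by (intro cnorm_C_obj_le) auto
  then show "cnorm (C_obj X) \<phi> = 0" using cnorm_C_obj_nonneg[OF \<phi>] by simp
qed

lemma cnorm_C_obj_scale:
  assumes \<phi>: "\<phi> \<in> carrier (C_obj X)"
  shows "cnorm (C_obj X) (c \<odot>\<^bsub>C_obj X\<^esub> \<phi>) = cmod c * cnorm (C_obj X) \<phi>"
proof (rule antisym)
  show "cnorm (C_obj X) (c \<odot>\<^bsub>C_obj X\<^esub> \<phi>) \<le> cmod c * cnorm (C_obj X) \<phi>"
    using cmod_le_cnorm_C_obj[OF \<phi>] by (intro cnorm_C_obj_le) (simp add: norm_mult mult_left_mono)
  have c\<phi>: "c \<odot>\<^bsub>C_obj X\<^esub> \<phi> \<in> carrier (C_obj X)" using C_obj_scale_closed[OF \<phi> \<phi>] by simp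
  show "cmod c * cnorm (C_obj X) \<phi> \<le> cnorm (C_obj X) (c \<odot>\<^bsub>C_obj X\<^esub> \<phi>)"
  proof (cases "c = 0")
    case False
    have "cnorm (C_obj X) \<phi> \<le> cnorm (C_obj X) (c \<odot>\<^bsub>C_obj X\<^esub> \<phi>) / cmod c"
    proof (rule cnorm_C_obj_le)
      fix x assume x: "x \<in> topspace X"
      have "cmod c * cmod (\<phi> x) \<le> cnorm (C_obj X) (c \<odot>\<^bsub>C_obj X\<^esub> \<phi>)"
        using cmod_le_cnorm_C_obj[OF c\<phi> x] x by (simp add: norm_mult)
      then show "cmod (\<phi> x) \<le> cnorm (C_obj X) (c \<odot>\<^bsub>C_obj X\<^esub> \<phi>) / cmod c"
        using False by (simp add: field_simps)
    qed
    then show ?thesis using False by (simp add: field_simps)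
  qed (use cnorm_C_obj_nonneg[OF c\<phi>] in simp)
qed

lemma cnorm_C_obj_cstar:
  assumes \<phi>: "\<phi> \<in> carrier (C_obj X)"
  shows "cnorm (C_obj X) (adj (C_obj X) \<phi> \<otimes>\<^bsub>C_obj X\<^esub> \<phi>) = (cnorm (C_obj X) \<phi>)\<^sup>2" (is "cnorm _ ?\<psi> = _")
proof (rule antisym)
  have v: "cmod (?\<psi> x) = (cmod (\<phi> x))\<^sup>2" if "x \<in> topspace X" for x
    using that by (simp add: norm_mult power2_eq_square)
  show "cnorm (C_obj X) ?\<psi> \<le> (cnorm (C_obj X) \<phi>)\<^sup>2"
    using cmod_le_cnorm_C_obj[OF \<phi>] v by (intro cnorm_C_obj_le) (metis norm_ge_zero power_mono)
  have \<psi>: "?\<psi> \<in> carrier (C_obj X)"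
    using C_obj_mult_closed[OF C_obj_adj_closed[OF \<phi> \<phi>] \<phi>] by simp
  have "cnorm (C_obj X) \<phi> \<le> sqrt (cnorm (C_obj X) ?\<psi>)"
  proof (rule cnorm_C_obj_le)
    fix x assume x: "x \<in> topspace X"
    show "cmod (\<phi> x) \<le> sqrt (cnorm (C_obj X) ?\<psi>)"
      using cmod_le_cnorm_C_obj[OF \<psi> x] unfolding v[OF x] by (rule real_le_rsqrt)
  qed
  then show "(cnorm (C_obj X) \<phi>)\<^sup>2 \<le> cnorm (C_obj X) ?\<psi>"
    using cnorm_C_obj_nonneg[OF \<phi>] cnorm_C_obj_nonneg[OF \<psi>] by (metis power_mono real_sqrt_pow2)
qed

lemma minus_C_obj:
  assumes "\<phi> \<in> carrier (C_obj X)" "\<psi> \<in> carrier (C_obj X)"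
  shows "\<phi> \<ominus>\<^bsub>C_obj X\<^esub> \<psi> = (\<lambda>x\<in>topspace X. \<phi> x - \<psi> x)"
proof -
  interpret cring "C_obj X" by (rule cring_C_obj)
  have "\<ominus>\<^bsub>C_obj X\<^esub> \<psi> = (\<lambda>x\<in>topspace X. -1 * \<psi> x)"
    using C_obj_scale_closed[OF assms(2,2), of "-1"] assms(2)
    by (intro minus_equality) (auto simp: fun_eq_iff restrict_def)
  then show ?thesis by (simp add: a_minus_def fun_eq_iff restrict_def)
qed

lemma cstar_dist_C_obj_le:
  assumes "\<phi> \<in> carrier (C_obj X)" "\<psi> \<in> carrier (C_obj X)"
  shows "cstar_dist (C_obj X) \<phi> \<psi> \<le> e \<longleftrightarrow> (\<forall>x\<in>topspace X. cmod (\<phi> x - \<psi> x) \<le> e)"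
proof -
  have d: "cstar_dist (C_obj X) \<phi> \<psi> = cnorm (C_obj X) (\<lambda>x\<in>topspace X. \<phi> x - \<psi> x)"
    using assms by (simp add: cstar_dist_def minus_C_obj)
  have "(\<lambda>x\<in>topspace X. \<phi> x - \<psi> x) \<in> carrier (C_obj X)"
    using assms by (intro restrict_in_C_obj continuous_map_diff) (auto simp: carrier_C_obj)
  from cmod_le_cnorm_C_obj[OF this] have "\<forall>x\<in>topspace X. cmod (\<phi> x - \<psi> x) \<le> cstar_dist (C_obj X) \<phi> \<psi>"
    by (simp add: d)
  then show ?thesis unfolding d by (auto intro!: cnorm_C_obj_le intro: order_trans)
qed

text \<open>The metric axioms come first because completeness, stated through
  \<open>Metric_space\<close>, is itself an axiom of \<open>comm_cstar_algebra\<close>; the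
  sublocale of that locale is available only afterwards.\<close>

lemma Metric_space_C_obj: "Metric_space (carrier (C_obj X)) (cstar_dist (C_obj X))"
proof
  interpret cring "C_obj X" by (rule cring_C_obj)
  note le = cstar_dist_C_obj_le
  have le': "cmod (\<phi> x - \<psi> x) \<le> cstar_dist (C_obj X) \<phi> \<psi>"
    if "\<phi> \<in> carrier (C_obj X)" "\<psi> \<in> carrier (C_obj X)" "x \<in> topspace X" for \<phi> \<psi> x
    using le[OF that(1,2), of "cstar_dist (C_obj X) \<phi> \<psi>"] that(3) by blast
  show "0 \<le> cstar_dist (C_obj X) \<phi> \<psi>" for \<phi> \<psi>
    by (simp add: cstar_dist_def cnorm_C_obj_nonneg del: C_obj_simps)
  have sym: "cstar_dist (C_obj X) \<phi> \<psi> \<le> cstar_dist (C_obj X) \<psi> \<phi>"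
    if "\<phi> \<in> carrier (C_obj X)" "\<psi> \<in> carrier (C_obj X)" for \<phi> \<psi>
    unfolding le[OF that] using le'[OF that(2,1)] by (metis norm_minus_commute)
  show "cstar_dist (C_obj X) \<phi> \<psi> = cstar_dist (C_obj X) \<psi> \<phi>" for \<phi> \<psi>
  proof (cases "\<phi> \<in> carrier (C_obj X) \<and> \<psi> \<in> carrier (C_obj X)")
    case True
    then show ?thesis using sym by (simp add: order_antisym)
  qed (auto simp: cstar_dist_def)
  fix \<phi> \<psi> \<theta> assume c: "\<phi> \<in> carrier (C_obj X)" "\<psi> \<in> carrier (C_obj X)"
  show "cstar_dist (C_obj X) \<phi> \<psi> = 0 \<longleftrightarrow> \<phi> = \<psi>"
  proof
    assume "cstar_dist (C_obj X) \<phi> \<psi> = 0"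
    then show "\<phi> = \<psi>" using le'[OF c] by (intro C_obj_eqI[OF c]) auto
  next
    assume "\<phi> = \<psi>"
    then have "cstar_dist (C_obj X) \<phi> \<psi> \<le> 0" using le[OF c] by simp
    then show "cstar_dist (C_obj X) \<phi> \<psi> = 0"
      by (simp add: cstar_dist_def cnorm_C_obj_nonneg c order_antisym del: C_obj_simps)
  qed
  assume c3: "\<theta> \<in> carrier (C_obj X)"
  show "cstar_dist (C_obj X) \<phi> \<theta> \<le> cstar_dist (C_obj X) \<phi> \<psi> + cstar_dist (C_obj X) \<psi> \<theta>"
  proof (subst le[OF c(1) c3], intro ballI)
    fix x assume x: "x \<in> topspace X"
    show "cmod (\<phi> x - \<theta> x) \<le> cstar_dist (C_obj X) \<phi> \<psi> + cstar_dist (C_obj X) \<psi> \<theta>"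
      using le'[OF c x] le'[OF c(2) c3 x] norm_triangle_ineq[of "\<phi> x - \<psi> x" "\<psi> x - \<theta> x"] by simp
  qed
qed

lemma mcomplete_C_obj: "Metric_space.mcomplete (carrier (C_obj X)) (cstar_dist (C_obj X))"
proof -
  interpret M: Metric_space "carrier (C_obj X)" "cstar_dist (C_obj X)" by (rule Metric_space_C_obj)
  show ?thesis
    unfolding M.mcomplete_def
  proof (intro allI impI)
    fix \<sigma> assume C: "M.MCauchy \<sigma>"
    then have \<sigma>: "\<sigma> n \<in> carrier (C_obj X)" for n by (auto simp: M.MCauchy_def)
    have unif: "\<exists>N. \<forall>n\<ge>N. \<forall>m\<ge>N. \<forall>x\<in>topspace X. cmod (\<sigma> n x - \<sigma> m x) \<le> e" if e: "0 < e" for e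
    proof -
      obtain N where N: "\<forall>n m. N \<le> n \<longrightarrow> N \<le> m \<longrightarrow> cstar_dist (C_obj X) (\<sigma> n) (\<sigma> m) < e"
        using C e unfolding M.MCauchy_def by blast
      have "\<forall>x\<in>topspace X. cmod (\<sigma> n x - \<sigma> m x) \<le> e" if "N \<le> n" "N \<le> m" for n m
        using N that cstar_dist_C_obj_le[OF \<sigma>[of n] \<sigma>[of m], of e] by (simp add: less_imp_le)
      then show ?thesis by blast
    qed
    have "Cauchy (\<lambda>n. \<sigma> n x)" if "x \<in> topspace X" for x
    proof (rule metric_CauchyI)
      fix e :: real assume e: "0 < e"
      then obtain N where N: "\<forall>n\<ge>N. \<forall>m\<ge>N. \<forall>x\<in>topspace X. cmod (\<sigma> n x - \<sigma> m x) \<le> e/2" using unif[of "e/2"] by auto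
      then show "\<exists>N. \<forall>m\<ge>N. \<forall>n\<ge>N. dist (\<sigma> m x) (\<sigma> n x) < e"
      proof (intro exI allI impI)
        fix m n assume "N \<le> m" "N \<le> n"
        then have "cmod (\<sigma> m x - \<sigma> n x) \<le> e/2" using N that by blast
        then show "dist (\<sigma> m x) (\<sigma> n x) < e" using e by (simp add: dist_norm)
      qed
    qed
    then have lim: "(\<lambda>n. \<sigma> n x) \<longlonglongrightarrow> lim (\<lambda>n. \<sigma> n x)" if "x \<in> topspace X" for x
      using that Cauchy_convergent convergent_LIMSEQ_iff by blast
    define \<phi> where "\<phi> = (\<lambda>x\<in>topspace X. lim (\<lambda>n. \<sigma> n x))"
    have close: "\<exists>N. \<forall>n\<ge>N. \<forall>x\<in>topspace X. cmod (\<sigma> n x - \<phi> x) \<le> e" if e: "0 < e" for e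
    proof -
      obtain N where N: "\<forall>n\<ge>N. \<forall>m\<ge>N. \<forall>x\<in>topspace X. cmod (\<sigma> n x - \<sigma> m x) \<le> e" using unif[OF e] by blast
      have "cmod (\<sigma> n x - \<phi> x) \<le> e" if "N \<le> n" "x \<in> topspace X" for n x
      proof (rule LIMSEQ_le_const2)
        show "(\<lambda>m. cmod (\<sigma> n x - \<sigma> m x)) \<longlonglongrightarrow> cmod (\<sigma> n x - \<phi> x)"
          using tendsto_norm[OF tendsto_diff[OF tendsto_const lim[OF that(2)]]] that(2) by (simp add: \<phi>_def)
        show "\<exists>N. \<forall>m\<ge>N. cmod (\<sigma> n x - \<sigma> m x) \<le> e" using N that by blast
      qed
      then show ?thesis by blast
    qed
    have "continuous_map X Met_TC.mtopology \<phi>"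
    proof (rule Met_TC.continuous_map_uniform_limit[where f = \<sigma> and F = sequentially])
      show "\<forall>\<^sub>F n in sequentially. continuous_map X Met_TC.mtopology (\<sigma> n)"
        using \<sigma> by (simp add: carrier_C_obj)
      fix e :: real assume "0 < e"
      then obtain N where "\<forall>n\<ge>N. \<forall>x\<in>topspace X. cmod (\<sigma> n x - \<phi> x) \<le> e/2" using close[of "e/2"] by auto
      then show "\<forall>\<^sub>F n in sequentially. \<forall>x\<in>topspace X. \<phi> x \<in> UNIV \<and> dist (\<sigma> n x) (\<phi> x) < e"
        using \<open>0 < e\<close> unfolding eventually_sequentially by (intro exI[of _ N]) (fastforce simp: dist_norm)
    qed simp
    then have \<phi>: "\<phi> \<in> carrier (C_obj X)" by (simp add: carrier_C_obj \<phi>_def)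
    have "limitin M.mtopology \<sigma> \<phi> sequentially"
      unfolding M.limitin_metric
    proof (intro conjI allI impI \<phi>)
      fix e :: real assume "0 < e"
      then obtain N where N: "\<forall>n\<ge>N. \<forall>x\<in>topspace X. cmod (\<sigma> n x - \<phi> x) \<le> e/2" using close[of "e/2"] by auto
      then have "cstar_dist (C_obj X) (\<sigma> n) \<phi> < e" if "N \<le> n" for n
        using cstar_dist_C_obj_le[OF \<sigma> \<phi>, of n "e/2"] that \<open>0 < e\<close> by auto
      then show "\<forall>\<^sub>F n in sequentially. \<sigma> n \<in> carrier (C_obj X) \<and> cstar_dist (C_obj X) (\<sigma> n) \<phi> < e"
        unfolding eventually_sequentially using \<sigma> by blast
    qed
    then show "\<exists>\<phi>. limitin M.mtopology \<sigma> \<phi> sequentially" by blast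
  qed
qed

theorem comm_cstar_algebra_C_obj: "comm_cstar_algebra (C_obj X)"
proof (intro comm_cstar_algebra.intro comm_cstar_algebra_axioms.intro algebra_C_obj mcomplete_C_obj)
  show "\<one>\<^bsub>C_obj X\<^esub> \<noteq> \<zero>\<^bsub>C_obj X\<^esub>"
  proof -
    obtain x where "x \<in> topspace X" by (rule chaus_point)
    then have "\<one>\<^bsub>C_obj X\<^esub> x \<noteq> \<zero>\<^bsub>C_obj X\<^esub> x" by simp
    then show ?thesis by metis
  qed
  fix c \<phi> \<psi> assume \<phi>: "\<phi> \<in> carrier (C_obj X)"
  show "0 \<le> cnorm (C_obj X) \<phi>" by (rule cnorm_C_obj_nonneg[OF \<phi>])
  show "cnorm (C_obj X) \<phi> = 0 \<longleftrightarrow> \<phi> = \<zero>\<^bsub>C_obj X\<^esub>" by (rule cnorm_C_obj_eq_0[OF \<phi>])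
  show "cnorm (C_obj X) (c \<odot>\<^bsub>C_obj X\<^esub> \<phi>) = cmod c * cnorm (C_obj X) \<phi>" by (rule cnorm_C_obj_scale[OF \<phi>])
  show "cnorm (C_obj X) (adj (C_obj X) \<phi> \<otimes>\<^bsub>C_obj X\<^esub> \<phi>) = (cnorm (C_obj X) \<phi>)\<^sup>2" by (rule cnorm_C_obj_cstar[OF \<phi>])
  show "adj (C_obj X) \<phi> \<in> carrier (C_obj X)" using C_obj_adj_closed[OF \<phi> \<phi>] by simp
  show "adj (C_obj X) (adj (C_obj X) \<phi>) = \<phi>"
    using \<phi> by (auto simp: fun_eq_iff restrict_def carrier_C_obj extensional_def)
  show "adj (C_obj X) (c \<odot>\<^bsub>C_obj X\<^esub> \<phi>) = cnj c \<odot>\<^bsub>C_obj X\<^esub> adj (C_obj X) \<phi>" by (auto simp: fun_eq_iff restrict_def)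
  assume \<psi>: "\<psi> \<in> carrier (C_obj X)"
  show "cnorm (C_obj X) (\<phi> \<oplus>\<^bsub>C_obj X\<^esub> \<psi>) \<le> cnorm (C_obj X) \<phi> + cnorm (C_obj X) \<psi>"
  proof (rule cnorm_C_obj_le)
    fix x assume x: "x \<in> topspace X"
    then show "cmod ((\<phi> \<oplus>\<^bsub>C_obj X\<^esub> \<psi>) x) \<le> cnorm (C_obj X) \<phi> + cnorm (C_obj X) \<psi>"
      using cmod_le_cnorm_C_obj[OF \<phi> x] cmod_le_cnorm_C_obj[OF \<psi> x] norm_triangle_ineq[of "\<phi> x" "\<psi> x"] by simp
  qed
  show "cnorm (C_obj X) (\<phi> \<otimes>\<^bsub>C_obj X\<^esub> \<psi>) \<le> cnorm (C_obj X) \<phi> * cnorm (C_obj X) \<psi>"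
  proof (rule cnorm_C_obj_le)
    fix x assume x: "x \<in> topspace X"
    then show "cmod ((\<phi> \<otimes>\<^bsub>C_obj X\<^esub> \<psi>) x) \<le> cnorm (C_obj X) \<phi> * cnorm (C_obj X) \<psi>"
      using cmod_le_cnorm_C_obj[OF \<phi> x] cmod_le_cnorm_C_obj[OF \<psi> x] cnorm_C_obj_nonneg[OF \<phi>]
      by (simp add: norm_mult mult_mono)
  qed
  show "adj (C_obj X) (\<phi> \<oplus>\<^bsub>C_obj X\<^esub> \<psi>) = adj (C_obj X) \<phi> \<oplus>\<^bsub>C_obj X\<^esub> adj (C_obj X) \<psi>" by (auto simp: fun_eq_iff restrict_def)
  show "adj (C_obj X) (\<phi> \<otimes>\<^bsub>C_obj X\<^esub> \<psi>) = adj (C_obj X) \<psi> \<otimes>\<^bsub>C_obj X\<^esub> adj (C_obj X) \<phi>" by (auto simp: fun_eq_iff restrict_def)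
qed

section \<open>Complex functionals on C(X) and comparison of measures\<close>

text \<open>Positivity is assumed only for products of a function with its adjoint. A nonnegative
  function has this form through its square root, which makes the real part of \<open>s\<close> on
  real functions a positive functional.\<close>

lemma complex_riesz:
  assumes add: "\<And>\<phi> \<psi>. \<lbrakk>\<phi> \<in> carrier (C_obj X); \<psi> \<in> carrier (C_obj X)\<rbrakk> \<Longrightarrow> s (\<phi> \<oplus>\<^bsub>C_obj X\<^esub> \<psi>) = s \<phi> + s \<psi>"
    and scale: "\<And>c \<phi>. \<phi> \<in> carrier (C_obj X) \<Longrightarrow> s (c \<odot>\<^bsub>C_obj X\<^esub> \<phi>) = c * s \<phi>"
    and one: "s \<one>\<^bsub>C_obj X\<^esub> = 1"
    and pos: "\<And>\<phi>. \<phi> \<in> carrier (C_obj X) \<Longrightarrow> \<exists>r\<ge>0. s (adj (C_obj X) \<phi> \<otimes>\<^bsub>C_obj X\<^esub> \<phi>) = complex_of_real r"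
  obtains M where "M \<in> prob_meas X" "\<And>\<phi>. \<phi> \<in> carrier (C_obj X) \<Longrightarrow> (\<integral>x. \<phi> x \<partial>M) = s \<phi>"
proof -
  define e where "e \<phi> = (\<lambda>x\<in>topspace X. complex_of_real (\<phi> x))" for \<phi> :: "'x \<Rightarrow> real"
  have e: "e \<phi> \<in> carrier (C_obj X)" if "continuous_map X euclideanreal \<phi>" for \<phi>
    unfolding e_def using that
    by (intro restrict_in_C_obj continuous_map_euclidean_compose[where g = of_real] continuous_intros)
  have s_pos: "\<exists>r\<ge>0. s (e \<phi>) = complex_of_real r"
    if \<phi>: "continuous_map X euclideanreal \<phi>" "\<And>x. x \<in> topspace X \<Longrightarrow> 0 \<le> \<phi> x" for \<phi>
  proof -
    let ?\<psi> = "e (\<lambda>x. sqrt (\<phi> x))"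
    have "?\<psi> \<in> carrier (C_obj X)"
      using \<phi>(1) by (intro e continuous_map_euclidean_compose[where g = sqrt] continuous_intros)
    from pos[OF this] obtain r where "0 \<le> r" "s (adj (C_obj X) ?\<psi> \<otimes>\<^bsub>C_obj X\<^esub> ?\<psi>) = complex_of_real r" by blast
    moreover have "adj (C_obj X) ?\<psi> \<otimes>\<^bsub>C_obj X\<^esub> ?\<psi> = e \<phi>"
      using \<phi>(2) by (auto simp: e_def fun_eq_iff restrict_def simp flip: of_real_mult)
    ultimately show ?thesis by auto
  qed
  have e_add: "s (e (\<lambda>x. \<phi> x + \<psi> x)) = s (e \<phi>) + s (e \<psi>)"
    if "continuous_map X euclideanreal \<phi>" "continuous_map X euclideanreal \<psi>" for \<phi> \<psi>
  proof -
    have eq: "e (\<lambda>x. \<phi> x + \<psi> x) = e \<phi> \<oplus>\<^bsub>C_obj X\<^esub> e \<psi>" by (auto simp: e_def fun_eq_iff restrict_def)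
    show ?thesis unfolding eq by (rule add[OF e[OF that(1)] e[OF that(2)]])
  qed
  have e_scale: "s (e (\<lambda>x. c * \<phi> x)) = of_real c * s (e \<phi>)"
    if "continuous_map X euclideanreal \<phi>" for c \<phi>
  proof -
    have eq: "e (\<lambda>x. c * \<phi> x) = of_real c \<odot>\<^bsub>C_obj X\<^esub> e \<phi>" by (auto simp: e_def fun_eq_iff restrict_def)
    show ?thesis unfolding eq by (rule scale[OF e[OF that]])
  qed
  have s_real: "Im (s (e \<phi>)) = 0" if \<phi>: "continuous_map X euclideanreal \<phi>" for \<phi>
  proof -
    have c: "continuous_map X euclideanreal (\<lambda>x. max (\<phi> x) 0)" "continuous_map X euclideanreal (\<lambda>x. max (- \<phi> x) 0)"
      using \<phi> by (auto intro!: continuous_intros)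
    \<comment> \<open>The positive part is the function plus its negative part; \<open>s\<close> is
      real on both parts, hence on the function.\<close>
    have "s (e (\<lambda>x. max (\<phi> x) 0)) = s (e (\<lambda>x. \<phi> x + max (- \<phi> x) 0))"
      by (intro arg_cong[of _ _ "\<lambda>f. s (e f)"]) (auto simp: max_def)
    also have "\<dots> = s (e \<phi>) + s (e (\<lambda>x. max (- \<phi> x) 0))" by (rule e_add[OF \<phi> c(2)])
    finally have "Im (s (e (\<lambda>x. max (\<phi> x) 0))) = Im (s (e \<phi>)) + Im (s (e (\<lambda>x. max (- \<phi> x) 0)))" by simp
    moreover have "Im (s (e (\<lambda>x. max (\<phi> x) 0))) = 0" using s_pos[OF c(1)] by auto
    moreover have "Im (s (e (\<lambda>x. max (- \<phi> x) 0))) = 0" using s_pos[OF c(2)] by auto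
    ultimately show ?thesis by simp
  qed
  interpret P: positive_functional X "\<lambda>\<phi>. Re (s (e \<phi>))"
  proof
    show "chaus X" by (rule X)
    show "0 \<le> Re (s (e \<phi>))" if "continuous_map X euclideanreal \<phi>" "\<And>x. x \<in> topspace X \<Longrightarrow> 0 \<le> \<phi> x" for \<phi>
      using s_pos[OF that] by auto
    show "Re (s (e (\<lambda>_. 1))) = 1" using one by (simp add: e_def)
  qed (simp_all add: e_add e_scale)
  have "(\<integral>x. \<phi> x \<partial>P.riesz) = s \<phi>" if \<phi>: "\<phi> \<in> carrier (C_obj X)" for \<phi>
  proof -
    have c: "continuous_map X euclideanreal (\<lambda>x. Re (\<phi> x))" "continuous_map X euclideanreal (\<lambda>x. Im (\<phi> x))"
      using C_objD[OF \<phi>] by (auto simp: continuous_map_complex_iff)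
    have real: "s (e \<psi>) = of_real (\<integral>x. \<psi> x \<partial>P.riesz)" if "continuous_map X euclideanreal \<psi>" for \<psi>
      using P.integral_riesz[OF that] s_real[OF that] by (simp add: complex_eq_iff)
    have ei: "\<i> \<odot>\<^bsub>C_obj X\<^esub> e (\<lambda>x. Im (\<phi> x)) \<in> carrier (C_obj X)"
      using C_obj_scale_closed[OF e[OF c(2)] e[OF c(2)]] by simp
    have eq: "\<phi> = e (\<lambda>x. Re (\<phi> x)) \<oplus>\<^bsub>C_obj X\<^esub> (\<i> \<odot>\<^bsub>C_obj X\<^esub> e (\<lambda>x. Im (\<phi> x)))"
      using \<phi> by (auto simp: e_def fun_eq_iff restrict_def complex_eq[symmetric] carrier_C_obj extensional_def)
    have "s \<phi> = s (e (\<lambda>x. Re (\<phi> x))) + \<i> * s (e (\<lambda>x. Im (\<phi> x)))"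
      by (subst eq) (simp only: add[OF e[OF c(1)] ei] scale[OF e[OF c(2)]])
    then show ?thesis
      using integral_complex_eq[OF integrable_continuous[OF X P.riesz_prob_meas C_objD[OF \<phi>]]]
      by (simp add: real[OF c(1)] real[OF c(2)] complex_eq_iff)
  qed
  then show ?thesis using that P.riesz_prob_meas by blast
qed

lemma prob_meas_eqI_C_obj:
  assumes "M \<in> prob_meas X" "N \<in> prob_meas X"
    and eq: "\<And>\<phi>. \<phi> \<in> carrier (C_obj X) \<Longrightarrow> (\<integral>x. \<phi> x \<partial>M) = (\<integral>x. \<phi> x \<partial>N)"
  shows "M = N"
proof (rule prob_meas_eqI[OF X assms(1,2)])
  fix \<phi> assume \<phi>: "continuous_map X euclideanreal \<phi>"
  let ?e = "\<lambda>x\<in>topspace X. complex_of_real (\<phi> x)"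
  have "?e \<in> carrier (C_obj X)"
    using \<phi> by (intro restrict_in_C_obj continuous_map_euclidean_compose[where g = of_real] continuous_intros)
  then have "(\<integral>x. ?e x \<partial>M) = (\<integral>x. ?e x \<partial>N)" by (rule eq)
  moreover have "(\<integral>x. ?e x \<partial>K) = complex_of_real (\<integral>x. \<phi> x \<partial>K)" if "K \<in> prob_meas X" for K
  proof -
    have "(\<integral>x. ?e x \<partial>K) = (\<integral>x. complex_of_real (\<phi> x) \<partial>K)"
      using prob_measD(1)[OF that] by (intro Bochner_Integration.integral_cong) auto
    then show ?thesis by simp
  qed
  ultimately show "(\<integral>x. \<phi> x \<partial>M) = (\<integral>x. \<phi> x \<partial>N)" using assms(1,2) by simp
qed

end

lemma integral_restrict_topspace:
  "space M = topspace X \<Longrightarrow> (\<integral>x. (\<lambda>x\<in>topspace X. f x) x \<partial>M) = (\<integral>x. f x \<partial>M)"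
  by (intro Bochner_Integration.integral_cong) auto

text \<open>This is the shape that \<open>simp\<close> leaves after rewriting an application of
  \<open>restrict\<close>.\<close>

lemma integral_if_topspace:
  "space M = topspace X \<Longrightarrow> (\<integral>x. (if x \<in> topspace X then f x else undefined) \<partial>M) = (\<integral>x. f x \<partial>M)"
  by (intro Bochner_Integration.integral_cong) auto

lemma integral_stoch_comp_complex:
  assumes Y: "chaus Y" and Z: "chaus Z" and \<mu>: "\<mu> \<in> stoch X Y" and \<nu>: "\<nu> \<in> stoch Y Z"
    and x: "x \<in> topspace X" and \<phi>: "continuous_map Z euclidean \<phi>"
  shows "(\<integral>z. \<phi> z \<partial>stoch_comp X Z \<nu> \<mu> x) = (\<integral>y. (\<integral>z. (\<phi> z :: complex) \<partial>\<nu> y) \<partial>\<mu> x)"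
proof -
  have c: "continuous_map Z euclideanreal (\<lambda>z. Re (\<phi> z))" "continuous_map Z euclideanreal (\<lambda>z. Im (\<phi> z))"
    using \<phi> by (auto simp: continuous_map_complex_iff)
  have pm: "stoch_comp X Z \<nu> \<mu> x \<in> prob_meas Z" by (rule stochD(2)[OF stoch_comp_in_stoch[OF Y Z \<mu> \<nu>] x])
  have in\<nu>: "(\<integral>z. \<phi> z \<partial>\<nu> y) = Complex (\<integral>z. Re (\<phi> z) \<partial>\<nu> y) (\<integral>z. Im (\<phi> z) \<partial>\<nu> y)" if "y \<in> topspace Y" for y
    by (rule integral_complex_eq[OF integrable_continuous[OF Z stochD(2)[OF \<nu> that] \<phi>]])
  have "(\<integral>y. (\<integral>z. \<phi> z \<partial>\<nu> y) \<partial>\<mu> x)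
      = Complex (\<integral>y. Re (\<integral>z. \<phi> z \<partial>\<nu> y) \<partial>\<mu> x) (\<integral>y. Im (\<integral>z. \<phi> z \<partial>\<nu> y) \<partial>\<mu> x)"
    by (rule integral_complex_eq[OF integrable_continuous[OF Y stochD(2)[OF \<mu> x] stochD(3)[OF \<nu> \<phi>]]])
  also have "(\<integral>y. Re (\<integral>z. \<phi> z \<partial>\<nu> y) \<partial>\<mu> x) = (\<integral>y. (\<integral>z. Re (\<phi> z) \<partial>\<nu> y) \<partial>\<mu> x)"
    using in\<nu> prob_measD(1)[OF stochD(2)[OF \<mu> x]] by (intro Bochner_Integration.integral_cong) auto
  also have "(\<integral>y. Im (\<integral>z. \<phi> z \<partial>\<nu> y) \<partial>\<mu> x) = (\<integral>y. (\<integral>z. Im (\<phi> z) \<partial>\<nu> y) \<partial>\<mu> x)"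
    using in\<nu> prob_measD(1)[OF stochD(2)[OF \<mu> x]] by (intro Bochner_Integration.integral_cong) auto
  finally show ?thesis
    using integral_complex_eq[OF integrable_continuous[OF Z pm \<phi>]]
    by (simp add: integral_stoch_comp[OF Y Z \<mu> \<nu> x c(1)] integral_stoch_comp[OF Y Z \<mu> \<nu> x c(2)])
qed

lemma stoch_eqI_C_obj:
  assumes "chaus Y" "\<mu> \<in> stoch X Y" "\<nu> \<in> stoch X Y"
    and eq: "\<And>x \<phi>. x \<in> topspace X \<Longrightarrow> \<phi> \<in> carrier (C_obj Y) \<Longrightarrow> (\<integral>y. \<phi> y \<partial>\<mu> x) = (\<integral>y. \<phi> y \<partial>\<nu> x)"
  shows "\<mu> = \<nu>"
  using stochD(1)[OF assms(2)] stochD(1)[OF assms(3)]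
proof (rule extensionalityI)
  fix x assume x: "x \<in> topspace X"
  show "\<mu> x = \<nu> x"
    by (rule prob_meas_eqI_C_obj[OF assms(1) stochD(2)[OF assms(2) x] stochD(2)[OF assms(3) x] eq[OF x]])
qed

lemma stochI_C_obj:
  assumes "\<mu> \<in> extensional (topspace X)"
    and pm: "\<And>x. x \<in> topspace X \<Longrightarrow> \<mu> x \<in> prob_meas Y"
    and c: "\<And>\<phi>. \<phi> \<in> carrier (C_obj Y) \<Longrightarrow> continuous_map X euclidean (\<lambda>x. \<integral>y. \<phi> y \<partial>\<mu> x)"
  shows "\<mu> \<in> stoch X Y"
proof -
  have "continuous_map X euclidean (\<lambda>x. \<integral>y. \<phi> y \<partial>\<mu> x)" if "continuous_map Y euclidean \<phi>" for \<phi> :: "_ \<Rightarrow> complex"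
    using c[OF restrict_in_C_obj[OF that]]
    by (rule continuous_map_eq) (rule integral_restrict_topspace[OF prob_measD(1)[OF pm]])
  then show ?thesis using assms(1) pm unfolding stoch_def continuous_map_vague_iff by blast
qed

section \<open>Positive unital maps\<close>

lemma pos_mapsD:
  assumes "f \<in> pos_maps B A"
  shows "f \<in> carrier B \<rightarrow>\<^sub>E carrier A" and "x \<in> carrier B \<Longrightarrow> f x \<in> carrier A"
    and "x \<in> carrier B \<Longrightarrow> y \<in> carrier B \<Longrightarrow> f (x \<oplus>\<^bsub>B\<^esub> y) = f x \<oplus>\<^bsub>A\<^esub> f y"
    and "x \<in> carrier B \<Longrightarrow> f (c \<odot>\<^bsub>B\<^esub> x) = c \<odot>\<^bsub>A\<^esub> f x"
    and "\<exists>K. \<forall>x\<in>carrier B. cnorm A (f x) \<le> K * cnorm B x"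
    and "f \<one>\<^bsub>B\<^esub> = \<one>\<^bsub>A\<^esub>"
    and "x \<in> carrier B \<Longrightarrow> cpositive A (f (adj B x \<otimes>\<^bsub>B\<^esub> x))"
proof -
  note * = assms[unfolded pos_maps_def mem_Collect_eq]
  show "f \<in> carrier B \<rightarrow>\<^sub>E carrier A" using * by (rule conjunct1)
  then show "x \<in> carrier B \<Longrightarrow> f x \<in> carrier A" by (rule PiE_mem)
  show "x \<in> carrier B \<Longrightarrow> y \<in> carrier B \<Longrightarrow> f (x \<oplus>\<^bsub>B\<^esub> y) = f x \<oplus>\<^bsub>A\<^esub> f y"
    "x \<in> carrier B \<Longrightarrow> f (c \<odot>\<^bsub>B\<^esub> x) = c \<odot>\<^bsub>A\<^esub> f x" "\<exists>K. \<forall>x\<in>carrier B. cnorm A (f x) \<le> K * cnorm B x"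
    "f \<one>\<^bsub>B\<^esub> = \<one>\<^bsub>A\<^esub>" "x \<in> carrier B \<Longrightarrow> cpositive A (f (adj B x \<otimes>\<^bsub>B\<^esub> x))"
    using * by simp_all
qed

lemma pos_mapsI:
  assumes "f \<in> carrier B \<rightarrow>\<^sub>E carrier A"
    and "\<And>x y. x \<in> carrier B \<Longrightarrow> y \<in> carrier B \<Longrightarrow> f (x \<oplus>\<^bsub>B\<^esub> y) = f x \<oplus>\<^bsub>A\<^esub> f y"
    and "\<And>c x. x \<in> carrier B \<Longrightarrow> f (c \<odot>\<^bsub>B\<^esub> x) = c \<odot>\<^bsub>A\<^esub> f x"
    and "\<And>x. x \<in> carrier B \<Longrightarrow> cnorm A (f x) \<le> K * cnorm B x"
    and "f \<one>\<^bsub>B\<^esub> = \<one>\<^bsub>A\<^esub>"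
    and "\<And>x. x \<in> carrier B \<Longrightarrow> cpositive A (f (adj B x \<otimes>\<^bsub>B\<^esub> x))"
  shows "f \<in> pos_maps B A"
  unfolding pos_maps_def mem_Collect_eq by (intro conjI ballI allI exI[of _ K] assms)

lemma pos_id_in_pos_maps:
  assumes "comm_cstar_algebra A"
  shows "pos_id A \<in> pos_maps A A"
proof -
  interpret comm_cstar_algebra A by fact
  show ?thesis
    by (rule pos_mapsI[where K = 1]) (auto simp: pos_id_def cpositive_def adj_closed)
qed

lemma pos_comp_in_pos_maps:
  assumes A: "comm_cstar_algebra A" and B: "comm_cstar_algebra B" and D: "comm_cstar_algebra D"
    and f: "f \<in> pos_maps B A" and g: "g \<in> pos_maps D B"
  shows "pos_comp D f g \<in> pos_maps D A"
proof -
  interpret A: comm_cstar_algebra A by fact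
  interpret B: comm_cstar_algebra B by fact
  interpret D: comm_cstar_algebra D by fact
  obtain K where K: "\<forall>x\<in>carrier B. cnorm A (f x) \<le> K * cnorm B x" using pos_mapsD(5)[OF f] by blast
  obtain K' where K': "\<forall>x\<in>carrier D. cnorm B (g x) \<le> K' * cnorm D x" using pos_mapsD(5)[OF g] by blast
  show ?thesis
  \<comment> \<open>The bound \<open>K\<close> of \<open>f\<close> may be negative, and multiplying
    the bound of \<open>g\<close> by it would then reverse the inequality.\<close>
  proof (rule pos_mapsI[where K = "max K 0 * K'"])
    show "pos_comp D f g \<in> carrier D \<rightarrow>\<^sub>E carrier A"
      using pos_mapsD(2)[OF f] pos_mapsD(2)[OF g] by (auto simp: pos_comp_def compose_def)
    fix x assume x: "x \<in> carrier D"
    note gx = pos_mapsD(2)[OF g x]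
    show "pos_comp D f g (c \<odot>\<^bsub>D\<^esub> x) = c \<odot>\<^bsub>A\<^esub> pos_comp D f g x" for c
      using x gx by (simp add: pos_comp_def compose_def pos_mapsD(4)[OF f] pos_mapsD(4)[OF g])
    show "pos_comp D f g (x \<oplus>\<^bsub>D\<^esub> y) = pos_comp D f g x \<oplus>\<^bsub>A\<^esub> pos_comp D f g y" if "y \<in> carrier D" for y
      using x that pos_mapsD(2)[OF g]
      by (simp add: pos_comp_def compose_def pos_mapsD(3)[OF f] pos_mapsD(3)[OF g])
    have "cnorm A (f (g x)) \<le> K * cnorm B (g x)" using K gx by blast
    also have "\<dots> \<le> max K 0 * cnorm B (g x)" using B.cnorm_nonneg[OF gx] by (intro mult_right_mono) auto
    also have "\<dots> \<le> max K 0 * (K' * cnorm D x)" using K' x by (intro mult_left_mono) auto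
    finally show "cnorm A (pos_comp D f g x) \<le> max K 0 * K' * cnorm D x"
      using x by (simp add: pos_comp_def compose_def mult.assoc)
    obtain c where c: "c \<in> carrier B" "g (adj D x \<otimes>\<^bsub>D\<^esub> x) = adj B c \<otimes>\<^bsub>B\<^esub> c"
      using pos_mapsD(7)[OF g x] by (auto simp: cpositive_def)
    have "pos_comp D f g (adj D x \<otimes>\<^bsub>D\<^esub> x) = f (adj B c \<otimes>\<^bsub>B\<^esub> c)"
      using x D.adj_closed[OF x] by (simp add: pos_comp_def compose_def c(2))
    then show "cpositive A (pos_comp D f g (adj D x \<otimes>\<^bsub>D\<^esub> x))" using pos_mapsD(7)[OF f c(1)] by simp
  next
    show "pos_comp D f g \<one>\<^bsub>D\<^esub> = \<one>\<^bsub>A\<^esub>"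
      by (simp add: pos_comp_def compose_def pos_mapsD(6)[OF f] pos_mapsD(6)[OF g])
  qed
qed

lemma pos_comp_id:
  assumes f: "f \<in> pos_maps B A"
  shows "pos_comp B f (pos_id B) = f" "pos_comp B (pos_id A) f = f"
proof -
  have e: "f \<in> extensional (carrier B)" using pos_mapsD(1)[OF f] by (simp add: PiE_def)
  show "pos_comp B f (pos_id B) = f"
    by (rule extensionalityI[OF _ e]) (simp_all add: pos_comp_def compose_def pos_id_def)
  show "pos_comp B (pos_id A) f = f"
    by (rule extensionalityI[OF _ e]) (simp_all add: pos_comp_def compose_def pos_id_def pos_mapsD(2)[OF f])
qed

lemma pos_comp_assoc:
  assumes "k \<in> pos_maps E D"
  shows "pos_comp E (pos_comp D f g) k = pos_comp E f (pos_comp E g k)"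
  unfolding pos_comp_def compose_def by (rule restrict_ext) (simp add: pos_mapsD(2)[OF assms])

section \<open>The functor of continuous functions\<close>

lemma C_map_apply:
  "\<phi> \<in> carrier (C_obj Y) \<Longrightarrow> C_map X Y \<mu> \<phi> = (\<lambda>x\<in>topspace X. \<integral>y. \<phi> y \<partial>\<mu> x)"
  by (simp add: C_map_def)

lemma C_map_closed:
  assumes "\<mu> \<in> stoch X Y" "\<phi> \<in> carrier (C_obj Y)"
  shows "C_map X Y \<mu> \<phi> \<in> carrier (C_obj X)"
  unfolding C_map_apply[OF assms(2)] by (rule restrict_in_C_obj[OF stochD(3)[OF assms(1) C_objD[OF assms(2)]]])

lemma C_map_in_pos_maps:
  assumes X: "chaus X" and Y: "chaus Y" and \<mu>: "\<mu> \<in> stoch X Y"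
  shows "C_map X Y \<mu> \<in> pos_maps (C_obj Y) (C_obj X)"
proof -
  interpret CY: comm_cstar_algebra "C_obj Y" by (rule comm_cstar_algebra_C_obj[OF Y])
  note sp = prob_measD(1)[OF stochD(2)[OF \<mu>]]
  note int = integrable_continuous[OF Y stochD(2)[OF \<mu>] C_objD]
  show ?thesis
  proof (rule pos_mapsI[where K = 1])
    show "C_map X Y \<mu> \<in> carrier (C_obj Y) \<rightarrow>\<^sub>E carrier (C_obj X)"
      using C_map_closed[OF \<mu>] by (auto simp: C_map_def)
    fix \<phi> assume \<phi>: "\<phi> \<in> carrier (C_obj Y)"
    show "C_map X Y \<mu> (c \<odot>\<^bsub>C_obj Y\<^esub> \<phi>) = c \<odot>\<^bsub>C_obj X\<^esub> C_map X Y \<mu> \<phi>" for c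
    proof -
      have "C_map X Y \<mu> (c \<odot>\<^bsub>C_obj Y\<^esub> \<phi>) = (\<lambda>x\<in>topspace X. \<integral>y. (c \<odot>\<^bsub>C_obj Y\<^esub> \<phi>) y \<partial>\<mu> x)"
        using \<phi> by (intro C_map_apply CY.scale_closed)
      also have "\<dots> = (\<lambda>x\<in>topspace X. c * C_map X Y \<mu> \<phi> x)"
        using sp by (intro restrict_ext) (simp add: C_map_apply[OF \<phi>] integral_if_topspace)
      finally show ?thesis by (simp only: C_obj_simps)
    qed
    show "C_map X Y \<mu> (\<phi> \<oplus>\<^bsub>C_obj Y\<^esub> \<psi>) = C_map X Y \<mu> \<phi> \<oplus>\<^bsub>C_obj X\<^esub> C_map X Y \<mu> \<psi>" if \<psi>: "\<psi> \<in> carrier (C_obj Y)" for \<psi>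
    proof -
      have "C_map X Y \<mu> (\<phi> \<oplus>\<^bsub>C_obj Y\<^esub> \<psi>) = (\<lambda>x\<in>topspace X. \<integral>y. (\<phi> \<oplus>\<^bsub>C_obj Y\<^esub> \<psi>) y \<partial>\<mu> x)"
        using \<phi> \<psi> by (intro C_map_apply CY.add_closed)
      also have "\<dots> = (\<lambda>x\<in>topspace X. C_map X Y \<mu> \<phi> x + C_map X Y \<mu> \<psi> x)"
        using sp int[OF _ \<phi>] int[OF _ \<psi>]
        by (intro restrict_ext) (simp add: C_map_apply[OF \<phi>] C_map_apply[OF \<psi>] integral_if_topspace)
      finally show ?thesis by (simp only: C_obj_simps)
    qed
    show "cnorm (C_obj X) (C_map X Y \<mu> \<phi>) \<le> 1 * cnorm (C_obj Y) \<phi>"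
    proof (rule cnorm_C_obj_le[OF X])
      fix x assume x: "x \<in> topspace X"
      interpret prob_space "\<mu> x" by (rule prob_measD(3)[OF stochD(2)[OF \<mu> x]])
      have "cmod (\<integral>y. \<phi> y \<partial>\<mu> x) \<le> (\<integral>y. cmod (\<phi> y) \<partial>\<mu> x)" by (rule integral_norm_bound)
      also have "\<dots> \<le> (\<integral>y. cnorm (C_obj Y) \<phi> \<partial>\<mu> x)"
        using int[OF x \<phi>] cmod_le_cnorm_C_obj[OF Y \<phi>] sp[OF x] by (intro integral_mono) auto
      also have "\<dots> = cnorm (C_obj Y) \<phi>" by (simp add: prob_space)
      finally show "cmod (C_map X Y \<mu> \<phi> x) \<le> 1 * cnorm (C_obj Y) \<phi>" using x by (simp add: C_map_apply[OF \<phi>])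
    qed
    \<comment> \<open>The witness for positivity is the square root of the integral of
      \<open>cmod (\<phi> y)\<close> squared. It is continuous in \<open>x\<close> because
      \<open>\<mu>\<close> is vaguely continuous.\<close>
    let ?r = "\<lambda>x. \<integral>y. (cmod (\<phi> y))\<^sup>2 \<partial>\<mu> x"
    let ?c = "\<lambda>x\<in>topspace X. complex_of_real (sqrt (?r x))"
    have "continuous_map Y euclideanreal (\<lambda>y. (cmod (\<phi> y))\<^sup>2)"
      using C_objD[OF \<phi>]
      by (intro continuous_map_euclidean_compose[where g = "\<lambda>z. (cmod z)\<^sup>2"] continuous_intros)
    then have "continuous_map X euclideanreal ?r" by (rule stoch_continuous_real[OF \<mu>])
    then have "?c \<in> carrier (C_obj X)"
      by (intro restrict_in_C_obj continuous_map_euclidean_compose[where g = "\<lambda>t. complex_of_real (sqrt t)"] continuous_intros)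
    moreover have "C_map X Y \<mu> (adj (C_obj Y) \<phi> \<otimes>\<^bsub>C_obj Y\<^esub> \<phi>) = adj (C_obj X) ?c \<otimes>\<^bsub>C_obj X\<^esub> ?c"
    proof -
      have "C_map X Y \<mu> (adj (C_obj Y) \<phi> \<otimes>\<^bsub>C_obj Y\<^esub> \<phi>) = (\<lambda>x\<in>topspace X. \<integral>y. (adj (C_obj Y) \<phi> \<otimes>\<^bsub>C_obj Y\<^esub> \<phi>) y \<partial>\<mu> x)"
        using \<phi> CY.adj_closed by (intro C_map_apply CY.mult_closed)
      also have "\<dots> = (\<lambda>x\<in>topspace X. complex_of_real (?r x))"
      proof (rule restrict_ext)
        fix x assume x: "x \<in> topspace X"
        have "(\<integral>y. (adj (C_obj Y) \<phi> \<otimes>\<^bsub>C_obj Y\<^esub> \<phi>) y \<partial>\<mu> x) = (\<integral>y. complex_of_real ((cmod (\<phi> y))\<^sup>2) \<partial>\<mu> x)"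
          using sp[OF x] by (intro Bochner_Integration.integral_cong)
            (auto simp: complex_norm_square mult.commute simp flip: of_real_power)
        also have "\<dots> = complex_of_real (?r x)" by (rule integral_complex_of_real)
        finally show "(\<integral>y. (adj (C_obj Y) \<phi> \<otimes>\<^bsub>C_obj Y\<^esub> \<phi>) y \<partial>\<mu> x) = complex_of_real (?r x)" .
      qed
      also have "\<dots> = adj (C_obj X) ?c \<otimes>\<^bsub>C_obj X\<^esub> ?c"
        by (auto simp: fun_eq_iff restrict_def simp flip: of_real_mult)
      finally show ?thesis .
    qed
    ultimately show "cpositive (C_obj X) (C_map X Y \<mu> (adj (C_obj Y) \<phi> \<otimes>\<^bsub>C_obj Y\<^esub> \<phi>))"
      unfolding cpositive_def by blast
  next
    have "(\<integral>y. 1 \<partial>\<mu> x) = (1::complex)" if "x \<in> topspace X" for x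
      using prob_space.prob_space[OF prob_measD(3)[OF stochD(2)[OF \<mu> that]]] by simp
    then show "C_map X Y \<mu> \<one>\<^bsub>C_obj Y\<^esub> = \<one>\<^bsub>C_obj X\<^esub>"
      unfolding C_obj_simps C_map_apply[OF C_obj_const_closed]
      using sp by (intro restrict_ext) (simp add: integral_restrict_topspace)
  qed
qed

lemma C_map_id:
  assumes "chaus X"
  shows "C_map X X (stoch_id X) = pos_id (C_obj X)"
  unfolding C_map_def pos_id_def
proof (rule restrict_ext)
  fix \<phi> assume \<phi>: "\<phi> \<in> carrier (C_obj X)"
  have "(\<lambda>x\<in>topspace X. \<integral>y. \<phi> y \<partial>stoch_id X x) = restrict \<phi> (topspace X)"
    using integral_stoch_id[OF _ C_objD[OF \<phi>]] by (intro restrict_ext)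
  then show "(\<lambda>x\<in>topspace X. \<integral>y. \<phi> y \<partial>stoch_id X x) = \<phi>" by (simp add: restrict_C_obj[OF \<phi>])
qed

lemma C_map_comp:
  assumes Y: "chaus Y" and Z: "chaus Z" and \<mu>: "\<mu> \<in> stoch X Y" and \<nu>: "\<nu> \<in> stoch Y Z"
  shows "C_map X Z (stoch_comp X Z \<nu> \<mu>) = pos_comp (C_obj Z) (C_map X Y \<mu>) (C_map Y Z \<nu>)"
  unfolding C_map_def[of X Z] pos_comp_def compose_def
proof (rule restrict_ext)
  fix \<phi> assume \<phi>: "\<phi> \<in> carrier (C_obj Z)"
  have "C_map X Y \<mu> (C_map Y Z \<nu> \<phi>) = (\<lambda>x\<in>topspace X. \<integral>y. C_map Y Z \<nu> \<phi> y \<partial>\<mu> x)"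
    by (rule C_map_apply[OF C_map_closed[OF \<nu> \<phi>]])
  also have "\<dots> = (\<lambda>x\<in>topspace X. \<integral>z. \<phi> z \<partial>stoch_comp X Z \<nu> \<mu> x)"
    unfolding C_map_apply[OF \<phi>] using prob_measD(1)[OF stochD(2)[OF \<mu>]]
    by (intro restrict_ext) (simp add: integral_if_topspace integral_stoch_comp_complex[OF Y Z \<mu> \<nu> _ C_objD[OF \<phi>]])
  finally show "(\<lambda>x\<in>topspace X. \<integral>z. \<phi> z \<partial>stoch_comp X Z \<nu> \<mu> x) = C_map X Y \<mu> (C_map Y Z \<nu> \<phi>)" by (rule sym)
qed

section \<open>The stochastic spectrum\<close>

context comm_cstar_algebra
begin

lemma Gelfand_apply: "a \<in> carrier A \<Longrightarrow> Gelfand A a = (\<lambda>\<omega>\<in>topspace (spec_obj A). \<omega> a)"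
  by (simp add: Gelfand_def)

lemma Gelfand_closed:
  assumes "a \<in> carrier A"
  shows "Gelfand A a \<in> carrier (C_obj (spec_obj A))"
  unfolding Gelfand_apply[OF assms] by (rule restrict_in_C_obj[OF continuous_map_eval])

text \<open>The choice is unique: \<open>Gelfand_surj\<close> gives existence, and
  \<open>characters_separate\<close> leaves one candidate.\<close>

definition gelfand_inv :: "(('a \<Rightarrow> complex) \<Rightarrow> complex) \<Rightarrow> 'a" where
  "gelfand_inv \<phi> = (SOME a. a \<in> carrier A \<and> (\<forall>\<omega>\<in>characters A. \<omega> a = \<phi> \<omega>))"

lemma
  assumes "\<phi> \<in> carrier (C_obj (spec_obj A))"
  shows gelfand_inv_closed: "gelfand_inv \<phi> \<in> carrier A"
    and character_gelfand_inv: "\<omega> \<in> characters A \<Longrightarrow> \<omega> (gelfand_inv \<phi>) = \<phi> \<omega>"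
proof -
  obtain a where "a \<in> carrier A" "\<And>\<omega>. \<omega> \<in> characters A \<Longrightarrow> \<omega> a = \<phi> \<omega>"
    using Gelfand_surj[OF C_objD[OF assms]] by blast
  then have "\<exists>a. a \<in> carrier A \<and> (\<forall>\<omega>\<in>characters A. \<omega> a = \<phi> \<omega>)" by blast
  from someI_ex[OF this] show "gelfand_inv \<phi> \<in> carrier A" "\<omega> \<in> characters A \<Longrightarrow> \<omega> (gelfand_inv \<phi>) = \<phi> \<omega>"
    unfolding gelfand_inv_def by blast+
qed

lemma gelfand_inv_eqI:
  assumes "\<phi> \<in> carrier (C_obj (spec_obj A))" "a \<in> carrier A" "\<And>\<omega>. \<omega> \<in> characters A \<Longrightarrow> \<omega> a = \<phi> \<omega>"
  shows "gelfand_inv \<phi> = a"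
  using assms by (intro characters_separate) (auto simp: gelfand_inv_closed character_gelfand_inv)

lemma gelfand_inv_Gelfand: "a \<in> carrier A \<Longrightarrow> gelfand_inv (Gelfand A a) = a"
  by (intro gelfand_inv_eqI Gelfand_closed) (simp_all add: Gelfand_apply)

lemma Gelfand_gelfand_inv:
  assumes "\<phi> \<in> carrier (C_obj (spec_obj A))"
  shows "Gelfand A (gelfand_inv \<phi>) = \<phi>"
  using assms
  by (intro C_obj_eqI[OF Gelfand_closed]) (simp_all add: gelfand_inv_closed Gelfand_apply character_gelfand_inv)

lemma
  assumes \<phi>: "\<phi> \<in> carrier (C_obj (spec_obj A))" and \<psi>: "\<psi> \<in> carrier (C_obj (spec_obj A))"
  shows gelfand_inv_add: "gelfand_inv (\<phi> \<oplus>\<^bsub>C_obj (spec_obj A)\<^esub> \<psi>) = gelfand_inv \<phi> \<oplus>\<^bsub>A\<^esub> gelfand_inv \<psi>"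
    and gelfand_inv_mult: "gelfand_inv (\<phi> \<otimes>\<^bsub>C_obj (spec_obj A)\<^esub> \<psi>) = gelfand_inv \<phi> \<otimes>\<^bsub>A\<^esub> gelfand_inv \<psi>"
    and gelfand_inv_scale: "gelfand_inv (c \<odot>\<^bsub>C_obj (spec_obj A)\<^esub> \<phi>) = c \<odot>\<^bsub>A\<^esub> gelfand_inv \<phi>"
    and gelfand_inv_adj: "gelfand_inv (adj (C_obj (spec_obj A)) \<phi>) = adj A (gelfand_inv \<phi>)"
proof -
  interpret C: comm_cstar_algebra "C_obj (spec_obj A)" by (rule comm_cstar_algebra_C_obj[OF chaus_spec_obj])
  note [simp] = gelfand_inv_closed[OF \<phi>] gelfand_inv_closed[OF \<psi>] adj_closed
  note s = charactersD(2-4) character_adj character_gelfand_inv[OF \<phi>] character_gelfand_inv[OF \<psi>]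
  show "gelfand_inv (\<phi> \<oplus>\<^bsub>C_obj (spec_obj A)\<^esub> \<psi>) = gelfand_inv \<phi> \<oplus>\<^bsub>A\<^esub> gelfand_inv \<psi>"
    by (rule gelfand_inv_eqI[OF C.add_closed[OF \<phi> \<psi>]]) (simp_all add: s)
  show "gelfand_inv (\<phi> \<otimes>\<^bsub>C_obj (spec_obj A)\<^esub> \<psi>) = gelfand_inv \<phi> \<otimes>\<^bsub>A\<^esub> gelfand_inv \<psi>"
    by (rule gelfand_inv_eqI[OF C.mult_closed[OF \<phi> \<psi>]]) (simp_all add: s)
  show "gelfand_inv (c \<odot>\<^bsub>C_obj (spec_obj A)\<^esub> \<phi>) = c \<odot>\<^bsub>A\<^esub> gelfand_inv \<phi>"
    by (rule gelfand_inv_eqI[OF C.scale_closed[OF \<phi>]]) (simp_all add: s)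
  show "gelfand_inv (adj (C_obj (spec_obj A)) \<phi>) = adj A (gelfand_inv \<phi>)"
    by (rule gelfand_inv_eqI[OF C.adj_closed[OF \<phi>]]) (simp_all add: s)
qed

lemma gelfand_inv_one: "gelfand_inv \<one>\<^bsub>C_obj (spec_obj A)\<^esub> = \<one>\<^bsub>A\<^esub>"
proof -
  interpret C: comm_cstar_algebra "C_obj (spec_obj A)" by (rule comm_cstar_algebra_C_obj[OF chaus_spec_obj])
  show ?thesis by (rule gelfand_inv_eqI[OF C.one_closed_A]) (simp_all add: character_one)
qed

lemma integral_eval_gelfand_inv:
  assumes M: "M \<in> prob_meas (spec_obj A)" and \<phi>: "\<phi> \<in> carrier (C_obj (spec_obj A))"
  shows "(\<integral>\<psi>. \<phi> \<psi> \<partial>M) = (\<integral>\<psi>. \<psi> (gelfand_inv \<phi>) \<partial>M)"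
  using prob_measD(1)[OF M] character_gelfand_inv[OF \<phi>]
  by (intro Bochner_Integration.integral_cong) auto

text \<open>Every continuous function on the spectrum is an evaluation, so evaluations are enough to
  distinguish regular measures. This gives the uniqueness behind the \<open>THE\<close> in
  \<open>spec_map\<close>.\<close>

lemma prob_meas_spec_eqI:
  assumes "M \<in> prob_meas (spec_obj A)" "N \<in> prob_meas (spec_obj A)"
    and "\<And>a. a \<in> carrier A \<Longrightarrow> (\<integral>\<psi>. \<psi> a \<partial>M) = (\<integral>\<psi>. \<psi> a \<partial>N)"
  shows "M = N"
  using assms gelfand_inv_closed
  by (intro prob_meas_eqI_C_obj[OF chaus_spec_obj]) (auto simp: integral_eval_gelfand_inv)

text \<open>The functional is moved to the spectrum by \<open>gelfand_inv\<close>, which respects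
  products and adjoints and so carries positivity along; then \<open>complex_riesz\<close>
  applies.\<close>

lemma state_representation:
  assumes add: "\<And>a b. a \<in> carrier A \<Longrightarrow> b \<in> carrier A \<Longrightarrow> s (a \<oplus>\<^bsub>A\<^esub> b) = s a + s b"
    and scale: "\<And>c a. a \<in> carrier A \<Longrightarrow> s (c \<odot>\<^bsub>A\<^esub> a) = c * s a"
    and one: "s \<one>\<^bsub>A\<^esub> = 1"
    and pos: "\<And>a. a \<in> carrier A \<Longrightarrow> \<exists>r\<ge>0. s (adj A a \<otimes>\<^bsub>A\<^esub> a) = complex_of_real r"
  obtains M where "M \<in> prob_meas (spec_obj A)" "\<And>a. a \<in> carrier A \<Longrightarrow> (\<integral>\<psi>. \<psi> a \<partial>M) = s a"
proof -
  interpret C: comm_cstar_algebra "C_obj (spec_obj A)" by (rule comm_cstar_algebra_C_obj[OF chaus_spec_obj])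
  have "\<exists>M\<in>prob_meas (spec_obj A). \<forall>\<phi>\<in>carrier (C_obj (spec_obj A)). (\<integral>\<psi>. \<phi> \<psi> \<partial>M) = s (gelfand_inv \<phi>)"
  proof (rule complex_riesz[OF chaus_spec_obj, of "\<lambda>\<phi>. s (gelfand_inv \<phi>)"])
    fix \<phi> assume \<phi>: "\<phi> \<in> carrier (C_obj (spec_obj A))"
    show "s (gelfand_inv (c \<odot>\<^bsub>C_obj (spec_obj A)\<^esub> \<phi>)) = c * s (gelfand_inv \<phi>)" for c
      using scale[OF gelfand_inv_closed[OF \<phi>]] unfolding gelfand_inv_scale[OF \<phi> \<phi>] .
    show "\<exists>r\<ge>0. s (gelfand_inv (adj (C_obj (spec_obj A)) \<phi> \<otimes>\<^bsub>C_obj (spec_obj A)\<^esub> \<phi>)) = complex_of_real r"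
      using pos[OF gelfand_inv_closed[OF \<phi>]]
      unfolding gelfand_inv_mult[OF C.adj_closed[OF \<phi>] \<phi>] gelfand_inv_adj[OF \<phi> \<phi>] .
    fix \<psi> assume \<psi>: "\<psi> \<in> carrier (C_obj (spec_obj A))"
    show "s (gelfand_inv (\<phi> \<oplus>\<^bsub>C_obj (spec_obj A)\<^esub> \<psi>)) = s (gelfand_inv \<phi>) + s (gelfand_inv \<psi>)"
      using add[OF gelfand_inv_closed[OF \<phi>] gelfand_inv_closed[OF \<psi>]] unfolding gelfand_inv_add[OF \<phi> \<psi>] .
  next
    show "s (gelfand_inv \<one>\<^bsub>C_obj (spec_obj A)\<^esub>) = 1" unfolding gelfand_inv_one by (rule one)
  qed blast
  then obtain M where M: "M \<in> prob_meas (spec_obj A)"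
    "\<And>\<phi>. \<phi> \<in> carrier (C_obj (spec_obj A)) \<Longrightarrow> (\<integral>\<psi>. \<phi> \<psi> \<partial>M) = s (gelfand_inv \<phi>)" by blast
  have "(\<integral>\<psi>. \<psi> a \<partial>M) = s a" if "a \<in> carrier A" for a
    using M(2)[OF Gelfand_closed[OF that]] integral_eval_gelfand_inv[OF M(1) Gelfand_closed[OF that]]
    by (simp add: gelfand_inv_Gelfand[OF that])
  then show ?thesis using that M(1) by blast
qed

lemma stoch_spec_eqI:
  assumes "\<mu> \<in> stoch X (spec_obj A)" "\<nu> \<in> stoch X (spec_obj A)"
    and eq: "\<And>x a. x \<in> topspace X \<Longrightarrow> a \<in> carrier A \<Longrightarrow> (\<integral>\<psi>. \<psi> a \<partial>\<mu> x) = (\<integral>\<psi>. \<psi> a \<partial>\<nu> x)"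
  shows "\<mu> = \<nu>"
  using stochD(1)[OF assms(1)] stochD(1)[OF assms(2)]
proof (rule extensionalityI)
  fix x assume x: "x \<in> topspace X"
  show "\<mu> x = \<nu> x"
    by (rule prob_meas_spec_eqI[OF stochD(2)[OF assms(1) x] stochD(2)[OF assms(2) x] eq[OF x]])
qed

lemma stoch_specI:
  assumes "\<mu> \<in> extensional (topspace X)"
    and pm: "\<And>x. x \<in> topspace X \<Longrightarrow> \<mu> x \<in> prob_meas (spec_obj A)"
    and c: "\<And>a. a \<in> carrier A \<Longrightarrow> continuous_map X euclidean (\<lambda>x. \<integral>\<psi>. \<psi> a \<partial>\<mu> x)"
  shows "\<mu> \<in> stoch X (spec_obj A)"
proof (rule stochI_C_obj[OF assms(1) pm])
  fix \<phi> assume \<phi>: "\<phi> \<in> carrier (C_obj (spec_obj A))"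
  show "continuous_map X euclidean (\<lambda>x. \<integral>\<psi>. \<phi> \<psi> \<partial>\<mu> x)"
    by (rule continuous_map_eq[OF c[OF gelfand_inv_closed[OF \<phi>]]])
       (rule integral_eval_gelfand_inv[OF pm \<phi>, symmetric])
qed

end

section \<open>Representing measures and functoriality of the spectrum\<close>

context
  fixes A :: "'a cstar_algebra" and B :: "'b cstar_algebra" and f
  assumes A: "comm_cstar_algebra A" and B: "comm_cstar_algebra B" and f: "f \<in> pos_maps B A"
begin

text \<open>A character of an adjoint times its element is a squared modulus, so the character after
  \<open>f\<close> is positive on squares and has a representing measure.\<close>

lemma represents_unique:
  assumes \<omega>: "\<omega> \<in> characters A"
  shows "\<exists>!M. represents B f \<omega> M"
proof -
  interpret A: comm_cstar_algebra A by (rule A)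
  interpret B: comm_cstar_algebra B by (rule B)
  note \<Omega> = A.charactersD[OF \<omega>]
  obtain M where "M \<in> prob_meas (spec_obj B)" "\<And>b. b \<in> carrier B \<Longrightarrow> (\<integral>\<psi>. \<psi> b \<partial>M) = \<omega> (f b)"
  proof (rule B.state_representation[of "\<lambda>b. \<omega> (f b)"])
    fix b assume b: "b \<in> carrier B"
    note fb = pos_mapsD(2)[OF f b]
    show "\<omega> (f (c \<odot>\<^bsub>B\<^esub> b)) = c * \<omega> (f b)" for c by (simp add: pos_mapsD(4)[OF f b] \<Omega>(3)[OF fb])
    show "\<omega> (f (b \<oplus>\<^bsub>B\<^esub> b')) = \<omega> (f b) + \<omega> (f b')" if "b' \<in> carrier B" for b'
      by (simp add: pos_mapsD(3)[OF f b that] \<Omega>(2)[OF fb pos_mapsD(2)[OF f that]])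
    obtain c where c: "c \<in> carrier A" "f (adj B b \<otimes>\<^bsub>B\<^esub> b) = adj A c \<otimes>\<^bsub>A\<^esub> c"
      using pos_mapsD(7)[OF f b] by (auto simp: cpositive_def)
    have "\<omega> (f (adj B b \<otimes>\<^bsub>B\<^esub> b)) = cnj (\<omega> c) * \<omega> c"
      using c A.adj_closed[OF c(1)] by (simp add: \<Omega>(4) A.character_adj[OF \<omega>])
    also have "\<dots> = complex_of_real ((cmod (\<omega> c))\<^sup>2)" by (simp only: complex_norm_square mult.commute)
    finally show "\<exists>r\<ge>0. \<omega> (f (adj B b \<otimes>\<^bsub>B\<^esub> b)) = complex_of_real r"
      by (intro exI[of _ "(cmod (\<omega> c))\<^sup>2"]) simp
  next
    show "\<omega> (f \<one>\<^bsub>B\<^esub>) = 1" by (simp add: pos_mapsD(6)[OF f] A.character_one[OF \<omega>])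
  qed blast
  then have "represents B f \<omega> M" by (simp add: represents_def)
  moreover have "N = M" if "represents B f \<omega> N" for N
    using that \<open>represents B f \<omega> M\<close> by (intro B.prob_meas_spec_eqI) (auto simp: represents_def)
  ultimately show ?thesis by blast
qed

lemma spec_map_represents:
  "\<omega> \<in> characters A \<Longrightarrow> represents B f \<omega> (spec_map B A f \<omega>)"
  using theI'[OF represents_unique] by (simp add: spec_map_def)

lemma integral_spec_map:
  "\<lbrakk>\<omega> \<in> characters A; b \<in> carrier B\<rbrakk> \<Longrightarrow> (\<integral>\<psi>. \<psi> b \<partial>spec_map B A f \<omega>) = \<omega> (f b)"
  using spec_map_represents by (simp add: represents_def)

lemma spec_map_in_stoch: "spec_map B A f \<in> stoch (spec_obj A) (spec_obj B)"
proof -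
  interpret B: comm_cstar_algebra B by (rule B)
  show ?thesis
  proof (rule B.stoch_specI)
    show "spec_map B A f \<in> extensional (topspace (spec_obj A))" by (simp add: spec_map_def)
    show "spec_map B A f \<omega> \<in> prob_meas (spec_obj B)" if "\<omega> \<in> topspace (spec_obj A)" for \<omega>
      using spec_map_represents that by (simp add: represents_def)
    fix b assume b: "b \<in> carrier B"
    show "continuous_map (spec_obj A) euclidean (\<lambda>\<omega>. \<integral>\<psi>. \<psi> b \<partial>spec_map B A f \<omega>)"
      by (rule continuous_map_eq[OF continuous_map_eval[of A "f b"]]) (simp add: integral_spec_map b)
  qed
qed

end

lemma spec_map_id:
  assumes A: "comm_cstar_algebra A"
  shows "spec_map A A (pos_id A) = stoch_id (spec_obj A)"
proof -
  interpret comm_cstar_algebra A by (rule A)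
  note p = pos_id_in_pos_maps[OF A]
  show ?thesis
  proof (rule stoch_spec_eqI[OF spec_map_in_stoch[OF A A p] stoch_id_in_stoch[OF chaus_spec_obj]])
    fix \<omega> a assume "\<omega> \<in> topspace (spec_obj A)" "a \<in> carrier A"
    then show "(\<integral>\<psi>. \<psi> a \<partial>spec_map A A (pos_id A) \<omega>) = (\<integral>\<psi>. \<psi> a \<partial>stoch_id (spec_obj A) \<omega>)"
      using integral_spec_map[OF A A p, of \<omega> a] integral_stoch_id[OF _ continuous_map_eval, of \<omega> A a]
      by (simp add: pos_id_def)
  qed
qed

lemma spec_map_comp:
  assumes A: "comm_cstar_algebra A" and B: "comm_cstar_algebra B" and D: "comm_cstar_algebra D"
    and f: "f \<in> pos_maps B A" and g: "g \<in> pos_maps D B"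
  shows "spec_map D A (pos_comp D f g) = stoch_comp (spec_obj A) (spec_obj D) (spec_map D B g) (spec_map B A f)"
proof -
  interpret A: comm_cstar_algebra A by (rule A)
  interpret B: comm_cstar_algebra B by (rule B)
  interpret D: comm_cstar_algebra D by (rule D)
  note fg = pos_comp_in_pos_maps[OF A B D f g]
  note sf = spec_map_in_stoch[OF A B f] and sg = spec_map_in_stoch[OF B D g]
  show ?thesis
  proof (rule D.stoch_spec_eqI[OF spec_map_in_stoch[OF A D fg]
        stoch_comp_in_stoch[OF B.chaus_spec_obj D.chaus_spec_obj sf sg]])
    fix \<omega> d assume \<omega>: "\<omega> \<in> topspace (spec_obj A)" and d: "d \<in> carrier D"
    have "(\<integral>\<psi>. \<psi> d \<partial>stoch_comp (spec_obj A) (spec_obj D) (spec_map D B g) (spec_map B A f) \<omega>)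
        = (\<integral>\<theta>. (\<integral>\<psi>. \<psi> d \<partial>spec_map D B g \<theta>) \<partial>spec_map B A f \<omega>)"
      by (rule integral_stoch_comp_complex[OF B.chaus_spec_obj D.chaus_spec_obj sf sg \<omega> continuous_map_eval])
    \<comment> \<open>The inner integral is again an evaluation, now at \<open>g d\<close>, so the
      defining equation of the other spectrum map applies to it.\<close>
    also have "\<dots> = (\<integral>\<theta>. \<theta> (g d) \<partial>spec_map B A f \<omega>)"
      using prob_measD(1)[OF stochD(2)[OF sf \<omega>]] d
      by (intro Bochner_Integration.integral_cong) (auto simp: integral_spec_map[OF B D g])
    also have "\<dots> = \<omega> (f (g d))"
      using integral_spec_map[OF A B f, of \<omega> "g d"] \<omega> pos_mapsD(2)[OF g d] by simp
    finally show "(\<integral>\<psi>. \<psi> d \<partial>spec_map D A (pos_comp D f g) \<omega>)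
        = (\<integral>\<psi>. \<psi> d \<partial>stoch_comp (spec_obj A) (spec_obj D) (spec_map D B g) (spec_map B A f) \<omega>)"
      using integral_spec_map[OF A D fg, of \<omega> d] \<omega> d by (simp add: pos_comp_def compose_def)
  qed
qed

section \<open>The natural isomorphisms\<close>

context
  fixes X :: "'x topology"
  assumes X: "chaus X"
begin

lemma h_fun_character:
  assumes x: "x \<in> topspace X"
  shows "h_fun X x \<in> characters (C_obj X)"
proof -
  interpret C: comm_cstar_algebra "C_obj X" by (rule comm_cstar_algebra_C_obj[OF X])
  show ?thesis
  proof (rule C.charactersI)
    show "h_fun X x \<in> extensional (carrier (C_obj X))" by (simp add: h_fun_def)
    fix \<phi> assume \<phi>: "\<phi> \<in> carrier (C_obj X)"
    show "cmod (h_fun X x \<phi>) \<le> cnorm (C_obj X) \<phi>"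
      using cmod_le_cnorm_C_obj[OF X \<phi> x] \<phi> by (simp add: h_fun_def)
    show "h_fun X x (c \<odot>\<^bsub>C_obj X\<^esub> \<phi>) = c * h_fun X x \<phi>" for c
      using C.scale_closed[OF \<phi>, of c] \<phi> x by (simp add: h_fun_def)
    fix \<psi> assume \<psi>: "\<psi> \<in> carrier (C_obj X)"
    show "h_fun X x (\<phi> \<oplus>\<^bsub>C_obj X\<^esub> \<psi>) = h_fun X x \<phi> + h_fun X x \<psi>"
      using C.add_closed[OF \<phi> \<psi>] \<phi> \<psi> x by (simp add: h_fun_def)
    show "h_fun X x (\<phi> \<otimes>\<^bsub>C_obj X\<^esub> \<psi>) = h_fun X x \<phi> * h_fun X x \<psi>"
      using C.mult_closed[OF \<phi> \<psi>] \<phi> \<psi> x by (simp add: h_fun_def)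
  next
    show "h_fun X x \<one>\<^bsub>C_obj X\<^esub> = 1" using C.one_closed_A x by (simp add: h_fun_def)
  qed
qed

lemma continuous_map_h_fun: "continuous_map X (spec_obj (C_obj X)) (h_fun X)"
proof (rule continuous_map_into_spec_obj)
  show "h_fun X \<in> topspace X \<rightarrow> characters (C_obj X)" using h_fun_character by blast
  show "continuous_map X euclidean (\<lambda>x. h_fun X x \<phi>)" if "\<phi> \<in> carrier (C_obj X)" for \<phi>
    using C_objD[OF that] that by (simp add: h_fun_def)
qed

lemma chaus_spec_C_obj: "chaus (spec_obj (C_obj X))"
  using comm_cstar_algebra.chaus_spec_obj[OF comm_cstar_algebra_C_obj[OF X]] .

lemma h_map_in_stoch: "h_map X \<in> stoch X (spec_obj (C_obj X))"
  unfolding h_map_def by (rule dirac_map_in_stoch[OF chaus_spec_C_obj continuous_map_h_fun])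

lemma integral_h_map:
  "\<lbrakk>x \<in> topspace X; continuous_map (spec_obj (C_obj X)) euclidean \<Phi>\<rbrakk>
    \<Longrightarrow> (\<integral>\<omega>. \<Phi> \<omega> \<partial>h_map X x) = (\<Phi> (h_fun X x) :: complex)"
  unfolding h_map_def by (rule integral_dirac_map[OF continuous_map_h_fun])

text \<open>The inverse of \<open>h\<close> sends a character of \<open>C X\<close> to the measure on \<open>X\<close> representing it.\<close>

lemma stoch_iso_h_map: "stoch_iso X (spec_obj (C_obj X)) (h_map X)"
proof -
  interpret C: comm_cstar_algebra "C_obj X" by (rule comm_cstar_algebra_C_obj[OF X])
  let ?S = "spec_obj (C_obj X)"
  have "\<exists>M\<in>prob_meas X. \<forall>\<phi>\<in>carrier (C_obj X). (\<integral>x. \<phi> x \<partial>M) = \<omega> \<phi>" if \<omega>: "\<omega> \<in> characters (C_obj X)" for \<omega>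
  proof (rule complex_riesz[OF X, of \<omega>])
    note \<Omega> = C.charactersD[OF \<omega>]
    fix \<phi> assume \<phi>: "\<phi> \<in> carrier (C_obj X)"
    show "\<omega> (c \<odot>\<^bsub>C_obj X\<^esub> \<phi>) = c * \<omega> \<phi>" for c by (rule \<Omega>(3)[OF \<phi>])
    have "\<omega> (adj (C_obj X) \<phi> \<otimes>\<^bsub>C_obj X\<^esub> \<phi>) = cnj (\<omega> \<phi>) * \<omega> \<phi>"
      using \<Omega>(4)[OF C.adj_closed[OF \<phi>] \<phi>] C.character_adj[OF \<omega> \<phi>] by simp
    also have "\<dots> = complex_of_real ((cmod (\<omega> \<phi>))\<^sup>2)" by (simp only: complex_norm_square mult.commute)
    finally show "\<exists>r\<ge>0. \<omega> (adj (C_obj X) \<phi> \<otimes>\<^bsub>C_obj X\<^esub> \<phi>) = complex_of_real r"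
      by (intro exI[of _ "(cmod (\<omega> \<phi>))\<^sup>2"]) simp
    show "\<omega> (\<phi> \<oplus>\<^bsub>C_obj X\<^esub> \<psi>) = \<omega> \<phi> + \<omega> \<psi>" if "\<psi> \<in> carrier (C_obj X)" for \<psi> by (rule \<Omega>(2)[OF \<phi> that])
  next
    show "\<omega> \<one>\<^bsub>C_obj X\<^esub> = 1" by (rule C.character_one[OF \<omega>])
  qed blast
  then obtain k where k: "\<And>\<omega>. \<omega> \<in> characters (C_obj X) \<Longrightarrow> k \<omega> \<in> prob_meas X"
    "\<And>\<omega> \<phi>. \<omega> \<in> characters (C_obj X) \<Longrightarrow> \<phi> \<in> carrier (C_obj X) \<Longrightarrow> (\<integral>x. \<phi> x \<partial>k \<omega>) = \<omega> \<phi>"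
    by metis
  let ?k = "restrict k (topspace ?S)"
  \<comment> \<open>Continuity is immediate: integrating \<open>\<phi>\<close> against
    \<open>k \<omega>\<close> gives the evaluation \<open>\<omega> \<phi>\<close>. The inverse only
    has to be a stochastic map; that every character is a point evaluation is not established
    first.\<close>
  have ks: "?k \<in> stoch ?S X"
  proof (rule stochI_C_obj)
    show "?k \<omega> \<in> prob_meas X" if "\<omega> \<in> topspace ?S" for \<omega> using k(1) that by simp
    fix \<phi> assume "\<phi> \<in> carrier (C_obj X)"
    then show "continuous_map ?S euclidean (\<lambda>\<omega>. \<integral>x. \<phi> x \<partial>?k \<omega>)"
      by (intro continuous_map_eq[OF continuous_map_eval[of "C_obj X" \<phi>]]) (simp add: k(2))
  qed simp
  have "stoch_comp X X ?k (h_map X) = stoch_id X"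
  proof (rule stoch_eqI_C_obj[OF X stoch_comp_in_stoch[OF chaus_spec_C_obj X h_map_in_stoch ks] stoch_id_in_stoch[OF X]])
    fix x \<phi> assume x: "x \<in> topspace X" and \<phi>: "\<phi> \<in> carrier (C_obj X)"
    have "(\<integral>y. \<phi> y \<partial>stoch_comp X X ?k (h_map X) x) = (\<integral>\<omega>. (\<integral>y. \<phi> y \<partial>?k \<omega>) \<partial>h_map X x)"
      by (rule integral_stoch_comp_complex[OF chaus_spec_C_obj X h_map_in_stoch ks x C_objD[OF \<phi>]])
    also have "\<dots> = (\<integral>y. \<phi> y \<partial>?k (h_fun X x))"
      by (rule integral_h_map[OF x stochD(3)[OF ks C_objD[OF \<phi>]]])
    also have "\<dots> = \<phi> x" using k(2)[OF h_fun_character[OF x] \<phi>] h_fun_character[OF x] \<phi> by (simp add: h_fun_def)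
    finally show "(\<integral>y. \<phi> y \<partial>stoch_comp X X ?k (h_map X) x) = (\<integral>y. \<phi> y \<partial>stoch_id X x)"
      by (simp add: integral_stoch_id[OF x C_objD[OF \<phi>]])
  qed
  moreover have "stoch_comp ?S ?S (h_map X) ?k = stoch_id ?S"
  proof (rule C.stoch_spec_eqI[OF stoch_comp_in_stoch[OF X chaus_spec_C_obj ks h_map_in_stoch] stoch_id_in_stoch[OF chaus_spec_C_obj]])
    fix \<omega> \<phi> assume \<omega>: "\<omega> \<in> topspace ?S" and \<phi>: "\<phi> \<in> carrier (C_obj X)"
    have "(\<integral>\<psi>. \<psi> \<phi> \<partial>stoch_comp ?S ?S (h_map X) ?k \<omega>) = (\<integral>x. (\<integral>\<psi>. \<psi> \<phi> \<partial>h_map X x) \<partial>?k \<omega>)"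
      by (rule integral_stoch_comp_complex[OF X chaus_spec_C_obj ks h_map_in_stoch \<omega> continuous_map_eval])
    also have "\<dots> = (\<integral>x. \<phi> x \<partial>?k \<omega>)"
      using prob_measD(1)[OF stochD(2)[OF ks \<omega>]] \<phi>
      by (intro Bochner_Integration.integral_cong) (auto simp: integral_h_map[OF _ continuous_map_eval] h_fun_def)
    also have "\<dots> = \<omega> \<phi>" using k(2) \<omega> \<phi> by simp
    finally show "(\<integral>\<psi>. \<psi> \<phi> \<partial>stoch_comp ?S ?S (h_map X) ?k \<omega>) = (\<integral>\<psi>. \<psi> \<phi> \<partial>stoch_id ?S \<omega>)"
      by (simp add: integral_stoch_id[OF \<omega> continuous_map_eval])
  qed
  ultimately show ?thesis unfolding stoch_iso_def using h_map_in_stoch ks by blast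
qed

text \<open>Integration against a Dirac measure is evaluation at its point, and evaluating a Gelfand
  transform at \<open>h_fun X x\<close> gives back the value at \<open>x\<close>.\<close>

lemma C_map_h_map_Gelfand:
  "pos_comp (C_obj X) (C_map X (spec_obj (C_obj X)) (h_map X)) (Gelfand (C_obj X)) = pos_id (C_obj X)"
  unfolding pos_comp_def compose_def pos_id_def
proof (rule restrict_ext)
  interpret C: comm_cstar_algebra "C_obj X" by (rule comm_cstar_algebra_C_obj[OF X])
  fix \<phi> assume \<phi>: "\<phi> \<in> carrier (C_obj X)"
  have "(\<integral>\<omega>. Gelfand (C_obj X) \<phi> \<omega> \<partial>h_map X x) = \<phi> x" if x: "x \<in> topspace X" for x
    using integral_h_map[OF x C_objD[OF C.Gelfand_closed[OF \<phi>]]] h_fun_character[OF x] \<phi>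
    by (simp add: C.Gelfand_apply h_fun_def)
  then have "C_map X (spec_obj (C_obj X)) (h_map X) (Gelfand (C_obj X) \<phi>) = restrict \<phi> (topspace X)"
    unfolding C_map_apply[OF C.Gelfand_closed[OF \<phi>]] by (rule restrict_ext)
  then show "C_map X (spec_obj (C_obj X)) (h_map X) (Gelfand (C_obj X) \<phi>) = \<phi>" by (simp add: restrict_C_obj[OF \<phi>])
qed

end

text \<open>On the evaluation at \<open>\<phi>\<close> both composites give the integral of
  \<open>\<phi>\<close> against \<open>\<mu> x\<close>: one by the defining equation of the spectrum
  map, the other because \<open>h\<close> consists of Dirac measures.\<close>

lemma h_map_natural:
  assumes X: "chaus X" and Y: "chaus Y" and \<mu>: "\<mu> \<in> stoch X Y"
  shows "stoch_comp X (spec_obj (C_obj Y)) (spec_map (C_obj Y) (C_obj X) (C_map X Y \<mu>)) (h_map X)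
    = stoch_comp X (spec_obj (C_obj Y)) (h_map Y) \<mu>"
proof -
  interpret C: comm_cstar_algebra "C_obj Y" by (rule comm_cstar_algebra_C_obj[OF Y])
  note CX = comm_cstar_algebra_C_obj[OF X] and CY = comm_cstar_algebra_C_obj[OF Y]
  note cX = chaus_spec_C_obj[OF X] and cY = chaus_spec_C_obj[OF Y]
  note hX = h_map_in_stoch[OF X] and hY = h_map_in_stoch[OF Y]
  note p = C_map_in_pos_maps[OF X Y \<mu>]
  note s = spec_map_in_stoch[OF CX CY p]
  let ?s = "spec_map (C_obj Y) (C_obj X) (C_map X Y \<mu>)"
  show ?thesis
  proof (rule C.stoch_spec_eqI[OF stoch_comp_in_stoch[OF cX cY hX s] stoch_comp_in_stoch[OF Y cY \<mu> hY]])
    fix x \<phi> assume x: "x \<in> topspace X" and \<phi>: "\<phi> \<in> carrier (C_obj Y)"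
    have "(\<integral>\<psi>. \<psi> \<phi> \<partial>stoch_comp X (spec_obj (C_obj Y)) ?s (h_map X) x) = (\<integral>\<omega>. (\<integral>\<psi>. \<psi> \<phi> \<partial>?s \<omega>) \<partial>h_map X x)"
      by (rule integral_stoch_comp_complex[OF cX cY hX s x continuous_map_eval])
    also have "\<dots> = (\<integral>\<psi>. \<psi> \<phi> \<partial>?s (h_fun X x))"
      by (rule integral_h_map[OF X x stochD(3)[OF s continuous_map_eval]])
    also have "\<dots> = h_fun X x (C_map X Y \<mu> \<phi>)"
      by (rule integral_spec_map[OF CX CY p h_fun_character[OF X x] \<phi>])
    also have "\<dots> = (\<integral>y. \<phi> y \<partial>\<mu> x)"
      using C_map_closed[OF \<mu> \<phi>] x by (simp add: h_fun_def C_map_apply[OF \<phi>])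
    also have "\<dots> = (\<integral>y. (\<integral>\<psi>. \<psi> \<phi> \<partial>h_map Y y) \<partial>\<mu> x)"
      using prob_measD(1)[OF stochD(2)[OF \<mu> x]] \<phi>
      by (intro Bochner_Integration.integral_cong) (auto simp: integral_h_map[OF Y _ continuous_map_eval] h_fun_def)
    also have "\<dots> = (\<integral>\<psi>. \<psi> \<phi> \<partial>stoch_comp X (spec_obj (C_obj Y)) (h_map Y) \<mu> x)"
      by (rule integral_stoch_comp_complex[OF Y cY \<mu> hY x continuous_map_eval, symmetric])
    finally show "(\<integral>\<psi>. \<psi> \<phi> \<partial>stoch_comp X (spec_obj (C_obj Y)) ?s (h_map X) x)
        = (\<integral>\<psi>. \<psi> \<phi> \<partial>stoch_comp X (spec_obj (C_obj Y)) (h_map Y) \<mu> x)" .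
  qed
qed

section \<open>The Gelfand transform and the triangle identity at the spectrum\<close>

context comm_cstar_algebra
begin

lemma cnorm_Gelfand:
  assumes a: "a \<in> carrier A"
  shows "cnorm (C_obj (spec_obj A)) (Gelfand A a) = cnorm A a"
  by (simp add: cnorm_C_obj cnorm_eq_SUP[OF a] Gelfand_apply[OF a])

lemma Gelfand_in_pos_maps: "Gelfand A \<in> pos_maps A (C_obj (spec_obj A))"
proof (rule pos_mapsI[where K = 1])
  show "Gelfand A \<in> carrier A \<rightarrow>\<^sub>E carrier (C_obj (spec_obj A))"
    using Gelfand_closed by (auto simp: Gelfand_def)
  fix x assume x: "x \<in> carrier A"
  show "Gelfand A (c \<odot>\<^bsub>A\<^esub> x) = c \<odot>\<^bsub>C_obj (spec_obj A)\<^esub> Gelfand A x" for c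
    using x by (auto simp: Gelfand_apply charactersD(3) fun_eq_iff restrict_def)
  show "Gelfand A (x \<oplus>\<^bsub>A\<^esub> y) = Gelfand A x \<oplus>\<^bsub>C_obj (spec_obj A)\<^esub> Gelfand A y" if "y \<in> carrier A" for y
    using x that by (auto simp: Gelfand_apply charactersD(2) fun_eq_iff restrict_def)
  show "cnorm (C_obj (spec_obj A)) (Gelfand A x) \<le> 1 * cnorm A x" using cnorm_Gelfand[OF x] by simp
  have "Gelfand A (adj A x \<otimes>\<^bsub>A\<^esub> x) = adj (C_obj (spec_obj A)) (Gelfand A x) \<otimes>\<^bsub>C_obj (spec_obj A)\<^esub> Gelfand A x"
    using x adj_closed[OF x]
    by (auto simp: Gelfand_apply charactersD(4) character_adj fun_eq_iff restrict_def)
  then show "cpositive (C_obj (spec_obj A)) (Gelfand A (adj A x \<otimes>\<^bsub>A\<^esub> x))"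
    using Gelfand_closed[OF x] unfolding cpositive_def by blast
next
  show "Gelfand A \<one>\<^bsub>A\<^esub> = \<one>\<^bsub>C_obj (spec_obj A)\<^esub>"
    by (auto simp: Gelfand_apply character_one fun_eq_iff restrict_def)
qed

text \<open>The inverse is positive because \<open>gelfand_inv\<close> respects products and
  adjoints, and it is bounded by 1 because the Gelfand transform preserves the norm.\<close>

lemma pos_iso_Gelfand: "pos_iso A (C_obj (spec_obj A)) (Gelfand A)"
proof -
  let ?C = "C_obj (spec_obj A)"
  interpret C: comm_cstar_algebra ?C by (rule comm_cstar_algebra_C_obj[OF chaus_spec_obj])
  let ?g = "restrict gelfand_inv (carrier ?C)"
  have "?g \<in> pos_maps ?C A"
  proof (rule pos_mapsI[where K = 1])
    show "?g \<in> carrier ?C \<rightarrow>\<^sub>E carrier A" using gelfand_inv_closed by auto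
    fix \<phi> assume \<phi>: "\<phi> \<in> carrier ?C"
    show "?g (c \<odot>\<^bsub>?C\<^esub> \<phi>) = c \<odot>\<^bsub>A\<^esub> ?g \<phi>" for c
      using \<phi> C.scale_closed[OF \<phi>] gelfand_inv_scale[OF \<phi> \<phi>] by (simp del: C_obj_simps)
    show "?g (\<phi> \<oplus>\<^bsub>?C\<^esub> \<psi>) = ?g \<phi> \<oplus>\<^bsub>A\<^esub> ?g \<psi>" if \<psi>: "\<psi> \<in> carrier ?C" for \<psi>
      using \<phi> \<psi> C.add_closed[OF \<phi> \<psi>] gelfand_inv_add[OF \<phi> \<psi>] by (simp del: C_obj_simps)
    show "cnorm A (?g \<phi>) \<le> 1 * cnorm ?C \<phi>"
      using cnorm_Gelfand[OF gelfand_inv_closed[OF \<phi>]] Gelfand_gelfand_inv[OF \<phi>] \<phi> by simp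
    have "?g (adj ?C \<phi> \<otimes>\<^bsub>?C\<^esub> \<phi>) = adj A (gelfand_inv \<phi>) \<otimes>\<^bsub>A\<^esub> gelfand_inv \<phi>"
      using C.mult_closed[OF C.adj_closed[OF \<phi>] \<phi>] gelfand_inv_mult[OF C.adj_closed[OF \<phi>] \<phi>] gelfand_inv_adj[OF \<phi> \<phi>]
      by (simp del: C_obj_simps)
    then show "cpositive A (?g (adj ?C \<phi> \<otimes>\<^bsub>?C\<^esub> \<phi>))"
      using gelfand_inv_closed[OF \<phi>] unfolding cpositive_def by blast
  next
    show "?g \<one>\<^bsub>?C\<^esub> = \<one>\<^bsub>A\<^esub>" using gelfand_inv_one C.one_closed_A by (simp del: C_obj_simps)
  qed
  moreover have "pos_comp A ?g (Gelfand A) = pos_id A"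
    unfolding pos_comp_def compose_def pos_id_def
    using Gelfand_closed gelfand_inv_Gelfand by (intro restrict_ext) simp
  moreover have "pos_comp ?C (Gelfand A) ?g = pos_id ?C"
    unfolding pos_comp_def compose_def pos_id_def
    using Gelfand_gelfand_inv by (intro restrict_ext) simp
  ultimately show ?thesis using Gelfand_in_pos_maps unfolding pos_iso_def by blast
qed

text \<open>Tested on the evaluation at \<open>a\<close>, the Dirac measure selects the character
  \<open>h_fun (spec_obj A) \<omega>\<close>, whose value at the transform of \<open>a\<close> is
  \<open>\<omega> a\<close>.\<close>

lemma spec_map_Gelfand_h_map:
  "stoch_comp (spec_obj A) (spec_obj A) (spec_map A (C_obj (spec_obj A)) (Gelfand A)) (h_map (spec_obj A))
    = stoch_id (spec_obj A)"
proof -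
  note S = chaus_spec_obj
  note cS = chaus_spec_C_obj[OF S]
  note CS = comm_cstar_algebra_C_obj[OF S]
  note h = h_map_in_stoch[OF S]
  note s = spec_map_in_stoch[OF CS comm_cstar_algebra_axioms Gelfand_in_pos_maps]
  let ?s = "spec_map A (C_obj (spec_obj A)) (Gelfand A)"
  show ?thesis
  proof (rule stoch_spec_eqI[OF stoch_comp_in_stoch[OF cS S h s] stoch_id_in_stoch[OF S]])
    fix \<omega> a assume \<omega>: "\<omega> \<in> topspace (spec_obj A)" and a: "a \<in> carrier A"
    have "(\<integral>\<psi>. \<psi> a \<partial>stoch_comp (spec_obj A) (spec_obj A) ?s (h_map (spec_obj A)) \<omega>)
        = (\<integral>\<theta>. (\<integral>\<psi>. \<psi> a \<partial>?s \<theta>) \<partial>h_map (spec_obj A) \<omega>)"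
      by (rule integral_stoch_comp_complex[OF cS S h s \<omega> continuous_map_eval])
    also have "\<dots> = (\<integral>\<psi>. \<psi> a \<partial>?s (h_fun (spec_obj A) \<omega>))"
      by (rule integral_h_map[OF S \<omega> stochD(3)[OF s continuous_map_eval]])
    also have "\<dots> = h_fun (spec_obj A) \<omega> (Gelfand A a)"
      by (rule integral_spec_map[OF CS comm_cstar_algebra_axioms Gelfand_in_pos_maps h_fun_character[OF S \<omega>] a])
    also have "\<dots> = \<omega> a" using Gelfand_closed[OF a] \<omega> by (simp add: h_fun_def Gelfand_apply[OF a])
    finally show "(\<integral>\<psi>. \<psi> a \<partial>stoch_comp (spec_obj A) (spec_obj A) ?s (h_map (spec_obj A)) \<omega>)
        = (\<integral>\<psi>. \<psi> a \<partial>stoch_id (spec_obj A) \<omega>)"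
      by (simp add: integral_stoch_id[OF \<omega> continuous_map_eval])
  qed
qed

end

text \<open>At each element and character this is the defining equation of the representing
  measure.\<close>

lemma Gelfand_natural:
  assumes A: "comm_cstar_algebra A" and B: "comm_cstar_algebra B" and f: "f \<in> pos_maps B A"
  shows "pos_comp B (C_map (spec_obj A) (spec_obj B) (spec_map B A f)) (Gelfand B) = pos_comp B (Gelfand A) f"
  unfolding pos_comp_def compose_def
proof (rule restrict_ext)
  interpret A: comm_cstar_algebra A by (rule A)
  interpret B: comm_cstar_algebra B by (rule B)
  note s = spec_map_in_stoch[OF A B f]
  fix b assume b: "b \<in> carrier B"
  have "(\<integral>\<psi>. Gelfand B b \<psi> \<partial>spec_map B A f \<omega>) = \<omega> (f b)" if \<omega>: "\<omega> \<in> topspace (spec_obj A)" for \<omega>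
    using integral_restrict_topspace[OF prob_measD(1)[OF stochD(2)[OF s \<omega>]], of "\<lambda>\<psi>. \<psi> b"]
      integral_spec_map[OF A B f _ b, of \<omega>] \<omega>
    by (simp add: B.Gelfand_apply[OF b])
  then show "C_map (spec_obj A) (spec_obj B) (spec_map B A f) (Gelfand B b) = Gelfand A (f b)"
    unfolding C_map_apply[OF B.Gelfand_closed[OF b]] A.Gelfand_apply[OF pos_mapsD(2)[OF f b]]
    by (rule restrict_ext)
qed

text \<open>The functors change the carrier type of an object, so the laws are stated for objects
  over independent types. The triangle identities involve \<open>h\<close> itself and not its
  inverse, which \<open>stoch_iso\<close> provides.\<close>

theorem theorem4p162:
  shows
    "\<comment> \<open>cHausStoch is a category\<close>
     (\<forall>(X :: 'x topology). chaus X \<longrightarrow> stoch_id X \<in> stoch X X) \<and>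
     (\<forall>(X :: 'x topology) (Y :: 'y topology) (Z :: 'z topology). \<forall>\<mu>\<in>stoch X Y. \<forall>\<nu>\<in>stoch Y Z.
        chaus X \<longrightarrow> chaus Y \<longrightarrow> chaus Z \<longrightarrow> stoch_comp X Z \<nu> \<mu> \<in> stoch X Z) \<and>
     (\<forall>(X :: 'x topology) (Y :: 'y topology). \<forall>\<mu>\<in>stoch X Y. chaus X \<longrightarrow> chaus Y \<longrightarrow>
        stoch_comp X Y \<mu> (stoch_id X) = \<mu> \<and> stoch_comp X Y (stoch_id Y) \<mu> = \<mu>) \<and>
     (\<forall>(X :: 'x topology) (Y :: 'y topology) (Z :: 'z topology) (W :: 'w topology).
        \<forall>\<mu>\<in>stoch X Y. \<forall>\<nu>\<in>stoch Y Z. \<forall>\<kappa>\<in>stoch Z W.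
        chaus X \<longrightarrow> chaus Y \<longrightarrow> chaus Z \<longrightarrow> chaus W \<longrightarrow>
        stoch_comp X W (stoch_comp Y W \<kappa> \<nu>) \<mu> = stoch_comp X W \<kappa> (stoch_comp X Z \<nu> \<mu>)) \<and>
     \<comment> \<open>cC*-AlgPos is a category\<close>
     (\<forall>(A :: 'a cstar_algebra). comm_cstar_algebra A \<longrightarrow> pos_id A \<in> pos_maps A A) \<and>
     (\<forall>(A :: 'a cstar_algebra) (B :: 'b cstar_algebra) (D :: 'd cstar_algebra).
        \<forall>f\<in>pos_maps B A. \<forall>g\<in>pos_maps D B.
        comm_cstar_algebra A \<longrightarrow> comm_cstar_algebra B \<longrightarrow> comm_cstar_algebra D \<longrightarrow>
        pos_comp D f g \<in> pos_maps D A) \<and>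
     (\<forall>(A :: 'a cstar_algebra) (B :: 'b cstar_algebra). \<forall>f\<in>pos_maps B A.
        comm_cstar_algebra A \<longrightarrow> comm_cstar_algebra B \<longrightarrow>
        pos_comp B f (pos_id B) = f \<and> pos_comp B (pos_id A) f = f) \<and>
     (\<forall>(A :: 'a cstar_algebra) (B :: 'b cstar_algebra) (D :: 'd cstar_algebra)
        (E :: 'e cstar_algebra). \<forall>f\<in>pos_maps B A. \<forall>g\<in>pos_maps D B. \<forall>k\<in>pos_maps E D.
        comm_cstar_algebra A \<longrightarrow> comm_cstar_algebra B \<longrightarrow> comm_cstar_algebra D \<longrightarrow>
        comm_cstar_algebra E \<longrightarrow>
        pos_comp E (pos_comp D f g) k = pos_comp E f (pos_comp E g k)) \<and>
     \<comment> \<open>C is a contravariant functor\<close>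
     (\<forall>(X :: 'x topology). chaus X \<longrightarrow> comm_cstar_algebra (C_obj X)) \<and>
     (\<forall>(X :: 'x topology) (Y :: 'y topology). \<forall>\<mu>\<in>stoch X Y. chaus X \<longrightarrow> chaus Y \<longrightarrow>
        C_map X Y \<mu> \<in> pos_maps (C_obj Y) (C_obj X)) \<and>
     (\<forall>(X :: 'x topology). chaus X \<longrightarrow> C_map X X (stoch_id X) = pos_id (C_obj X)) \<and>
     (\<forall>(X :: 'x topology) (Y :: 'y topology) (Z :: 'z topology). \<forall>\<mu>\<in>stoch X Y. \<forall>\<nu>\<in>stoch Y Z.
        chaus X \<longrightarrow> chaus Y \<longrightarrow> chaus Z \<longrightarrow>
        C_map X Z (stoch_comp X Z \<nu> \<mu>) = pos_comp (C_obj Z) (C_map X Y \<mu>) (C_map Y Z \<nu>)) \<and>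
     \<comment> \<open>sigma is a well-defined contravariant functor\<close>
     (\<forall>(A :: 'a cstar_algebra). comm_cstar_algebra A \<longrightarrow> chaus (spec_obj A)) \<and>
     (\<forall>(A :: 'a cstar_algebra) (B :: 'b cstar_algebra). \<forall>f\<in>pos_maps B A.
        comm_cstar_algebra A \<longrightarrow> comm_cstar_algebra B \<longrightarrow>
        (\<forall>\<omega>\<in>characters A. \<exists>!M. represents B f \<omega> M) \<and>
        spec_map B A f \<in> stoch (spec_obj A) (spec_obj B)) \<and>
     (\<forall>(A :: 'a cstar_algebra). comm_cstar_algebra A \<longrightarrow>
        spec_map A A (pos_id A) = stoch_id (spec_obj A)) \<and>
     (\<forall>(A :: 'a cstar_algebra) (B :: 'b cstar_algebra) (D :: 'd cstar_algebra).
        \<forall>f\<in>pos_maps B A. \<forall>g\<in>pos_maps D B.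
        comm_cstar_algebra A \<longrightarrow> comm_cstar_algebra B \<longrightarrow> comm_cstar_algebra D \<longrightarrow>
        spec_map D A (pos_comp D f g)
          = stoch_comp (spec_obj A) (spec_obj D) (spec_map D B g) (spec_map B A f)) \<and>
     \<comment> \<open>h is a natural isomorphism\<close>
     (\<forall>(X :: 'x topology). chaus X \<longrightarrow> stoch_iso X (spec_obj (C_obj X)) (h_map X)) \<and>
     (\<forall>(X :: 'x topology) (Y :: 'y topology). \<forall>\<mu>\<in>stoch X Y. chaus X \<longrightarrow> chaus Y \<longrightarrow>
        stoch_comp X (spec_obj (C_obj Y)) (spec_map (C_obj Y) (C_obj X) (C_map X Y \<mu>)) (h_map X)
          = stoch_comp X (spec_obj (C_obj Y)) (h_map Y) \<mu>) \<and>
     \<comment> \<open>Gamma is a natural isomorphism\<close>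
     (\<forall>(A :: 'a cstar_algebra). comm_cstar_algebra A \<longrightarrow>
        pos_iso A (C_obj (spec_obj A)) (Gelfand A)) \<and>
     (\<forall>(A :: 'a cstar_algebra) (B :: 'b cstar_algebra). \<forall>f\<in>pos_maps B A.
        comm_cstar_algebra A \<longrightarrow> comm_cstar_algebra B \<longrightarrow>
        pos_comp B (C_map (spec_obj A) (spec_obj B) (spec_map B A f)) (Gelfand B)
          = pos_comp B (Gelfand A) f) \<and>
     \<comment> \<open>triangle identities\<close>
     (\<forall>(X :: 'x topology). chaus X \<longrightarrow>
        pos_comp (C_obj X) (C_map X (spec_obj (C_obj X)) (h_map X)) (Gelfand (C_obj X))
          = pos_id (C_obj X)) \<and>
     (\<forall>(A :: 'a cstar_algebra). comm_cstar_algebra A \<longrightarrow>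
        stoch_comp (spec_obj A) (spec_obj A)
          (spec_map A (C_obj (spec_obj A)) (Gelfand A)) (h_map (spec_obj A))
          = stoch_id (spec_obj A))"
proof (intro conjI allI ballI impI, goal_cases)
  case 1 then show ?case by (rule stoch_id_in_stoch)
next
  case 2 from 2(4,5,1,2) show ?case by (rule stoch_comp_in_stoch)
next
  case 3 from 3(2,3,1) show ?case by (rule stoch_comp_id_right)
next
  case 4 from 4(3,1) show ?case by (rule stoch_comp_id_left)
next
  case 5 from 5(5,6,7,1,2,3) show ?case by (rule stoch_comp_assoc)
next
  case 6 then show ?case by (rule pos_id_in_pos_maps)
next
  case 7 from 7(3,4,5,1,2) show ?case by (rule pos_comp_in_pos_maps)
next
  case 8 from 8(1) show ?case by (rule pos_comp_id)
next
  case 9 from 9(1) show ?case by (rule pos_comp_id)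
next
  case 10 from 10(3) show ?case by (rule pos_comp_assoc)
next
  case 11 then show ?case by (rule comm_cstar_algebra_C_obj)
next
  case 12 from 12(2,3,1) show ?case by (rule C_map_in_pos_maps)
next
  case 13 then show ?case by (rule C_map_id)
next
  case 14 from 14(4,5,1,2) show ?case by (rule C_map_comp)
next
  case 15 then show ?case by (rule comm_cstar_algebra.chaus_spec_obj)
next
  case 16 from 16(2,3,1,4) show ?case by (rule represents_unique)
next
  case 17 from 17(2,3,1) show ?case by (rule spec_map_in_stoch)
next
  case 18 then show ?case by (rule spec_map_id)
next
  case 19 from 19(3,4,5,1,2) show ?case by (rule spec_map_comp)
next
  case 20 then show ?case by (rule stoch_iso_h_map)
next
  case 21 from 21(2,3,1) show ?case by (rule h_map_natural)
next
  case 22 then show ?case by (rule comm_cstar_algebra.pos_iso_Gelfand)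
next
  case 23 from 23(2,3,1) show ?case by (rule Gelfand_natural)
next
  case 24 then show ?case by (rule C_map_h_map_Gelfand)
next
  case 25 then show ?case by (rule comm_cstar_algebra.spec_map_Gelfand_h_map)
qed

end
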